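(* There exists an algorithm that, given $A\in\mathbb{Z}^{m\times n}$ with $\gcd(A_{i,1},\dots,A_{i,n})=1$ for every row index $i$, $b\in\mathbb{Z}^m$ and $c\in\mathbb{Z}^n$, solves the integer programming problem $$\max\{c^Tx \colon Ax=b,\ x\geq 0,\ x\in\mathbb{Z}^n\}$$ in time bounded by $$\mathcal{O}\left(2^{2m}\cdot \Delta^{m^3+3m^2+2m}\cdot n^{m^3+5m^2+6m+1}\right),$$ where $\Delta=\max_{i,j}|A_{i,j}|$.
   Context: The implied constant in $\mathcal{O}(\cdot)$ is absolute (independent of $m$, $n$, $\Delta$, $A$, $b$, $c$). Running time is counted in elementary (arithmetic) operations; in particular the stated bound does not involve the encoding sizes of $b$ and $c$. *)

theory Defs
  imports "Jordan_Normal_Form.Matrix"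
begin

section \<open>Integer programs\<close>

definition ip_feasible :: "int mat \<Rightarrow> int vec \<Rightarrow> int vec set" where
  "ip_feasible A b =
     {x \<in> carrier_vec (dim_col A). A *\<^sub>v x = b \<and> (\<forall>j < dim_col A. 0 \<le> x $ j)}"

text \<open>Over the integers an objective that is bounded above on a nonempty feasible set attains its
  maximum, so exactly one of the following outcomes applies.\<close>

datatype ip_answer = Infeasible | Optimal "int vec" | Unbounded

fun ip_correct :: "int mat \<Rightarrow> int vec \<Rightarrow> int vec \<Rightarrow> ip_answer \<Rightarrow> bool" where
  "ip_correct A b c Infeasible \<longleftrightarrow> ip_feasible A b = {}"
| "ip_correct A b c (Optimal x) \<longleftrightarrow>
     x \<in> ip_feasible A b \<and> (\<forall>y \<in> ip_feasible A b. c \<bullet> y \<le> c \<bullet> x)"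
| "ip_correct A b c Unbounded \<longleftrightarrow> (\<forall>K. \<exists>x \<in> ip_feasible A b. K < c \<bullet> x)"

text \<open>The set below is nonempty only if the matrix has at least one row and one column.\<close>

definition max_abs_entry :: "int mat \<Rightarrow> nat" where
  "max_abs_entry A = nat (Max {\<bar>A $$ (i, j)\<bar> | i j. i < dim_row A \<and> j < dim_col A})"


section \<open>Algorithms and their running time\<close>

text \<open>An algorithm is a while program over unbounded integers: the structured form of a
  random access machine with unit cost per elementary operation (addition, subtraction,
  multiplication, floor division, comparison, logical connective, constant, memory access,
  jump). The memory consists of named arrays indexed by integers; a scalar is cell 0 of its array.

  Floor division has to be among the elementary operations: the least \<open>z \<ge> 0\<close> for which
  \<open>2 x - 2 y + 3 z = b\<close> has a solution \<open>x, y \<ge> 0\<close> is \<open>b mod 2\<close>, which cannot be computed from \<open>b\<close>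
  with a number of additions, subtractions, multiplications and comparisons independent of \<open>b\<close>.\<close>

type_synonym state = "string \<Rightarrow> int \<Rightarrow> int"

datatype iexp =
    Const int
  | Cell string iexp
  | Add iexp iexp
  | Sub iexp iexp
  | Mul iexp iexp
  | Quot iexp iexp

datatype bexp =
    Lt iexp iexp
  | Neg bexp
  | Conj bexp bexp

datatype com =
    Skip
  | Assign string iexp iexp
  | Seq com com
  | If bexp com com
  | While bexp com

text \<open>Integer division \<open>div\<close> rounds towards minus infinity, and \<open>x div 0 = 0\<close>.\<close>

fun ival :: "iexp \<Rightarrow> state \<Rightarrow> int" where
  "ival (Const k) s = k"
| "ival (Cell a e) s = s a (ival e s)"
| "ival (Add e f) s = ival e s + ival f s"
| "ival (Sub e f) s = ival e s - ival f s"
| "ival (Mul e f) s = ival e s * ival f s"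
| "ival (Quot e f) s = ival e s div ival f s"

fun bval :: "bexp \<Rightarrow> state \<Rightarrow> bool" where
  "bval (Lt e f) s \<longleftrightarrow> ival e s < ival f s"
| "bval (Neg p) s \<longleftrightarrow> \<not> bval p s"
| "bval (Conj p q) s \<longleftrightarrow> bval p s \<and> bval q s"

fun itime :: "iexp \<Rightarrow> nat" where
  "itime (Const k) = 1"
| "itime (Cell a e) = itime e + 1"
| "itime (Add e f) = itime e + itime f + 1"
| "itime (Sub e f) = itime e + itime f + 1"
| "itime (Mul e f) = itime e + itime f + 1"
| "itime (Quot e f) = itime e + itime f + 1"

fun btime :: "bexp \<Rightarrow> nat" where
  "btime (Lt e f) = itime e + itime f + 1"
| "btime (Neg p) = btime p + 1"
| "btime (Conj p q) = btime p + btime q + 1"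

text \<open>\<open>exec p s t s'\<close>: program \<open>p\<close> started in \<open>s\<close> terminates in \<open>s'\<close> after \<open>t\<close> elementary
  operations. The command \<open>Assign a e f\<close> stores the value of \<open>f\<close> in cell \<open>e\<close> of array \<open>a\<close>.\<close>

inductive exec :: "com \<Rightarrow> state \<Rightarrow> nat \<Rightarrow> state \<Rightarrow> bool" where
  Skip: "exec Skip s 1 s"
| Assign: "exec (Assign a e f) s (itime e + itime f + 1) (s(a := (s a)(ival e s := ival f s)))"
| Seq: "exec p s t s' \<Longrightarrow> exec q s' u s'' \<Longrightarrow> exec (Seq p q) s (t + u) s''"
| IfTrue: "bval \<beta> s \<Longrightarrow> exec p s t s' \<Longrightarrow> exec (If \<beta> p q) s (btime \<beta> + 1 + t) s'"
| IfFalse: "\<not> bval \<beta> s \<Longrightarrow> exec q s t s' \<Longrightarrow> exec (If \<beta> p q) s (btime \<beta> + 1 + t) s'"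
| WhileFalse: "\<not> bval \<beta> s \<Longrightarrow> exec (While \<beta> p) s (btime \<beta> + 1) s"
| WhileTrue: "bval \<beta> s \<Longrightarrow> exec p s t s' \<Longrightarrow> exec (While \<beta> p) s' u s'' \<Longrightarrow>
    exec (While \<beta> p) s (btime \<beta> + 1 + t + u) s''"

inductive_cases exec_elims:
  "exec Skip s t s'"
  "exec (Assign a e f) s t s'"
  "exec (Seq p q) s t s'"
  "exec (If \<beta> p q) s t s'"
  "exec (While \<beta> p) s t s'"

lemma exec_deterministic:
  "exec p s t s' \<Longrightarrow> exec p s u s'' \<Longrightarrow> u = t \<and> s'' = s'"
proof (induction arbitrary: u s'' rule: exec.induct)
  case (Skip s)
  then show ?case by (rule exec_elims(1)) simp
next
  case (Assign a e f s)
  then show ?case by (rule exec_elims(2)) simp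
next
  case (Seq p s t s' q v s2)
  from Seq.prems show ?case
    by (rule exec_elims(3)) (use Seq.IH in fastforce)
next
  case (IfTrue \<beta> s p t s' q)
  from IfTrue.prems show ?case
    by (rule exec_elims(4)) (use IfTrue.IH in fastforce, simp add: IfTrue.hyps(1))
next
  case (IfFalse \<beta> s q t s' p)
  from IfFalse.prems show ?case
    by (rule exec_elims(4)) (simp add: IfFalse.hyps(1), use IfFalse.IH in fastforce)
next
  case (WhileFalse \<beta> s p)
  from WhileFalse.prems show ?case
    by (rule exec_elims(5)) (simp_all add: WhileFalse.hyps)
next
  case (WhileTrue \<beta> s p t s' v s2)
  from WhileTrue.prems show ?case
    by (rule exec_elims(5)) (simp add: WhileTrue.hyps(1), use WhileTrue.IH in fastforce)
qed


section \<open>Input and output\<close>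

text \<open>The matrix is stored row by row; every memory cell that holds no input is zero.\<close>

definition ip_input :: "int mat \<Rightarrow> int vec \<Rightarrow> int vec \<Rightarrow> state" where
  "ip_input A b c = (\<lambda>a k.
     if a = ''m'' \<and> k = 0 then int (dim_row A)
     else if a = ''n'' \<and> k = 0 then int (dim_col A)
     else if a = ''A'' \<and> 0 \<le> k \<and> k < int (dim_row A * dim_col A)
       then A $$ (nat k div dim_col A, nat k mod dim_col A)
     else if a = ''b'' \<and> 0 \<le> k \<and> k < int (dim_vec b) then b $ nat k
     else if a = ''c'' \<and> 0 \<le> k \<and> k < int (dim_vec c) then c $ nat k
     else 0)"

definition ip_output :: "nat \<Rightarrow> state \<Rightarrow> ip_answer" where
  "ip_output n s =
     (if s ''status'' 0 = 0 then Infeasible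
      else if s ''status'' 0 = 1 then Optimal (vec n (\<lambda>j. s ''x'' (int j)))
      else Unbounded)"

end

theory Submission
  imports Defs
begin

text \<open>
  Put \<open>M = (n \<Delta>)^m\<close>. By the pigeonhole principle every linearly dependent set of columns carries an
  integral kernel vector with entries below \<open>M\<close>; moving along such vectors turns a feasible point,
  without loss in the objective unless a short improving ray exists, into one whose entries are
  smaller than \<open>M - 1\<close> outside a linearly independent set \<open>B\<close> of columns. Hence \<open>x = u + y\<close> with
  \<open>u \<ge> 0\<close>, \<open>\<Sum> u \<le> D = n (M - 1)\<close>, and \<open>y\<close> supported on \<open>B\<close>, so that \<open>y\<close> is determined by \<open>b - A u\<close>.

  Since only the value \<open>A u\<close> and the cost of \<open>u\<close> matter, the small parts are enumerated by a knapsack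
  recursion: the column \<open>j\<close> is encoded by the positive weight \<open>w_j = K^m + \<Sum>_i A_ij K^i\<close>, and for
  \<open>K = 4 (D + 1) \<Delta>\<close> the total weight of \<open>u\<close> determines \<open>A u\<close>. The coordinate \<open>y_j\<close> is \<open>l (b - A u) / (l a_j)\<close> for
  some \<open>l \<in> {-M..M}^m\<close> vanishing on the other columns of \<open>B\<close>, again by the pigeonhole principle; the
  program runs through all choices of columns and functionals and keeps the best feasible candidate.
  The problem is unbounded if and only if it is feasible and the knapsack table contains a short
  improving ray, i.e. an entry of positive value whose weight is a multiple of \<open>K^m\<close>.
\<close>

section \<open>Small solutions of homogeneous linear systems\<close>

text \<open>For \<open>n \<ge> 2\<close> the powers of \<open>M\<close> arise as follows: the table
  has at most \<open>2 * 4^m * n * M^(m+2)\<close> cells, and \<open>r \<le> m\<close> functionals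
  with \<open>m\<close> coefficients each give \<open>M^(m^2)\<close> choices, times a power of 3
  that \<open>M^(2*m)\<close> absorbs. Together this is \<open>M^(m^2+3*m+2)\<close>, exactly the
  power of \<open>\<Delta>\<close> that is allowed. The tight case is \<open>n = 1\<close>: the gcd
  condition then forces \<open>\<Delta> = 1\<close>, only a constant times \<open>4^m\<close> is
  allowed, and the program fits because large entries start at \<open>M - 1\<close> (so
  \<open>D = 0\<close> and the table has one cell) and because \<open>r\<close> is
  \<open>min m n\<close> rather than \<open>m\<close>. The pigeonhole principle needs fewer
  equations than unknowns, which redundant rows can spoil. Minimal sets of rows with the same kernel
  repair this and stand in for the rank. An improving ray blocks the reduction of large entries, yet
  infeasibility must be recognised in its presence too. The reduction is therefore also applied with
  the objective zero, which no ray improves.\<close>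

lemma siegel_box:
  fixes a :: "'r \<Rightarrow> 't \<Rightarrow> int" and \<delta> X :: nat
  assumes "finite R" "finite T"
    and a: "\<And>r t. r \<in> R \<Longrightarrow> t \<in> T \<Longrightarrow> \<bar>a r t\<bar> \<le> int \<delta>"
    and count: "(card T * \<delta> * X + 1) ^ card R < (X + 1) ^ card T"
  shows "\<exists>g. (\<exists>t\<in>T. g t \<noteq> 0) \<and> (\<forall>t. \<bar>g t\<bar> \<le> int X) \<and> (\<forall>t. t \<notin> T \<longrightarrow> g t = 0)
           \<and> (\<forall>r\<in>R. (\<Sum>t\<in>T. a r t * g t) = 0)"
proof -
  define F where "F = PiE T (\<lambda>_. {0..int X})"
  define \<phi> where "\<phi> f = restrict (\<lambda>r. \<Sum>t\<in>T. a r t * f t) R" for f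
  \<comment> \<open>\<open>lo r\<close> is the least value of row \<open>r\<close> on the box. Each
    coefficient stretches the range at one end only, so its length is
    \<open>card T * \<delta> * X\<close>, half that of the symmetric interval; the factor 2 saved
    here keeps \<open>M\<close> at \<open>(n * \<Delta>)^m\<close>.\<close>
  define lo where "lo r = (\<Sum>t\<in>T. min 0 (a r t) * int X)" for r
  have cF: "card F = (X + 1) ^ card T"
    unfolding F_def by (simp add: card_PiE \<open>finite T\<close> nat_add_distrib)
  have "\<phi> ` F \<subseteq> PiE R (\<lambda>r. {lo r..lo r + int (card T * \<delta> * X)})" (is "_ \<subseteq> ?B")
  proof
    fix y assume "y \<in> \<phi> ` F"
    then obtain f where f: "f \<in> F" and y: "y = \<phi> f" by blast
    have ft: "0 \<le> f t" "f t \<le> int X" if "t \<in> T" for t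
      using f that unfolding F_def by (auto simp: PiE_iff)
    have "lo r \<le> (\<Sum>t\<in>T. a r t * f t)
        \<and> (\<Sum>t\<in>T. a r t * f t) \<le> lo r + int (card T * \<delta> * X)" if r: "r \<in> R" for r
    proof
      show "lo r \<le> (\<Sum>t\<in>T. a r t * f t)"
        unfolding lo_def
      proof (rule sum_mono)
        fix t assume t: "t \<in> T"
        have "min 0 (a r t) * int X \<le> min 0 (a r t) * f t"
          using ft[OF t] by (intro mult_left_mono_neg) auto
        also have "\<dots> \<le> a r t * f t"
          using ft[OF t] by (intro mult_right_mono) auto
        finally show "min 0 (a r t) * int X \<le> a r t * f t" .
      qed
      have "(\<Sum>t\<in>T. a r t * f t) - lo r = (\<Sum>t\<in>T. a r t * f t - min 0 (a r t) * int X)"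
        unfolding lo_def by (simp add: sum_subtractf)
      also have "\<dots> \<le> (\<Sum>t\<in>T. int \<delta> * int X)"
      proof (rule sum_mono)
        fix t assume t: "t \<in> T"
        have "a r t * f t - min 0 (a r t) * int X \<le> \<bar>a r t\<bar> * int X"
        proof (cases "0 \<le> a r t")
          case True
          then show ?thesis using ft[OF t] by (auto intro: mult_left_mono)
        next
          case False
          then have "a r t * f t \<le> 0" using ft[OF t] by (simp add: mult_nonpos_nonneg)
          then show ?thesis using False by (simp add: min_def)
        qed
        also have "\<dots> \<le> int \<delta> * int X" using a[OF r t] by (intro mult_right_mono) auto
        finally show "a r t * f t - min 0 (a r t) * int X \<le> int \<delta> * int X" .
      qed
      also have "\<dots> = int (card T * \<delta> * X)" by simp
      finally show "(\<Sum>t\<in>T. a r t * f t) \<le> lo r + int (card T * \<delta> * X)" by simp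
    qed
    then show "y \<in> ?B" unfolding y \<phi>_def by auto
  qed
  moreover have "finite ?B" using \<open>finite R\<close> by (intro finite_PiE) auto
  moreover have "card ?B = (card T * \<delta> * X + 1) ^ card R"
    by (simp add: card_PiE \<open>finite R\<close> nat_add_distrib nat_mult_distrib)
  ultimately have "card (\<phi> ` F) < card F"
    using count cF card_mono by (metis le_less_trans)
  then have "\<not> inj_on \<phi> F" using card_image by fastforce
  then obtain f f' where ff: "f \<in> F" "f' \<in> F" "\<phi> f = \<phi> f'" "f \<noteq> f'" by (auto simp: inj_on_def)
  define g where "g t = (if t \<in> T then f t - f' t else 0)" for t
  have "\<exists>t\<in>T. f t \<noteq> f' t" using ff unfolding F_def using PiE_ext by blast
  then have "\<exists>t\<in>T. g t \<noteq> 0" by (auto simp: g_def)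
  moreover have "\<bar>g t\<bar> \<le> int X" for t
  proof (cases "t \<in> T")
    case True
    then have "f t \<in> {0..int X}" "f' t \<in> {0..int X}" using ff unfolding F_def by (auto simp: PiE_iff)
    then show ?thesis by (auto simp: g_def)
  qed (simp add: g_def)
  moreover have "(\<Sum>t\<in>T. a r t * g t) = 0" if "r \<in> R" for r
  proof -
    have "\<phi> f r = \<phi> f' r" using ff by simp
    then show ?thesis using that by (simp add: \<phi>_def g_def right_diff_distrib sum_subtractf)
  qed
  ultimately show ?thesis by (intro exI[of _ g]) (auto simp: g_def)
qed

text \<open>The count works because \<open>N * X + 1 \<le> N * (X + 1)\<close>. Only
  \<open>1 \<le> N\<close> is required, so the bound on the functionals covers
  \<open>n * \<Delta> = 1\<close>.\<close>

lemma siegel: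
  fixes a :: "'r \<Rightarrow> 't \<Rightarrow> int" and \<delta> N p :: nat
  assumes fin: "finite R" "finite T"
    and a: "\<And>r t. r \<in> R \<Longrightarrow> t \<in> T \<Longrightarrow> \<bar>a r t\<bar> \<le> int \<delta>"
    and N: "card T * \<delta> \<le> N" "1 \<le> N" and RT: "card R < card T" and p: "card R \<le> p"
  shows "\<exists>g. (\<exists>t\<in>T. g t \<noteq> 0) \<and> (\<forall>t. \<bar>g t\<bar> \<le> int (N ^ p)) \<and> (\<forall>t. t \<notin> T \<longrightarrow> g t = 0)
           \<and> (\<forall>r\<in>R. (\<Sum>t\<in>T. a r t * g t) = 0)"
proof (rule siegel_box[OF fin a])
  let ?X = "N ^ p"
  have "(card T * \<delta> * ?X + 1) ^ card R \<le> (N * ?X + N) ^ card R"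
    using N by (intro power_mono add_mono mult_right_mono) auto
  also have "\<dots> = N ^ card R * (?X + 1) ^ card R"
    by (simp add: power_mult_distrib[symmetric] algebra_simps)
  also have "\<dots> \<le> ?X * (?X + 1) ^ card R"
    using N p by (intro mult_right_mono power_increasing) auto
  also have "\<dots> < (?X + 1) ^ Suc (card R)" by simp
  also have "\<dots> \<le> (?X + 1) ^ card T" using RT by (intro power_increasing) auto
  finally show "(card T * \<delta> * ?X + 1) ^ card R < (?X + 1) ^ card T" .
qed auto

text \<open>For \<open>N \<ge> 2\<close> the inequality \<open>N * X + 1 < N * (X + 1)\<close> is
  strict, and one unit is gained over \<open>siegel\<close>. This gain allows
  \<open>D = n * (M - 1)\<close>, which is 0 when \<open>n = \<Delta> = 1\<close>.\<close>

lemma siegel_less: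
  fixes a :: "'r \<Rightarrow> 't \<Rightarrow> int" and \<delta> N p :: nat
  assumes fin: "finite R" "finite T"
    and a: "\<And>r t. r \<in> R \<Longrightarrow> t \<in> T \<Longrightarrow> \<bar>a r t\<bar> \<le> int \<delta>"
    and N: "card T * \<delta> \<le> N" "2 \<le> N" and RT: "card R < card T" and p: "card R \<le> p" "1 \<le> p"
  shows "\<exists>g. (\<exists>t\<in>T. g t \<noteq> 0) \<and> (\<forall>t. \<bar>g t\<bar> \<le> int (N ^ p - 1)) \<and> (\<forall>t. t \<notin> T \<longrightarrow> g t = 0)
           \<and> (\<forall>r\<in>R. (\<Sum>t\<in>T. a r t * g t) = 0)"
proof (rule siegel_box[OF fin a])
  let ?X = "N ^ p - 1"
  have "N ^ 1 \<le> N ^ p" using N p by (intro power_increasing) auto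
  then have X: "?X + 1 = N ^ p" "1 \<le> ?X" using N by auto
  show "(card T * \<delta> * ?X + 1) ^ card R < (?X + 1) ^ card T"
  \<comment> \<open>A strict inequality between the bases survives only a positive exponent.\<close>
  proof (cases "card R = 0")
    case True
    then show ?thesis using X RT one_less_power[of "?X + 1" "card T"] by simp
  next
    case False
    have "card T * \<delta> * ?X + 1 \<le> N * ?X + 1" using N by (simp add: mult_right_mono)
    also have "\<dots> < N * (?X + 1)" unfolding distrib_left using N by simp
    finally have "(card T * \<delta> * ?X + 1) ^ card R < (N * (?X + 1)) ^ card R"
      using False by (intro power_strict_mono) auto
    also have "\<dots> = N ^ card R * (?X + 1) ^ card R" by (rule power_mult_distrib)
    also have "\<dots> \<le> (?X + 1) * (?X + 1) ^ card R"
      unfolding X(1) using N p by (intro mult_right_mono power_increasing) auto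
    also have "\<dots> \<le> (?X + 1) ^ card T"
      using RT X power_increasing[of "Suc (card R)" "card T" "?X + 1"] by simp
    finally show ?thesis .
  qed
qed auto

text \<open>Any finite family of coefficients is bounded by the sum of its absolute values, so
  \<open>siegel\<close> applies. This qualitative form replaces rank arguments over the
  rationals.\<close>

lemma nontrivial_kernel:
  fixes a :: "'r \<Rightarrow> 't \<Rightarrow> int"
  assumes fin: "finite R" "finite T" and "card R < card T"
  shows "\<exists>g. (\<exists>t\<in>T. g t \<noteq> 0) \<and> (\<forall>t. t \<notin> T \<longrightarrow> g t = 0) \<and> (\<forall>r\<in>R. (\<Sum>t\<in>T. a r t * g t) = 0)"
proof -
  define \<delta> where "\<delta> = nat (\<Sum>(r, t)\<in>R \<times> T. \<bar>a r t\<bar>)"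
  have "\<bar>a r t\<bar> \<le> int \<delta>" if "r \<in> R" "t \<in> T" for r t
  proof -
    have "(\<lambda>(r, t). \<bar>a r t\<bar>) (r, t) \<le> (\<Sum>(r, t)\<in>R \<times> T. \<bar>a r t\<bar>)"
      using fin that by (intro member_le_sum) auto
    also have "\<dots> \<le> int \<delta>" by (simp add: \<delta>_def)
    finally show ?thesis by simp
  qed
  then show ?thesis
    using siegel[OF fin, of a \<delta> "card T * \<delta> + 1" "card R"] assms(3) by auto
qed

section \<open>Kernels on a set of columns, with minimal row sets in place of the rank\<close>

definition int_kernel :: "('i \<Rightarrow> 'j \<Rightarrow> int) \<Rightarrow> 'i set \<Rightarrow> 'j set \<Rightarrow> ('j \<Rightarrow> int) set" where
  "int_kernel A I S = {g. (\<forall>j. j \<notin> S \<longrightarrow> g j = 0) \<and> (\<forall>i\<in>I. (\<Sum>j\<in>S. A i j * g j) = 0)}"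

text \<open>Clearing denominators shows that this is linear independence over the rationals.\<close>

definition independent_columns :: "('i \<Rightarrow> 'j \<Rightarrow> int) \<Rightarrow> 'i set \<Rightarrow> 'j set \<Rightarrow> bool" where
  "independent_columns A I S \<longleftrightarrow> (\<forall>g \<in> int_kernel A I S. \<forall>j\<in>S. g j = 0)"

text \<open>Among the row sets with no larger kernel than \<open>R\<close>, take one of least
  cardinality: dropping a row \<open>i\<close> must enlarge the kernel, and a new kernel vector is
  \<open>z i\<close>. The vectors \<open>z i\<close> are dual to the rows of \<open>I\<close> up to
  scaling.\<close>

lemma minimal_rows:
  assumes "finite R"
  shows "\<exists>I z. I \<subseteq> R \<and> int_kernel A I S \<subseteq> int_kernel A R S
    \<and> (\<forall>i\<in>I. z i \<in> int_kernel A (I - {i}) S \<and> (\<Sum>j\<in>S. A i j * z i j) \<noteq> 0)"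
proof -
  define P where "P I \<longleftrightarrow> I \<subseteq> R \<and> int_kernel A I S \<subseteq> int_kernel A R S" for I
  have "P R" by (simp add: P_def)
  then obtain I where I: "P I" and least: "\<And>J. P J \<Longrightarrow> card I \<le> card J"
    using ex_has_least_nat[of P R card] by blast
  have "\<exists>z. z \<in> int_kernel A (I - {i}) S \<and> (\<Sum>j\<in>S. A i j * z j) \<noteq> 0" if i: "i \<in> I" for i
  proof -
    have "finite I" using I assms finite_subset by (auto simp: P_def)
    then have "card (I - {i}) < card I" using i by (rule card_Diff1_less)
    then have "\<not> P (I - {i})" using least by fastforce
    then obtain z where z: "z \<in> int_kernel A (I - {i}) S" "z \<notin> int_kernel A R S"
      using I by (auto simp: P_def)
    then have "z \<notin> int_kernel A I S" using I by (auto simp: P_def)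
    then show ?thesis using z(1) by (auto simp: int_kernel_def)
  qed
  then obtain z where "\<And>i. i \<in> I \<Longrightarrow> z i \<in> int_kernel A (I - {i}) S \<and> (\<Sum>j\<in>S. A i j * z i j) \<noteq> 0"
    by metis
  then show ?thesis using I unfolding P_def by blast
qed

text \<open>A dependent set may have no more columns than there are rows, so
  \<open>siegel_less\<close> cannot be applied to \<open>R\<close> itself. A minimal row set
  \<open>I\<close> does have fewer than \<open>card S\<close> rows: otherwise \<open>g\<close> and
  the vectors \<open>z i\<close> would be more than \<open>card S\<close> vectors with
  \<open>card S\<close> coordinates, and a dependence between them would force \<open>g\<close> to
  vanish.\<close>

lemma bounded_kernel:
  fixes A :: "'i \<Rightarrow> 'j \<Rightarrow> int" and \<delta> N :: nat
  assumes fin: "finite R" "finite S"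
    and A: "\<And>i j. i \<in> R \<Longrightarrow> j \<in> S \<Longrightarrow> \<bar>A i j\<bar> \<le> int \<delta>"
    and N: "card S * \<delta> \<le> N" "2 \<le> N" and "1 \<le> card R"
    and dep: "\<not> independent_columns A R S"
  shows "\<exists>h \<in> int_kernel A R S. (\<exists>j\<in>S. h j \<noteq> 0) \<and> (\<forall>j. \<bar>h j\<bar> \<le> int (N ^ card R - 1))"
proof -
  obtain g where g: "g \<in> int_kernel A R S" "\<exists>j\<in>S. g j \<noteq> 0"
    using dep by (auto simp: independent_columns_def)
  obtain I z where I: "I \<subseteq> R" "int_kernel A I S \<subseteq> int_kernel A R S"
    and z: "\<And>i. i \<in> I \<Longrightarrow> z i \<in> int_kernel A (I - {i}) S"
    and z': "\<And>i. i \<in> I \<Longrightarrow> (\<Sum>j\<in>S. A i j * z i j) \<noteq> 0"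
    using minimal_rows[OF fin(1), of A S] by blast
  have finI: "finite I" using I fin finite_subset by blast
  have "card I < card S"
  proof (rule ccontr)
    assume "\<not> card I < card S"
    define v where "v j t = (case t of None \<Rightarrow> g j | Some i \<Rightarrow> z i j)" for j t
    define T where "T = insert None (Some ` I)"
    have finT: "finite T" using finI by (simp add: T_def)
    have "card T = card I + 1" using finI by (simp add: T_def card_image)
    then have "card S < card T" using \<open>\<not> card I < card S\<close> by simp
    then obtain \<mu> where \<mu>: "\<exists>t\<in>T. \<mu> t \<noteq> 0" "\<And>j. j \<in> S \<Longrightarrow> (\<Sum>t\<in>T. v j t * \<mu> t) = 0"
      using nontrivial_kernel[OF fin(2) finT, of v] by metis
    \<comment> \<open>Row \<open>i\<close> annihilates \<open>g\<close> and every
      \<open>z i'\<close> with \<open>i' \<noteq> i\<close>, so applying it to the dependence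
      isolates the coefficient of \<open>z i\<close>.\<close>
    have "\<mu> (Some i) = 0" if i: "i \<in> I" for i
    proof -
      have "0 = (\<Sum>j\<in>S. A i j * (\<Sum>t\<in>T. v j t * \<mu> t))" using \<mu>(2) by simp
      also have "\<dots> = (\<Sum>t\<in>T. \<mu> t * (\<Sum>j\<in>S. A i j * v j t))"
        by (simp add: sum_distrib_left mult_ac) (rule sum.swap)
      also have "\<dots> = (\<Sum>t\<in>T. if t = Some i then \<mu> t * (\<Sum>j\<in>S. A i j * z i j) else 0)"
      proof (rule sum.cong[OF refl])
        fix t assume t: "t \<in> T"
        show "\<mu> t * (\<Sum>j\<in>S. A i j * v j t)
            = (if t = Some i then \<mu> t * (\<Sum>j\<in>S. A i j * z i j) else 0)"
        proof (cases t)
          case None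
          then show ?thesis using g(1) i I(1) by (auto simp: v_def int_kernel_def)
        next
          case (Some i')
          then have "i' \<in> I" using t by (auto simp: T_def)
          with Some show ?thesis using z[of i'] i by (auto simp: v_def int_kernel_def)
        qed
      qed
      also have "\<dots> = \<mu> (Some i) * (\<Sum>j\<in>S. A i j * z i j)"
        using i finT by (subst sum.delta) (auto simp: T_def)
      finally show ?thesis using z'[OF i] by simp
    qed
    then have *: "\<forall>i\<in>I. \<mu> (Some i) = 0" by blast
    then have "\<mu> None \<noteq> 0" using \<mu>(1) by (auto simp: T_def)
    moreover have "g j * \<mu> None = 0" if "j \<in> S" for j
      using \<mu>(2)[OF that] * finI by (simp add: T_def v_def sum.reindex)
    ultimately show False using g(2) by auto
  qed
  moreover have "card I \<le> card R" using I(1) fin(1) by (rule card_mono[rotated])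
  ultimately obtain h where h: "\<exists>j\<in>S. h j \<noteq> 0" "\<forall>j. \<bar>h j\<bar> \<le> int (N ^ card R - 1)"
    "\<forall>j. j \<notin> S \<longrightarrow> h j = 0" "\<forall>i\<in>I. (\<Sum>j\<in>S. A i j * h j) = 0"
    using siegel_less[OF finI fin(2), of A \<delta> N "card R"] A I(1) N assms(6) by (auto simp: subset_iff)
  then have "h \<in> int_kernel A R S" using I(2) by (auto simp: int_kernel_def)
  then show ?thesis using h by blast
qed

text \<open>Vanishing on the columns other than \<open>j\<close> is a system of
  \<open>card B - 1\<close> equations; restricted to \<open>card B\<close> rows of a minimal row set
  it has a small nonzero solution \<open>l\<close>. If \<open>l\<close> vanished on column
  \<open>j\<close> as well, it would be zero on the span of \<open>B\<close>, contradicting the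
  vectors dual to the rows.\<close>

lemma separating_functional:
  fixes A :: "'i \<Rightarrow> 'j \<Rightarrow> int" and \<delta> N :: nat
  assumes fin: "finite R" "finite B"
    and A: "\<And>i j. i \<in> R \<Longrightarrow> j \<in> B \<Longrightarrow> \<bar>A i j\<bar> \<le> int \<delta>"
    and N: "card B * \<delta> \<le> N" "1 \<le> N"
    and ind: "independent_columns A R B" and j: "j \<in> B"
  shows "\<exists>l. (\<forall>i. \<bar>l i\<bar> \<le> int (N ^ card R)) \<and> (\<Sum>i\<in>R. l i * A i j) \<noteq> 0
           \<and> (\<forall>j'\<in>B - {j}. (\<Sum>i\<in>R. l i * A i j') = 0)"
proof -
  obtain I z where I: "I \<subseteq> R" "int_kernel A I B \<subseteq> int_kernel A R B"
    and z: "\<And>i. i \<in> I \<Longrightarrow> z i \<in> int_kernel A (I - {i}) B"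
    and z': "\<And>i. i \<in> I \<Longrightarrow> (\<Sum>j\<in>B. A i j * z i j) \<noteq> 0"
    using minimal_rows[OF fin(1), of A B] by blast
  have finI: "finite I" using I fin finite_subset by blast
  have "card B \<le> card I"
  proof (rule ccontr)
    assume "\<not> card B \<le> card I"
    then obtain g where "\<exists>j\<in>B. g j \<noteq> 0" "g \<in> int_kernel A I B"
      using nontrivial_kernel[OF finI fin(2), of A] by (auto simp: int_kernel_def)
    then show False using I(2) ind by (auto simp: independent_columns_def)
  qed
  \<comment> \<open>Using only \<open>card B\<close> of the rows makes \<open>card B\<close> the
    number of unknowns, for which \<open>N\<close> is large enough.\<close>
  then obtain T where T: "T \<subseteq> I" "card T = card B" using obtain_subset_with_card_n by metis
  have finT: "finite T" using T finI finite_subset by blast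
  have TR: "T \<subseteq> R" using T I by blast
  have "card (B - {j}) < card T" unfolding T(2) using fin(2) j by (rule card_Diff1_less)
  moreover have "card T \<le> card R" using TR fin(1) by (rule card_mono[rotated])
  ultimately obtain l where l: "\<exists>i\<in>T. l i \<noteq> 0" "\<forall>i. \<bar>l i\<bar> \<le> int (N ^ card R)"
    "\<forall>i. i \<notin> T \<longrightarrow> l i = 0" "\<forall>j'\<in>B - {j}. (\<Sum>i\<in>T. A i j' * l i) = 0"
    using siegel[of "B - {j}" T "\<lambda>j i. A i j" \<delta> N "card R"] A TR N fin finT T(2)
    by (auto simp: subset_iff)
  have RT: "(\<Sum>i\<in>R. l i * q i) = (\<Sum>i\<in>T. q i * l i)" for q
    using TR fin(1) l(3) by (subst mult.commute) (intro sum.mono_neutral_cong_right, auto)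
  have "(\<Sum>i\<in>T. A i j * l i) \<noteq> 0"
  proof
    assume "(\<Sum>i\<in>T. A i j * l i) = 0"
    then have 0: "(\<Sum>i\<in>T. A i j' * l i) = 0" if "j' \<in> B" for j' using l(4) that by (cases "j' = j") auto
    obtain i where i: "i \<in> T" "l i \<noteq> 0" using l(1) by blast
    \<comment> \<open>Pair the vanishing combination of rows with \<open>z i\<close>: since
      \<open>T\<close> lies in \<open>I\<close>, every row of \<open>T\<close> except
      \<open>i\<close> annihilates \<open>z i\<close>.\<close>
    have "0 = (\<Sum>j'\<in>B. z i j' * (\<Sum>t\<in>T. A t j' * l t))" using 0 by simp
    also have "\<dots> = (\<Sum>t\<in>T. l t * (\<Sum>j'\<in>B. A t j' * z i j'))"
      by (simp add: sum_distrib_left mult_ac) (rule sum.swap)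
    also have "\<dots> = (\<Sum>t\<in>T. if t = i then l t * (\<Sum>j'\<in>B. A t j' * z i j') else 0)"
      using z[of i] i T(1) by (intro sum.cong) (auto simp: int_kernel_def)
    also have "\<dots> = l i * (\<Sum>j'\<in>B. A i j' * z i j')" using i finT by (subst sum.delta) auto
    finally show False using z'[of i] i T(1) by auto
  qed
  then show ?thesis using l(2,4) RT by (intro exI[of _ l]) auto
qed

lemma card_independent_columns:
  assumes "finite R" "finite S" "independent_columns A R S"
  shows "card S \<le> card R"
  using nontrivial_kernel[OF assms(1,2), of A] assms(3)
  by (force simp: independent_columns_def int_kernel_def)



section \<open>Feasible points with few large entries\<close>

text \<open>The lowest digit is a multiple of \<open>K\<close> of absolute value below
  \<open>K\<close>, hence 0; divide by \<open>K\<close> and repeat. The leading coefficient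
  \<open>t\<close> is left unrestricted because in \<open>weight_eq\<close> it is the sum of the
  entries.\<close>

lemma digits_zero:
  fixes e :: "nat \<Rightarrow> int"
  assumes "0 \<le> K" "\<And>i. i < k \<Longrightarrow> \<bar>e i\<bar> < K" "(\<Sum>i<k. e i * K ^ i) + t * K ^ k = 0"
  shows "(\<forall>i<k. e i = 0) \<and> (0 < K \<longrightarrow> t = 0)"
  using assms(2,3)
proof (induction k arbitrary: e)
  case 0
  then show ?case by simp
next
  case (Suc k)
  let ?S = "(\<Sum>i<k. e (Suc i) * K ^ i) + t * K ^ k"
  have *: "e 0 + K * ?S = 0"
    using Suc.prems(2) by (subst (asm) sum.lessThan_Suc_shift) (simp add: sum_distrib_left algebra_simps)
  then have "e 0 = K * (- ?S)" by (simp add: algebra_simps)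
  then have "K dvd e 0" by (rule dvdI)
  then have e0: "e 0 = 0" using Suc.prems(1)[of 0] by (metis zdvd_imp_le abs_of_pos dvd_abs_iff not_less zero_less_abs_iff zero_less_Suc)
  have "K > 0" using Suc.prems(1)[of 0] by simp
  then have "?S = 0" using * e0 by simp
  then have "(\<forall>i<k. e (Suc i) = 0) \<and> (0 < K \<longrightarrow> t = 0)" using Suc.prems(1) by (intro Suc.IH) auto
  then show ?case using e0 by (auto simp: less_Suc_eq_0_disj)
qed

lemma radix_digits:
  fixes G :: int and a :: "nat \<Rightarrow> int"
  assumes "0 < G" "\<And>k. k < r \<Longrightarrow> 0 \<le> a k \<and> a k < G"
  shows "\<exists>e. 0 \<le> e \<and> e < G ^ r \<and> (\<forall>k<r. e div G ^ k mod G = a k)"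
  using assms(2)
proof (induction r arbitrary: a)
  case 0
  then show ?case by (intro exI[of _ 0]) simp
next
  case (Suc r)
  obtain e where e: "0 \<le> e" "e < G ^ r" "\<forall>k<r. e div G ^ k mod G = a (Suc k)"
    using Suc.IH[of "\<lambda>k. a (Suc k)"] Suc.prems by auto
  let ?e = "a 0 + G * e"
  have a0: "0 \<le> a 0" "a 0 < G" using Suc.prems by auto
  have "?e < G * (e + 1)" using a0 by (simp add: algebra_simps)
  also have "\<dots> \<le> G * G ^ r" using e assms(1) by (intro mult_left_mono) auto
  finally have "?e < G ^ Suc r" by simp
  moreover have "0 \<le> ?e" using a0 e assms(1) by simp
  moreover have "?e div G ^ k mod G = a k" if "k < Suc r" for k
  proof (cases k)
    case 0
    then show ?thesis using a0 by simp
  next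
    case (Suc k')
    have "?e div G ^ k = ?e div G div G ^ k'"
      using assms(1) Suc by (simp add: zdiv_zmult2_eq)
    also have "?e div G = e" using a0 assms(1) by simp
    finally show ?thesis using e(3) Suc that by simp
  qed
  ultimately show ?case by blast
qed

section \<open>The integer program on functions and the encoding of columns by weights\<close>

locale integer_program =
  fixes m n :: nat and A :: "nat \<Rightarrow> nat \<Rightarrow> int" and b c :: "nat \<Rightarrow> int" and \<Delta> :: nat
  assumes m: "1 \<le> m" and n: "1 \<le> n" and \<Delta>: "1 \<le> \<Delta>"
    and A_le: "\<And>i j. i < m \<Longrightarrow> j < n \<Longrightarrow> \<bar>A i j\<bar> \<le> int \<Delta>"
    and A_nonzero: "\<exists>i<m. \<exists>j<n. A i j \<noteq> 0"
begin

definition M :: nat where "M = (n * \<Delta>) ^ m"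
definition D :: nat where "D = n * (M - 1)"
text \<open>The factor 4 comes from comparing a vector of sum at most \<open>D\<close> with a vector
  of the same weight, whose sum can reach \<open>3 * D\<close>: their left-hand sides then differ by
  at most \<open>4 * D * \<Delta>\<close>.\<close>

definition K :: int where "K = 4 * (int D + 1) * int \<Delta>"
definition w :: "nat \<Rightarrow> int" where "w j = (\<Sum>i<m. A i j * K ^ i) + K ^ m"
text \<open>A vector of sum at most \<open>D\<close> has weight at most
  \<open>3/2 * D * K^m\<close>, so it lies in the table. The factor 2 still guarantees sum at most
  \<open>4 * D\<close> for every vector whose weight is below \<open>H\<close>, as
  \<open>ray_of_weight\<close> requires.\<close>

definition H :: nat where "H = 2 * D * nat (K ^ m) + 1"

definition lhs :: "(nat \<Rightarrow> int) \<Rightarrow> nat \<Rightarrow> int" where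
  "lhs x i = (\<Sum>j<n. A i j * x j)"
definition obj :: "(nat \<Rightarrow> int) \<Rightarrow> int" where
  "obj x = (\<Sum>j<n. c j * x j)"
definition weight :: "(nat \<Rightarrow> int) \<Rightarrow> int" where
  "weight x = (\<Sum>j<n. w j * x j)"
definition nonneg :: "(nat \<Rightarrow> int) \<Rightarrow> bool" where
  "nonneg x \<longleftrightarrow> (\<forall>j<n. 0 \<le> x j)"
definition feasible :: "(nat \<Rightarrow> int) \<Rightarrow> bool" where
  "feasible x \<longleftrightarrow> nonneg x \<and> (\<forall>i<m. lhs x i = b i)"

definition ray :: "(nat \<Rightarrow> int) \<Rightarrow> bool" where
  "ray g \<longleftrightarrow> nonneg g \<and> (\<forall>i<m. lhs g i = 0)"

lemma M_ge_1: "1 \<le> M"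
  using n \<Delta> by (simp add: M_def)

lemma lhs_add: "lhs (\<lambda>j. x j + y j) i = lhs x i + lhs y i"
  and lhs_scale: "lhs (\<lambda>j. t * x j) i = t * lhs x i"
  and lhs_uminus: "lhs (\<lambda>j. - x j) i = - lhs x i"
  and lhs_diff: "lhs (\<lambda>j. x j - y j) i = lhs x i - lhs y i"
  by (simp_all add: lhs_def algebra_simps sum.distrib sum_distrib_left sum_negf sum_subtractf)

lemma obj_add: "obj (\<lambda>j. x j + y j) = obj x + obj y"
  and obj_scale: "obj (\<lambda>j. t * x j) = t * obj x"
  and obj_uminus: "obj (\<lambda>j. - x j) = - obj x"
  by (simp_all add: obj_def algebra_simps sum.distrib sum_distrib_left sum_negf)

text \<open>The weight is a number in base \<open>K\<close> with signed digits
  \<open>lhs x i\<close> and leading coefficient the sum of the entries.\<close>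

lemma weight_eq: "weight x = (\<Sum>i<m. lhs x i * K ^ i) + (\<Sum>j<n. x j) * K ^ m"
proof -
  have "weight x = (\<Sum>j<n. \<Sum>i<m. A i j * x j * K ^ i) + (\<Sum>j<n. x j * K ^ m)"
    by (simp add: weight_def w_def algebra_simps sum.distrib sum_distrib_left)
  also have "(\<Sum>j<n. \<Sum>i<m. A i j * x j * K ^ i) = (\<Sum>i<m. lhs x i * K ^ i)"
    by (subst sum.swap) (simp add: lhs_def sum_distrib_right)
  finally show ?thesis by (simp add: sum_distrib_right)
qed

lemma K_ge: "4 * int \<Delta> \<le> K" "4 \<le> K"
proof -
  have "4 * int \<Delta> * 1 \<le> 4 * int \<Delta> * (int D + 1)" by (intro mult_left_mono) auto
  then show "4 * int \<Delta> \<le> K" by (simp add: K_def mult_ac)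
  then show "4 \<le> K" using \<Delta> by simp
qed

text \<open>The lower digits contribute at most \<open>\<Delta> * (K^m - 1) / (K - 1)\<close>, which
  is at most \<open>K^m / 2\<close> because \<open>K \<ge> 4 * \<Delta>\<close>. Hence all weights
  agree up to a factor of 3, and the weight of a vector controls the sum of its entries.\<close>

lemma w_bounds:
  assumes "j < n"
  shows "K ^ m \<le> 2 * w j" "2 * w j \<le> 3 * K ^ m"
proof -
  \<comment> \<open>Multiplying by \<open>K - 1\<close> turns the geometric sum into
    \<open>K^m - 1\<close> without a division.\<close>
  have "(K - 1) * \<bar>\<Sum>i<m. A i j * K ^ i\<bar> \<le> (K - 1) * (\<Sum>i<m. int \<Delta> * K ^ i)"
  proof (intro mult_left_mono order_trans[OF sum_abs] sum_mono)
    fix i assume "i \<in> {..<m}"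
    then show "\<bar>A i j * K ^ i\<bar> \<le> int \<Delta> * K ^ i"
      using A_le[of i j] assms K_ge by (auto simp: abs_mult intro!: mult_right_mono)
  qed (use K_ge in auto)
  also have "\<dots> = int \<Delta> * (K ^ m - 1)"
    by (simp add: sum_distrib_left[symmetric] power_diff_1_eq mult_ac)
  finally have 1: "2 * ((K - 1) * \<bar>\<Sum>i<m. A i j * K ^ i\<bar>) \<le> 2 * int \<Delta> * (K ^ m - 1)" by simp
  have "2 * int \<Delta> * (K ^ m - 1) \<le> (K - 1) * K ^ m"
  proof -
    have "2 * int \<Delta> * (K ^ m - 1) \<le> (K - 1) * (K ^ m - 1)"
      using K_ge \<Delta> by (intro mult_right_mono) auto
    also have "\<dots> \<le> (K - 1) * K ^ m" using K_ge by (intro mult_left_mono) auto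
    finally show ?thesis .
  qed
  with 1 have "(K - 1) * (2 * \<bar>\<Sum>i<m. A i j * K ^ i\<bar>) \<le> (K - 1) * K ^ m" by (simp add: mult_ac)
  then have "2 * \<bar>\<Sum>i<m. A i j * K ^ i\<bar> \<le> K ^ m" using K_ge by (subst (asm) mult_le_cancel_left) auto
  then show "K ^ m \<le> 2 * w j" "2 * w j \<le> 3 * K ^ m" by (auto simp: w_def)
qed

lemma w_pos: "j < n \<Longrightarrow> 0 < w j"
  using w_bounds(1)[of j] zero_less_power[of K m] K_ge by linarith

lemma weight_bounds:
  assumes "nonneg x"
  shows "K ^ m * (\<Sum>j<n. x j) \<le> 2 * weight x" "2 * weight x \<le> 3 * K ^ m * (\<Sum>j<n. x j)"
  using w_bounds assms
  by (auto simp: weight_def sum_distrib_left nonneg_def mult.assoc[symmetric] intro!: sum_mono mult_right_mono)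

lemma H_eq: "int H = 2 * int D * K ^ m + 1"
  using K_ge by (simp add: H_def)

lemma weight_less_H:
  assumes "nonneg x" "(\<Sum>j<n. x j) \<le> int D"
  shows "0 \<le> weight x" "weight x < int H"
proof -
  have K0: "0 < K ^ m" using K_ge by simp
  have s: "0 \<le> (\<Sum>j<n. x j)" using assms(1) by (intro sum_nonneg) (auto simp: nonneg_def)
  have "0 \<le> K ^ m * (\<Sum>j<n. x j)" using K0 s by simp
  then show "0 \<le> weight x" using weight_bounds(1)[OF assms(1)] by linarith
  have "K ^ m * (\<Sum>j<n. x j) \<le> K ^ m * int D" using K0 assms(2) by (intro mult_left_mono) auto
  moreover have "0 \<le> K ^ m * int D" using K0 by simp
  ultimately show "weight x < int H"
    using weight_bounds(2)[OF assms(1)] unfolding H_eq by (simp add: mult_ac)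
qed

lemma lhs_le:
  assumes "\<And>j. j < n \<Longrightarrow> \<bar>x j\<bar> \<le> y j" "i < m"
  shows "\<bar>lhs x i\<bar> \<le> int \<Delta> * (\<Sum>j<n. y j)"
  unfolding lhs_def sum_distrib_left
proof (intro order_trans[OF sum_abs] sum_mono)
  fix j assume "j \<in> {..<n}"
  then show "\<bar>A i j * x j\<bar> \<le> int \<Delta> * y j"
    using A_le[OF assms(2), of j] assms(1)[of j] by (auto simp: abs_mult intro: mult_mono)
qed

text \<open>Only \<open>u\<close> has a bounded sum; the table may hold any vector \<open>u'\<close>
  of that weight. Comparable column weights give \<open>u'\<close> a sum of at most
  \<open>3 * D\<close>, so the digits of the difference stay below \<open>K\<close> and must
  vanish.\<close>

lemma same_weight:
  assumes "nonneg u" "nonneg u'" "weight u' = weight u" "(\<Sum>j<n. u j) \<le> int D" "i < m"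
  shows "lhs u' i = lhs u i"
proof -
  have K0: "0 < K ^ m" using K_ge by simp
  have "K ^ m * (\<Sum>j<n. u' j) \<le> 3 * K ^ m * (\<Sum>j<n. u j)"
    using weight_bounds(1)[OF assms(2)] weight_bounds(2)[OF assms(1)] assms(3) by simp
  also have "\<dots> \<le> 3 * K ^ m * int D" using K0 assms(4) by (intro mult_left_mono) auto
  finally have "K ^ m * (\<Sum>j<n. u' j) \<le> K ^ m * (3 * int D)" by (simp add: mult_ac)
  then have u': "(\<Sum>j<n. u' j) \<le> 3 * int D" using K0 by simp
  have bound: "\<bar>lhs (\<lambda>j. u' j - u j) i\<bar> < K" if "i < m" for i
  proof -
    have "\<bar>lhs (\<lambda>j. u' j - u j) i\<bar> \<le> int \<Delta> * (\<Sum>j<n. u' j + u j)"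
      using assms(1,2) that by (intro lhs_le) (auto simp: nonneg_def abs_le_iff)
    also have "\<dots> \<le> int \<Delta> * (4 * int D)"
      using u' assms(4) by (intro mult_left_mono) (auto simp: sum.distrib)
    also have "\<dots> < K" using \<Delta> by (simp add: K_def algebra_simps)
    finally show ?thesis .
  qed
  have "(\<Sum>i<m. lhs (\<lambda>j. u' j - u j) i * K ^ i) + (\<Sum>j<n. u' j - u j) * K ^ m = 0"
    using assms(3) unfolding weight_eq lhs_diff by (simp add: algebra_simps sum_subtractf)
  from digits_zero[OF _ bound this] K_ge assms(5) show ?thesis by (auto simp: lhs_diff)
qed

text \<open>Subtracting \<open>t\<close> from the sum of the entries in the leading position leaves
  a representation of 0 with digits \<open>lhs u i\<close> below \<open>K\<close>. No relation
  between \<open>t\<close> and that sum is presupposed.\<close>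

lemma ray_of_weight:
  assumes "nonneg u" "weight u = t * K ^ m" "weight u < int H"
  shows "ray u"
proof -
  have K0: "0 < K ^ m" using K_ge by simp
  have "K ^ m * (\<Sum>j<n. u j) \<le> 2 * (2 * int D * K ^ m)"
    using weight_bounds(1)[OF assms(1)] assms(3) H_eq by simp
  then have "K ^ m * (\<Sum>j<n. u j) \<le> K ^ m * (4 * int D)" by (simp add: mult_ac)
  then have u: "(\<Sum>j<n. u j) \<le> 4 * int D" using K0 by simp
  have bound: "\<bar>lhs u i\<bar> < K" if "i < m" for i
  proof -
    have "\<bar>lhs u i\<bar> \<le> int \<Delta> * (\<Sum>j<n. u j)"
      using assms(1) that by (intro lhs_le) (auto simp: nonneg_def)
    also have "\<dots> \<le> int \<Delta> * (4 * int D)" using u by (intro mult_left_mono) auto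
    also have "\<dots> < K" using \<Delta> by (simp add: K_def algebra_simps)
    finally show ?thesis .
  qed
  have "(\<Sum>i<m. lhs u i * K ^ i) + ((\<Sum>j<n. u j) - t) * K ^ m = 0"
    using assms(2) unfolding weight_eq by (simp add: algebra_simps)
  from digits_zero[OF _ bound this] K_ge assms(1) show ?thesis by (auto simp: ray_def)
qed

section \<open>Short rays and the reduction of large entries\<close>

definition short_ray :: "(nat \<Rightarrow> int) \<Rightarrow> bool" where
  "short_ray g \<longleftrightarrow> ray g \<and> (\<forall>j<n. g j \<le> int M - 1)"

lemma sum_le_D:
  assumes "\<And>j. j < n \<Longrightarrow> x j \<le> int M - 1"
  shows "(\<Sum>j<n. x j) \<le> int D"
proof -
  have "(\<Sum>j<n. x j) \<le> (\<Sum>j<n. int M - 1)" using assms by (intro sum_mono) auto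
  also have "\<dots> = int D" using M_ge_1 by (simp add: D_def)
  finally show ?thesis .
qed

abbreviation independent :: "nat set \<Rightarrow> bool" where
  "independent S \<equiv> independent_columns A {..<m} S"

lemma dependent_direction:
  assumes "S \<subseteq> {..<n}" "\<not> independent S"
  shows "\<exists>h. (\<forall>i<m. lhs h i = 0) \<and> (\<forall>j. \<bar>h j\<bar> \<le> int M - 1) \<and> (\<forall>j. j \<notin> S \<longrightarrow> h j = 0) \<and> (\<exists>j\<in>S. h j \<noteq> 0)"
proof -
  have S: "finite S" "card S \<le> n" using assms(1) finite_subset card_mono[OF _ assms(1)] by auto
  have lhs: "lhs h i = (\<Sum>j\<in>S. A i j * h j)" if "\<forall>j. j \<notin> S \<longrightarrow> h j = 0" for h i
    unfolding lhs_def using that assms(1) by (intro sum.mono_neutral_right) auto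
  \<comment> \<open>\<open>bounded_kernel\<close> needs a base of at least 2. If
    \<open>n * \<Delta> = 1\<close>, the only column is nonzero and no dependent set exists.\<close>
  have "2 \<le> n * \<Delta>"
  proof (rule ccontr)
    assume "\<not> 2 \<le> n * \<Delta>"
    then have "n = 1" using n \<Delta> by (metis mult.commute mult_le_mono nat_mult_1 not_less_eq_eq numeral_2_eq_2 One_nat_def le_antisym)
    then obtain i where i: "i < m" "A i 0 \<noteq> 0" using A_nonzero by auto
    have "S = {} \<or> S = {0}" using assms(1) \<open>n = 1\<close> by auto
    then have "independent S" using i by (auto simp: independent_columns_def int_kernel_def)
    then show False using assms(2) by blast
  qed
  moreover have "card S * \<Delta> \<le> n * \<Delta>" using S by (simp add: mult_right_mono)
  ultimately obtain h where "h \<in> int_kernel A {..<m} S" "\<exists>j\<in>S. h j \<noteq> 0" "\<forall>j. \<bar>h j\<bar> \<le> int (M - 1)"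
    using bounded_kernel[of "{..<m}" S A \<Delta> "n * \<Delta>"] S(1) assms A_le m by (auto simp: M_def subset_iff)
  then show ?thesis using lhs M_ge_1 by (intro exI[of _ h]) (auto simp: int_kernel_def of_nat_diff)
qed

text \<open>While the columns of the large entries are dependent, there is a kernel direction on
  them, with entries at most \<open>M - 1\<close> in absolute value, that does not lower the
  objective and decreases some entry. Going one step beyond the last point where all these entries
  are still large takes one below \<open>M - 1\<close> and none below 0, so the number of large
  entries drops.\<close>

lemma reduce_large:
  assumes "feasible x" and no_ray: "\<And>g. short_ray g \<Longrightarrow> obj g \<le> 0"
  shows "\<exists>x'. feasible x' \<and> obj x \<le> obj x' \<and> independent {j. j < n \<and> int M - 1 \<le> x' j}"
  using assms(1)
proof (induction "card {j. j < n \<and> int M - 1 \<le> x j}" arbitrary: x rule: less_induct)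
  case (less x)
  let ?L = "\<lambda>x. {j. j < n \<and> int M - 1 \<le> x j}"
  have finL: "finite (?L x)" for x by simp
  show ?case
  proof (cases "independent (?L x)")
    case True
    then show ?thesis using less.prems by blast
  next
    case False
    obtain h where h: "\<forall>i<m. lhs h i = 0" "\<forall>j. \<bar>h j\<bar> \<le> int M - 1" "\<forall>j. j \<notin> ?L x \<longrightarrow> h j = 0"
      "\<exists>j\<in>?L x. h j \<noteq> 0"
      using dependent_direction[OF _ False] by blast
    define dir where "dir d \<longleftrightarrow> (\<forall>i<m. lhs d i = 0) \<and> (\<forall>j. \<bar>d j\<bar> \<le> int M - 1) \<and> (\<forall>j. j \<notin> ?L x \<longrightarrow> d j = 0)
      \<and> 0 \<le> obj d \<and> (\<exists>j\<in>?L x. d j < 0)" for d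
    have "\<exists>d. dir d"
    proof -
      \<comment> \<open>Orient \<open>h\<close> towards a nonnegative objective. Without a negative
        entry it is a short ray, hence of objective 0, and its negative can be used instead.\<close>
      define g where "g = (if 0 \<le> obj h then h else (\<lambda>j. - h j))"
      have g: "\<forall>i<m. lhs g i = 0" "\<forall>j. \<bar>g j\<bar> \<le> int M - 1" "\<forall>j. j \<notin> ?L x \<longrightarrow> g j = 0"
        "0 \<le> obj g" "\<exists>j\<in>?L x. g j \<noteq> 0"
        using h by (auto simp: g_def lhs_uminus obj_uminus)
      show ?thesis
      proof (cases "\<exists>j\<in>?L x. g j < 0")
        case True
        then show ?thesis using g by (intro exI[of _ g]) (simp add: dir_def)
      next
        case False
        then have "\<forall>j. 0 \<le> g j" using g(3) by (metis linorder_not_less order.refl)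
        then have "short_ray g" using g(1,2) by (auto simp: short_ray_def ray_def nonneg_def)
        then have "obj g = 0" using no_ray g(4) by force
        moreover have "\<exists>j\<in>?L x. - g j < 0" using g(5) False by force
        ultimately have "dir (\<lambda>j. - g j)" using g by (auto simp: dir_def lhs_uminus obj_uminus)
        then show ?thesis by blast
      qed
    qed
    then obtain d where d: "\<forall>i<m. lhs d i = 0" "\<forall>j. \<bar>d j\<bar> \<le> int M - 1" "\<forall>j. j \<notin> ?L x \<longrightarrow> d j = 0"
      "0 \<le> obj d" and "\<exists>j\<in>?L x. d j < 0" by (auto simp: dir_def)
    then obtain j0 where j0: "j0 \<in> ?L x" "d j0 < 0" by blast
    define P where "P t \<longleftrightarrow> (\<exists>j\<in>?L x. x j + int t * d j < int M - 1)" for t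
    have "x j0 + int (nat (x j0 + 1)) * d j0 < int M - 1"
    proof -
      \<comment> \<open>The entry at \<open>j0\<close> loses at least 1 per step, so after
        \<open>x j0 + 1\<close> steps it is negative.\<close>
      have "0 \<le> x j0" using less.prems j0 by (auto simp: feasible_def nonneg_def)
      moreover have "(x j0 + 1) * d j0 \<le> (x j0 + 1) * - 1"
        using calculation j0 by (intro mult_left_mono) auto
      ultimately show ?thesis using M_ge_1 by simp
    qed
    then have "P (nat (x j0 + 1))" using j0 by (auto simp: P_def)
    moreover have "\<not> P 0" by (auto simp: P_def)
    ultimately obtain t where t: "P (Suc t)" "\<not> P t"
      using ex_least_nat_less[of P "nat (x j0 + 1)"] by (metis Suc_eq_plus1 le_refl)
    define y where "y j = x j + int (Suc t) * d j" for j
    \<comment> \<open>At step \<open>t\<close> the entry is at least \<open>M - 1\<close>, and one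
      further step subtracts at most \<open>M - 1\<close>; threshold and bound on the direction have
      to coincide here.\<close>
    have ylarge: "0 \<le> y j" if "j \<in> ?L x" for j
    proof -
      have "int M - 1 \<le> x j + int t * d j" using t(2) that by (force simp: P_def)
      moreover have "- (int M - 1) \<le> d j" using d(2)[rule_format, of j] by linarith
      ultimately show ?thesis by (simp add: y_def algebra_simps)
    qed
    have ysmall: "y j = x j" if "j \<notin> ?L x" for j using d(3) that by (simp add: y_def)
    have "nonneg y" using ylarge ysmall less.prems unfolding nonneg_def feasible_def by metis
    moreover have "lhs y i = lhs x i" if "i < m" for i
      using d(1) that by (simp add: y_def[abs_def] lhs_add lhs_scale)
    ultimately have fy: "feasible y" using less.prems by (auto simp: feasible_def)
    have oy: "obj x \<le> obj y" using d(4) by (simp add: y_def[abs_def] obj_add obj_scale)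
    have "?L y \<subset> ?L x"
    proof
      show "?L y \<subseteq> ?L x"
      proof
        fix j assume "j \<in> ?L y"
        then show "j \<in> ?L x" using ysmall[of j] by auto
      qed
      obtain j where j: "j \<in> ?L x" "y j < int M - 1" using t(1) unfolding P_def y_def by blast
      show "?L y \<noteq> ?L x"
      proof
        assume "?L y = ?L x"
        then have "j \<in> ?L y" using j(1) by (rule ssubst)
        then show False using j(2) by simp
      qed
    qed
    then have "card (?L y) < card (?L x)" using finL psubset_card_mono by blast
    from less.hyps[OF this fy] obtain x' where "feasible x'" "obj y \<le> obj x'"
      "independent (?L x')" by blast
    then show ?thesis using oy by (intro exI[of _ x']) auto
  qed
qed

end

section \<open>Candidates for an optimal solution\<close>

text \<open>A multiple of \<open>p * Q^m\<close> affects only digits from position \<open>m\<close>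
  on. This allows \<open>fun_coeff\<close> to read its digits from \<open>e div G ^ k\<close>
  without first reducing modulo \<open>G\<close>.\<close>

lemma div_digits_shift:
  fixes a z :: int
  assumes "0 < p" "0 < Q" "i < m"
  shows "(a + p * Q ^ m * z) div p div Q ^ i mod Q = a div p div Q ^ i mod Q"
proof -
  have "(a + p * Q ^ m * z) div p = a div p + Q ^ m * z"
    using assms(1) by (simp add: mult.assoc)
  also have "Q ^ m * z = Q ^ i * (Q * Q ^ (m - Suc i) * z)"
    using assms(3) by (simp add: power_Suc[symmetric] power_add[symmetric] mult.assoc[symmetric] del: power_Suc)
  also have "(a div p + Q ^ i * (Q * Q ^ (m - Suc i) * z)) div Q ^ i = a div p div Q ^ i + Q * Q ^ (m - Suc i) * z"
    using assms(2) by simp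
  also have "\<dots> mod Q = a div p div Q ^ i mod Q" by (simp add: mult.assoc)
  finally show ?thesis .
qed

context integer_program
begin

definition Q :: int where "Q = 2 * int M + 1"
definition G :: int where "G = int n * Q ^ m"
text \<open>Independent columns number at most \<open>m\<close> and at most \<open>n\<close>. The
  second bound matters for \<open>n = 1\<close>, where it reduces \<open>G^r\<close> to
  \<open>3^m\<close> when \<open>\<Delta> = 1\<close>.\<close>

definition r :: nat where "r = min m n"

text \<open>A candidate is numbered by \<open>e < G^r\<close>: its base-\<open>G\<close> digits consist of a column index and of \<open>m\<close>
  base-\<open>Q\<close> digits, which are the coefficients of a functional, shifted by \<open>M\<close> to make them nonnegative.
  The zero functional contributes \<open>0 div 0 = 0\<close>, so that fewer than \<open>r\<close> columns are covered as well.\<close>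

definition col :: "int \<Rightarrow> nat \<Rightarrow> nat" where
  "col e k = nat (e div G ^ k mod int n)"
definition fun_coeff :: "int \<Rightarrow> nat \<Rightarrow> nat \<Rightarrow> int" where
  "fun_coeff e k i = e div G ^ k div int n div Q ^ i mod Q - int M"
definition pivot_num :: "int \<Rightarrow> (nat \<Rightarrow> int) \<Rightarrow> nat \<Rightarrow> int" where
  "pivot_num e u k = (\<Sum>i<m. fun_coeff e k i * (b i - lhs u i))"
definition pivot_den :: "int \<Rightarrow> nat \<Rightarrow> int" where
  "pivot_den e k = (\<Sum>i<m. fun_coeff e k i * A i (col e k))"
definition cand :: "int \<Rightarrow> (nat \<Rightarrow> int) \<Rightarrow> nat \<Rightarrow> int" where
  "cand e u j = u j + (\<Sum>k<r. if col e k = j then pivot_num e u k div pivot_den e k else 0)"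

lemma Q_pos: "0 < Q"
  by (simp add: Q_def)

lemma G_pos: "0 < G"
  using n Q_pos by (simp add: G_def)

text \<open>\<open>u\<close> is \<open>x\<close> with its large entries removed. The removed part is
  recovered from the residual alone, so any \<open>u'\<close> with the same left-hand side can be
  completed by the same large entries; this is what lets a table entry replace
  \<open>u\<close>.\<close>

lemma cand_complete:
  assumes x: "feasible x" and ind: "independent {j. j < n \<and> int M - 1 \<le> x j}"
  shows "\<exists>u. nonneg u \<and> (\<Sum>j<n. u j) \<le> int D \<and>
    (\<forall>u'. nonneg u' \<and> (\<forall>i<m. lhs u' i = lhs u i) \<longrightarrow>
      (\<exists>e. 0 \<le> e \<and> e < G ^ r \<and> feasible (cand e u') \<and> obj (cand e u') = obj x + (obj u' - obj u)))"
proof -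
  define L where "L = {j. j < n \<and> int M - 1 \<le> x j}"
  have L: "L \<subseteq> {..<n}" "finite L" by (auto simp: L_def)
  have indL: "independent L" using ind by (simp add: L_def)
  have "card L \<le> m" using card_independent_columns[OF _ L(2) indL] by simp
  moreover have "card L \<le> n" using card_mono[OF _ L(1)] by simp
  ultimately have cL: "card L \<le> r" "card L \<le> n" by (auto simp: r_def)
  obtain f where f: "bij_betw f {0..<card L} L" using ex_bij_betw_nat_finite[OF L(2)] by blast
  have fL: "f k \<in> L" if "k < card L" for k using f that by (auto simp: bij_betw_def)
  have "\<exists>l. (\<forall>i. \<bar>l i\<bar> \<le> int M) \<and> (\<Sum>i<m. l i * A i j) \<noteq> 0
         \<and> (\<forall>j'\<in>L - {j}. (\<Sum>i<m. l i * A i j') = 0)" if "j \<in> L" for j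
    using separating_functional[of "{..<m}" L A \<Delta> "n * \<Delta>" j] L A_le cL(2) n \<Delta> indL that
    by (auto simp: M_def subset_iff mult_right_mono)
  then have "\<exists>l. \<forall>j\<in>L. (\<forall>i. \<bar>l j i\<bar> \<le> int M) \<and> (\<Sum>i<m. l j i * A i j) \<noteq> 0
         \<and> (\<forall>j'\<in>L - {j}. (\<Sum>i<m. l j i * A i j') = 0)" by (intro bchoice) blast
  then obtain l where l0: "\<forall>j\<in>L. (\<forall>i. \<bar>l j i\<bar> \<le> int M) \<and> (\<Sum>i<m. l j i * A i j) \<noteq> 0
         \<and> (\<forall>j'\<in>L - {j}. (\<Sum>i<m. l j i * A i j') = 0)" by blast
  have l: "\<bar>l j i\<bar> \<le> int M" "(\<Sum>i<m. l j i * A i j) \<noteq> 0"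
    "j' \<in> L \<Longrightarrow> j' \<noteq> j \<Longrightarrow> (\<Sum>i<m. l j i * A i j') = 0" if "j \<in> L" for j i j'
    using l0 that by blast+
  \<comment> \<open>Positions from \<open>card L\<close> on are padded with the zero functional and
    column 0, which add nothing to the candidate.\<close>
  define l' where "l' k i = (if k < card L then l (f k) i else 0)" for k i
  define j' where "j' k = (if k < card L then f k else 0)" for k
  have l'M: "\<bar>l' k i\<bar> \<le> int M" for k i using l(1) fL by (auto simp: l'_def)
  have j'n: "j' k < n" for k using fL L(1) n by (auto simp: j'_def)
  have "\<exists>e. 0 \<le> e \<and> e < Q ^ m \<and> (\<forall>i<m. e div Q ^ i mod Q = l' k i + int M)" for k
  proof (rule radix_digits[OF Q_pos])
    fix i
    show "0 \<le> l' k i + int M \<and> l' k i + int M < Q" using l'M[of k i] by (simp add: Q_def abs_le_iff)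
  qed
  then have "\<exists>d. \<forall>k. 0 \<le> d k \<and> d k < Q ^ m \<and> (\<forall>i<m. d k div Q ^ i mod Q = l' k i + int M)"
    by (intro choice) blast
  then obtain d where d: "\<And>k. 0 \<le> d k" "\<And>k. d k < Q ^ m" "\<And>k i. i < m \<Longrightarrow> d k div Q ^ i mod Q = l' k i + int M"
    by blast
  have "0 \<le> int (j' k) + int n * d k \<and> int (j' k) + int n * d k < G" for k
  proof -
    have "int (j' k) + int n * d k < int n * (d k + 1)" using j'n[of k] by (simp add: algebra_simps)
    also have "\<dots> \<le> int n * Q ^ m" using d(2)[of k] by (intro mult_left_mono) auto
    finally show ?thesis using d(1) by (simp add: G_def)
  qed
  then obtain e where e: "0 \<le> e" "e < G ^ r" and ek: "\<And>k. k < r \<Longrightarrow> e div G ^ k mod G = int (j' k) + int n * d k"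
    using radix_digits[OF G_pos, of r "\<lambda>k. int (j' k) + int n * d k"] by blast
  have col: "col e k = j' k" if "k < r" for k
  proof -
    have "e div G ^ k mod int n = e div G ^ k mod G mod int n"
      by (simp add: G_def mod_mod_cancel)
    then show ?thesis using ek[OF that] j'n[of k] by (simp add: col_def)
  qed
  have coeff: "fun_coeff e k i = l' k i" if "k < r" "i < m" for k i
  proof -
    \<comment> \<open>\<open>z\<close> collects the base-\<open>G\<close> digits above position
      \<open>k\<close>; they are invisible to the \<open>m\<close> digits read here.\<close>
    define z where "z = e div G ^ k div G"
    have ed: "e div G ^ k = (int (j' k) + int n * d k) + int n * Q ^ m * z"
      using ek[OF that(1)] mult_div_mod_eq[of G "e div G ^ k"] by (simp add: G_def z_def)
    have "e div G ^ k div int n div Q ^ i mod Q = (int (j' k) + int n * d k) div int n div Q ^ i mod Q"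
      unfolding ed by (rule div_digits_shift) (use n Q_pos that(2) in auto)
    also have "(int (j' k) + int n * d k) div int n = d k" using j'n[of k] by simp
    finally show ?thesis using d(3)[OF that(2)] by (simp add: fun_coeff_def)
  qed
  define u where "u j = (if j \<in> L then 0 else x j)" for j
  define y where "y j = (if j \<in> L then x j else 0)" for j
  have x_eq: "x = (\<lambda>j. u j + y j)" by (auto simp: u_def y_def)
  have lhsx: "lhs x i = lhs u i + lhs y i" for i by (subst x_eq) (rule lhs_add)
  have objx: "obj x = obj u + obj y" by (subst x_eq) (rule obj_add)
  have xnn: "0 \<le> x j" if "j < n" for j using x that by (auto simp: feasible_def nonneg_def)
  have "nonneg u" using xnn by (auto simp: u_def nonneg_def)
  moreover have "(\<Sum>j<n. u j) \<le> int D"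
    using M_ge_1 by (intro sum_le_D) (auto simp: u_def L_def)
  moreover have "\<exists>e. 0 \<le> e \<and> e < G ^ r \<and> feasible (cand e u') \<and> obj (cand e u') = obj x + (obj u' - obj u)"
    if u': "nonneg u'" "\<forall>i<m. lhs u' i = lhs u i" for u'
  proof -
    have res: "b i - lhs u' i = (\<Sum>j\<in>L. A i j * y j)" if "i < m" for i
    proof -
      have "b i - lhs u' i = lhs y i" using that u'(2) x lhsx[of i] by (simp add: feasible_def)
      also have "\<dots> = (\<Sum>j\<in>L. A i j * y j)"
        unfolding lhs_def using L by (intro sum.mono_neutral_right) (auto simp: y_def)
      finally show ?thesis .
    qed
    \<comment> \<open>The residual is the combination of the columns of \<open>L\<close> with
      coefficients \<open>y\<close>. The functional of \<open>f k\<close> keeps a single term of it,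
      so the division is exact.\<close>
    have quot: "pivot_num e u' k div pivot_den e k = (if k < card L then y (f k) else 0)" if k: "k < r" for k
    proof (cases "k < card L")
      case True
      have "pivot_num e u' k = (\<Sum>i<m. \<Sum>j\<in>L. l (f k) i * (A i j * y j))"
        using True k by (simp add: pivot_num_def coeff res l'_def sum_distrib_left)
      also have "\<dots> = (\<Sum>j\<in>L. (\<Sum>i<m. l (f k) i * A i j) * y j)"
        by (subst sum.swap) (simp add: sum_distrib_right mult.assoc)
      also have "\<dots> = (\<Sum>j\<in>L. if j = f k then (\<Sum>i<m. l (f k) i * A i j) * y j else 0)"
        using l(3)[OF fL[OF True]] by (intro sum.cong) auto
      also have "\<dots> = (\<Sum>i<m. l (f k) i * A i (f k)) * y (f k)"
        using fL[OF True] L(2) by (subst sum.delta) auto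
      finally have "pivot_num e u' k = pivot_den e k * y (f k)"
        using True k by (simp add: pivot_den_def coeff col l'_def j'_def)
      moreover have "pivot_den e k \<noteq> 0"
        using l(2)[OF fL[OF True]] True k by (simp add: pivot_den_def coeff col l'_def j'_def)
      ultimately show ?thesis using True by simp
    next
      case False
      then have "pivot_num e u' k = 0" using k by (simp add: pivot_num_def coeff l'_def)
      then show ?thesis using False by simp
    qed
    have cand: "cand e u' j = u' j + y j" for j
    proof -
      have "(\<Sum>k<r. if col e k = j then pivot_num e u' k div pivot_den e k else 0)
          = (\<Sum>k<r. if k < card L then (if f k = j then y (f k) else 0) else 0)"
        by (intro sum.cong) (auto simp: quot col j'_def)
      also have "\<dots> = (\<Sum>k<card L. if f k = j then y (f k) else 0)"
        using cL(1) by (intro sum.mono_neutral_cong_right) auto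
      also have "\<dots> = (\<Sum>j''\<in>L. if j'' = j then y j'' else 0)"
        using sum.reindex_bij_betw[OF f, of "\<lambda>j''. if j'' = j then y j'' else 0"]
        by (simp add: lessThan_atLeast0)
      also have "\<dots> = y j" using L(2) by (simp add: y_def)
      finally show ?thesis by (simp add: cand_def)
    qed
    then have cand': "cand e u' = (\<lambda>j. u' j + y j)" by blast
    have "nonneg (cand e u')" using u'(1) xnn by (auto simp: cand nonneg_def y_def)
    moreover have "lhs (cand e u') i = b i" if "i < m" for i
      using that u'(2) x lhsx[of i] by (simp add: cand' lhs_add feasible_def)
    ultimately have "feasible (cand e u')" by (simp add: feasible_def)
    moreover have "obj (cand e u') = obj x + (obj u' - obj u)" by (simp add: cand' obj_add objx)
    ultimately show ?thesis using e by blast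
  qed
  ultimately show ?thesis by blast
qed

section \<open>Consequences of a correct knapsack table\<close>

text \<open>The maximum ranges over all nonnegative vectors of weight \<open>V\<close>, with no
  bound on their sum, so that the recursion needs no second parameter; \<open>same_weight\<close>
  compensates for this.\<close>

definition table_entry :: "bool \<Rightarrow> int \<Rightarrow> (nat \<Rightarrow> int) \<Rightarrow> int \<Rightarrow> bool" where
  "table_entry reached v u V \<longleftrightarrow> (reached \<longrightarrow> nonneg u \<and> weight u = V \<and> obj u = v)
     \<and> (\<forall>x. nonneg x \<and> weight x = V \<longrightarrow> reached \<and> obj x \<le> v)"

context
  fixes F :: "int \<Rightarrow> bool" and v :: "int \<Rightarrow> int" and U :: "int \<Rightarrow> nat \<Rightarrow> int"
  assumes table: "\<And>V. 0 \<le> V \<Longrightarrow> V < int H \<Longrightarrow> table_entry (F V) (v V) (U V) V"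
begin

text \<open>Exchanging the small part for the table entry of the same weight preserves the left-hand
  side and cannot lower the objective.\<close>

lemma structured_candidate:
  assumes x: "feasible x" and ind: "independent {j. j < n \<and> int M - 1 \<le> x j}"
  shows "\<exists>V e. 0 \<le> V \<and> V < int H \<and> F V \<and> 0 \<le> e \<and> e < G ^ r
           \<and> feasible (cand e (U V)) \<and> obj x \<le> obj (cand e (U V))"
proof -
  obtain u where u: "nonneg u" "(\<Sum>j<n. u j) \<le> int D"
    and cand: "\<And>u'. nonneg u' \<Longrightarrow> \<forall>i<m. lhs u' i = lhs u i \<Longrightarrow>
      \<exists>e. 0 \<le> e \<and> e < G ^ r \<and> feasible (cand e u') \<and> obj (cand e u') = obj x + (obj u' - obj u)"
    using cand_complete[OF assms] by blast
  let ?V = "weight u"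
  have V: "0 \<le> ?V" "?V < int H" using weight_less_H[OF u] by auto
  then have F: "F ?V" "obj u \<le> v ?V" "nonneg (U ?V)" "weight (U ?V) = ?V" "obj (U ?V) = v ?V"
    using table[OF V] u(1) by (auto simp: table_entry_def)
  moreover have "\<forall>i<m. lhs (U ?V) i = lhs u i" using same_weight[OF u(1) F(3) F(4) u(2)] by blast
  ultimately obtain e where "0 \<le> e" "e < G ^ r" "feasible (cand e (U ?V))"
      "obj (cand e (U ?V)) = obj x + (obj (U ?V) - obj u)" using cand by blast
  then show ?thesis using V F by (intro exI[of _ ?V] exI[of _ e]) auto
qed

text \<open>The candidates do not depend on the objective. With the objective zero no ray is
  improving, so the reduction of large entries goes through even if the given program is
  unbounded.\<close>

lemma candidate_exists:
  assumes "feasible x"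
  shows "\<exists>V e. 0 \<le> V \<and> V < int H \<and> F V \<and> 0 \<le> e \<and> e < G ^ r \<and> feasible (cand e (U V))"
proof -
  interpret zero: integer_program m n A b "\<lambda>_. 0" \<Delta>
    by unfold_locales (use m n \<Delta> A_le A_nonzero in auto)
  have "zero.feasible x" using assms by (simp add: zero.feasible_def feasible_def zero.nonneg_def nonneg_def zero.lhs_def lhs_def)
  then obtain x' where "zero.feasible x'" "independent {j. j < n \<and> int M - 1 \<le> x' j}"
    using zero.reduce_large[of x] by (auto simp: zero.obj_def zero.M_def M_def)
  then show ?thesis using structured_candidate[of x']
    by (auto simp: zero.feasible_def feasible_def zero.nonneg_def nonneg_def zero.lhs_def lhs_def)
qed

text \<open>A ray has all lower digits 0, so its weight is a multiple of \<open>K^m\<close>. The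
  table entry at that weight is at least as good; it need not be short, but by
  \<open>ray_of_weight\<close> it is again a ray.\<close>

lemma improving_ray:
  "(\<exists>g. short_ray g \<and> 0 < obj g) \<Longrightarrow> \<exists>V. 0 \<le> V \<and> V < int H \<and> F V \<and> V mod K ^ m = 0 \<and> 0 < v V"
  and unbounded_direction:
  "0 \<le> V \<Longrightarrow> V < int H \<Longrightarrow> F V \<Longrightarrow> V mod K ^ m = 0 \<Longrightarrow> 0 < v V \<Longrightarrow> ray (U V) \<and> 0 < obj (U V)"
proof -
  assume "\<exists>g. short_ray g \<and> 0 < obj g"
  then obtain g where g: "ray g" "\<forall>j<n. g j \<le> int M - 1" "0 < obj g" by (auto simp: short_ray_def)
  then have nn: "nonneg g" and D: "(\<Sum>j<n. g j) \<le> int D" by (auto simp: ray_def intro: sum_le_D)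
  have "weight g = (\<Sum>j<n. g j) * K ^ m" using g(1) by (simp add: weight_eq ray_def)
  then have "weight g mod K ^ m = 0" by simp
  moreover have "F (weight g)" "obj g \<le> v (weight g)"
    using table[OF weight_less_H[OF nn D]] nn by (auto simp: table_entry_def)
  ultimately show "\<exists>V. 0 \<le> V \<and> V < int H \<and> F V \<and> V mod K ^ m = 0 \<and> 0 < v V"
    using weight_less_H[OF nn D] g(3) by (intro exI[of _ "weight g"]) auto
next
  assume V: "0 \<le> V" "V < int H" "F V" "V mod K ^ m = 0" "0 < v V"
  then have U: "nonneg (U V)" "weight (U V) = V" "obj (U V) = v V"
    using table[OF V(1,2)] by (auto simp: table_entry_def)
  have "V = (V div K ^ m) * K ^ m" using V(4) by auto
  then show "ray (U V) \<and> 0 < obj (U V)"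
    using ray_of_weight[OF U(1), of "V div K ^ m"] U V by auto
qed

lemma best_candidate:
  assumes "feasible x" and "\<nexists>V. 0 \<le> V \<and> V < int H \<and> F V \<and> V mod K ^ m = 0 \<and> 0 < v V"
  shows "\<exists>V e. 0 \<le> V \<and> V < int H \<and> F V \<and> 0 \<le> e \<and> e < G ^ r
           \<and> feasible (cand e (U V)) \<and> obj x \<le> obj (cand e (U V))"
proof -
  obtain x' where "feasible x'" "obj x \<le> obj x'" "independent {j. j < n \<and> int M - 1 \<le> x' j}"
    using reduce_large[OF assms(1)] assms(2) improving_ray by (meson not_less)
  then obtain V e where "0 \<le> V" "V < int H" "F V" "0 \<le> e" "e < G ^ r" "feasible (cand e (U V))"
    "obj x' \<le> obj (cand e (U V))"
    using structured_candidate[of x'] by blast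
  then show ?thesis using \<open>obj x \<le> obj x'\<close> by (intro exI[of _ V] exI[of _ e]) auto
qed

end

lemma unbounded_along_ray:
  assumes "feasible x" "ray g" "0 < obj g"
  shows "\<exists>y. feasible y \<and> t < obj y"
proof -
  define k where "k = int (nat (t - obj x + 1))"
  define y where "y j = x j + k * g j" for j
  have y: "y = (\<lambda>j. x j + k * g j)" by (simp add: y_def fun_eq_iff)
  have "0 \<le> k" by (simp add: k_def)
  then have "nonneg y" using assms(1,2) by (simp add: nonneg_def feasible_def ray_def y_def)
  moreover have "lhs y i = b i" if "i < m" for i
    using assms(1,2) that unfolding y lhs_add lhs_scale by (simp add: feasible_def ray_def)
  ultimately have "feasible y" by (simp add: feasible_def)
  moreover have "t < obj y"
  proof -
    have "k * 1 \<le> k * obj g" using assms(3) by (intro mult_left_mono) (auto simp: k_def)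
    moreover have "t - obj x < k" by (simp add: k_def)
    ultimately show ?thesis unfolding y obj_add obj_scale by linarith
  qed
  ultimately show ?thesis by blast
qed

end

section \<open>Reasoning about programs and their running time\<close>

text \<open>Since \<open>exec\<close> is deterministic, the existential statement is total
  correctness with a time bound.\<close>

definition runs :: "com \<Rightarrow> state \<Rightarrow> nat \<Rightarrow> (state \<Rightarrow> bool) \<Rightarrow> bool" where
  "runs p s T Q \<longleftrightarrow> (\<exists>t s'. exec p s t s' \<and> t \<le> T \<and> Q s')"

fun mods :: "com \<Rightarrow> string set" where
  "mods Skip = {}"
| "mods (Assign a e f) = {a}"
| "mods (Seq p q) = mods p \<union> mods q"
| "mods (If \<beta> p q) = mods p \<union> mods q"
| "mods (While \<beta> p) = mods p"

abbreviation same_outside :: "string set \<Rightarrow> state \<Rightarrow> state \<Rightarrow> bool" where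
  "same_outside X s s' \<equiv> \<forall>a. a \<notin> X \<longrightarrow> s' a = s a"

lemma exec_mods: "exec p s t s' \<Longrightarrow> same_outside (mods p) s s'"
  by (induction rule: exec.induct) auto

text \<open>The frame condition is supplied when the postcondition is weakened, so specifications
  need not list the arrays left untouched.\<close>

lemma runs_mono:
  assumes "runs p s T R" "\<And>s'. R s' \<Longrightarrow> same_outside (mods p) s s' \<Longrightarrow> Q s'" "T \<le> T'"
  shows "runs p s T' Q"
  using assms exec_mods unfolding runs_def by (meson order_trans)

lemma runs_Skip: "Q s \<Longrightarrow> 1 \<le> T \<Longrightarrow> runs Skip s T Q"
  unfolding runs_def using exec.Skip by blast

lemma runs_Assign:
  "Q (s(a := (s a)(ival e s := ival f s))) \<Longrightarrow> itime e + itime f + 1 \<le> T \<Longrightarrow> runs (Assign a e f) s T Q"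
  unfolding runs_def using exec.Assign by blast

lemma runs_Seq:
  assumes "runs p s T R" "\<And>s'. R s' \<Longrightarrow> same_outside (mods p) s s' \<Longrightarrow> runs q s' T' Q" "T + T' \<le> T''"
  shows "runs (Seq p q) s T'' Q"
proof -
  obtain t s' where 1: "exec p s t s'" "t \<le> T" "R s'" using assms(1) by (auto simp: runs_def)
  then obtain u s'' where 2: "exec q s' u s''" "u \<le> T'" "Q s''"
    using assms(2)[OF 1(3) exec_mods[OF 1(1)]] by (auto simp: runs_def)
  have "exec (Seq p q) s (t + u) s''" using 1 2 exec.Seq by blast
  then show ?thesis using 1 2 assms(3) unfolding runs_def by (meson add_mono order_trans)
qed

lemma runs_Seq_wp:
  assumes "runs p s T (\<lambda>s'. runs q s' T' Q)" "T + T' \<le> T''"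
  shows "runs (Seq p q) s T'' Q"
  using runs_Seq[OF assms(1) _ assms(2)] by blast

lemma runs_Seq_Assign:
  assumes "runs q (s(a := (s a)(ival e s := ival f s))) T Q" "itime e + itime f + 1 + T \<le> T'"
  shows "runs (Seq (Assign a e f) q) s T' Q"
proof -
  obtain u s'' where "exec q (s(a := (s a)(ival e s := ival f s))) u s''" "u \<le> T" "Q s''"
    using assms(1) by (auto simp: runs_def)
  then show ?thesis
    using exec.Seq[OF exec.Assign] assms(2) unfolding runs_def by (meson add_left_mono order_trans)
qed

lemma runs_Seq_Assign_eq:
  assumes "runs q s' T Q" "s(a := (s a)(ival e s := ival f s)) = s'" "itime e + itime f + 1 + T \<le> T'"
  shows "runs (Seq (Assign a e f) q) s T' Q"
  using runs_Seq_Assign assms by blast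

lemma runs_If:
  assumes "bval \<beta> s \<Longrightarrow> runs p s T Q" "\<not> bval \<beta> s \<Longrightarrow> runs q s T Q" "btime \<beta> + 1 + T \<le> T'"
  shows "runs (If \<beta> p q) s T' Q"
proof (cases "bval \<beta> s")
  case True
  then obtain t s' where "exec p s t s'" "t \<le> T" "Q s'" using assms(1) by (auto simp: runs_def)
  then show ?thesis using exec.IfTrue[OF True] assms(3) unfolding runs_def
    by (meson add_left_mono order_trans)
next
  case False
  then obtain t s' where "exec q s t s'" "t \<le> T" "Q s'" using assms(2) by (auto simp: runs_def)
  then show ?thesis using exec.IfFalse[OF False] assms(3) unfolding runs_def
    by (meson add_left_mono order_trans)
qed

abbreviation (input) scalar :: "string \<Rightarrow> iexp" where
  "scalar x \<equiv> Cell x (Const 0)"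

abbreviation (input) assign :: "string \<Rightarrow> iexp \<Rightarrow> com" where
  "assign x e \<equiv> Assign x (Const 0) e"

notation Seq (infixr ";;" 55)

definition maximize :: "string \<Rightarrow> iexp \<Rightarrow> com" where
  "maximize x e = If (Lt (scalar x) e) (assign x e) Skip"

lemma mods_maximize [simp]: "mods (maximize x e) = {x}"
  by (simp add: maximize_def)

lemma runs_maximize:
  assumes "Q (s(x := (s x)(0 := max (s x 0) (ival e s))))" "2 * itime e + 7 \<le> T"
  shows "runs (maximize x e) s T Q"
  unfolding maximize_def
proof (rule runs_If[where T = "itime e + 2"])
  assume "bval (Lt (scalar x) e) s"
  then have "max (s x 0) (ival e s) = ival e s" by simp
  then show "runs (assign x e) s (itime e + 2) Q" using assms by (intro runs_Assign) auto
next
  assume "\<not> bval (Lt (scalar x) e) s"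
  then have "max (s x 0) (ival e s) = s x 0" by simp
  then show "runs Skip s (itime e + 2) Q" using assms by (intro runs_Skip) auto
qed (use assms in simp)

section \<open>Counting loops\<close>

definition For :: "string \<Rightarrow> iexp \<Rightarrow> com \<Rightarrow> com" where
  "For i e p = Seq (assign i (Const 0))
     (While (Lt (scalar i) e) (Seq p (assign i (Add (scalar i) (Const 1)))))"

lemma mods_For [simp]: "mods (For i e p) = insert i (mods p)"
  by (auto simp: For_def)

text \<open>The guard re-evaluates \<open>e\<close>, so its value must stay \<open>N\<close>
  throughout. An iteration costs \<open>itime e + 4\<close> for the guard, \<open>T\<close> for the
  body and 6 for the increment; the initialisation costs 3 and the final guard
  \<open>itime e + 4\<close>. The invariant is restored after the counter has been increased, whence
  the updated state in \<open>step\<close>.\<close>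

lemma runs_For:
  assumes init: "I 0 (s(i := (s i)(0 := 0)))"
    and fresh: "i \<notin> mods p"
    and bound: "\<And>k s'. k \<le> N \<Longrightarrow> I k s' \<Longrightarrow> same_outside (insert i (mods p)) s s' \<Longrightarrow> s' i 0 = int k
      \<Longrightarrow> ival e s' = int N"
    and step: "\<And>k s'. k < N \<Longrightarrow> I k s' \<Longrightarrow> same_outside (insert i (mods p)) s s' \<Longrightarrow> s' i 0 = int k
      \<Longrightarrow> runs p s' T (\<lambda>s''. I (Suc k) (s''(i := (s'' i)(0 := int (Suc k)))))"
    and post: "\<And>s'. I N s' \<Longrightarrow> same_outside (insert i (mods p)) s s' \<Longrightarrow> s' i 0 = int N \<Longrightarrow> Q s'"
    and time: "N * (T + itime e + 10) + itime e + 7 \<le> T'"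
  shows "runs (For i e p) s T' Q"
proof -
  let ?W = "While (Lt (scalar i) e) (Seq p (assign i (Add (scalar i) (Const 1))))"
  have loop: "runs ?W s' (d * (T + itime e + 10) + itime e + 4) Q"
    if "d + k = N" "I k s'" "same_outside (insert i (mods p)) s s'" "s' i 0 = int k" for d k s'
    using that
  proof (induction d arbitrary: k s')
    case 0
    then have "\<not> bval (Lt (scalar i) e) s'" using bound[of k s'] by simp
    from exec.WhileFalse[OF this] post 0 show ?case unfolding runs_def by fastforce
  next
    case (Suc d)
    then have k: "k < N" by simp
    have b: "bval (Lt (scalar i) e) s'" using bound[of k s'] Suc.prems k by simp
    obtain t s1 where 1: "exec p s' t s1" "t \<le> T" "I (Suc k) (s1(i := (s1 i)(0 := int (Suc k))))"
      using step[OF k Suc.prems(2-4)] by (auto simp: runs_def)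
    have s1: "same_outside (mods p) s' s1" using exec_mods[OF 1(1)] .
    then have "s1 i 0 = int k" using fresh Suc.prems(4) by simp
    then have 2: "exec (assign i (Add (scalar i) (Const 1))) s1 6 (s1(i := (s1 i)(0 := int (Suc k))))"
      using exec.Assign[of i "Const 0" "Add (scalar i) (Const 1)" s1]
      by (simp add: add.commute eval_nat_numeral)
    let ?s2 = "s1(i := (s1 i)(0 := int (Suc k)))"
    have "same_outside (insert i (mods p)) s ?s2" using s1 Suc.prems(3) by auto
    moreover have "d + Suc k = N" "?s2 i 0 = int (Suc k)" using Suc.prems(1) by auto
    ultimately have "runs ?W ?s2 (d * (T + itime e + 10) + itime e + 4) Q"
      using Suc.IH[OF _ 1(3)] by blast
    then obtain u s3 where 3: "exec ?W ?s2 u s3" "u \<le> d * (T + itime e + 10) + itime e + 4" "Q s3"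
      unfolding runs_def by blast
    have "exec ?W s' (btime (Lt (scalar i) e) + 1 + (t + 6) + u) s3"
      using exec.WhileTrue[OF b exec.Seq[OF 1(1) 2] 3(1)] .
    then show ?case unfolding runs_def using 1(2) 3(2,3) by (intro exI conjI) auto
  qed
  have 0: "exec (assign i (Const 0)) s 3 (s(i := (s i)(0 := 0)))"
    using exec.Assign[of i "Const 0" "Const 0" s] by (simp add: eval_nat_numeral)
  have "same_outside (insert i (mods p)) s (s(i := (s i)(0 := 0)))" by simp
  then have "runs ?W (s(i := (s i)(0 := 0))) (N * (T + itime e + 10) + itime e + 4) Q"
    using loop[of N 0, OF _ init] by simp
  then obtain u s' where "exec ?W (s(i := (s i)(0 := 0))) u s'"
      "u \<le> N * (T + itime e + 10) + itime e + 4" "Q s'"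
    unfolding runs_def by blast
  then show ?thesis unfolding runs_def For_def
    using exec.Seq[OF 0] time by (intro exI[of _ "3 + u"] exI[of _ s']) auto
qed

section \<open>Computing the parameters\<close>

definition compute_max :: com where
  "compute_max = For ''k'' (Mul (scalar ''m'') (scalar ''n''))
     (Seq (maximize ''d'' (Cell ''A'' (scalar ''k'')))
          (maximize ''d'' (Sub (Const 0) (Cell ''A'' (scalar ''k'')))))"

text \<open>\<open>P\<close> and \<open>G\<close> only receive their initial values 1 and
  \<open>n\<close> here; \<open>compute_weights\<close> multiplies them by \<open>K\<close> and
  \<open>Q\<close> once per row, so that \<open>P\<close> is the current power of \<open>K\<close>
  and finally \<open>K^m\<close>.\<close>

definition compute_sizes :: com where
  "compute_sizes =
     assign ''M'' (Const 1) ;;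
     For ''k'' (scalar ''m'') (assign ''M'' (Mul (scalar ''M'') (Mul (scalar ''n'') (scalar ''d'')))) ;;
     assign ''D'' (Mul (scalar ''n'') (Sub (scalar ''M'') (Const 1))) ;;
     assign ''K'' (Mul (Mul (Const 4) (Add (scalar ''D'') (Const 1))) (scalar ''d'')) ;;
     assign ''Q'' (Add (Mul (Const 2) (scalar ''M'')) (Const 1)) ;;
     assign ''P'' (Const 1) ;;
     assign ''G'' (scalar ''n'') ;;
     If (Lt (scalar ''m'') (scalar ''n'')) (assign ''r'' (scalar ''m'')) (assign ''r'' (scalar ''n''))"

definition add_row :: com where
  "add_row = For ''j'' (scalar ''n'') (Assign ''w'' (scalar ''j'') (Add (Cell ''w'' (scalar ''j''))
      (Mul (Cell ''A'' (Add (Mul (scalar ''i'') (scalar ''n'')) (scalar ''j''))) (scalar ''P''))))"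

definition compute_weights :: com where
  "compute_weights =
     For ''i'' (scalar ''m'')
       (add_row ;; assign ''P'' (Mul (scalar ''P'') (scalar ''K'')) ;; assign ''G'' (Mul (scalar ''G'') (scalar ''Q''))) ;;
     For ''j'' (scalar ''n'') (Assign ''w'' (scalar ''j'') (Add (Cell ''w'' (scalar ''j'')) (scalar ''P''))) ;;
     assign ''E'' (Const 1) ;;
     For ''k'' (scalar ''r'') (assign ''E'' (Mul (scalar ''E'') (scalar ''G''))) ;;
     assign ''H'' (Add (Mul (Mul (Const 2) (scalar ''D'')) (scalar ''P'')) (Const 1))"

section \<open>Correctness of the parameters, with cost O(m n)\<close>

context integer_program
begin

definition stores_input :: "state \<Rightarrow> bool" where
  "stores_input s \<longleftrightarrow> s ''m'' 0 = int m \<and> s ''n'' 0 = int n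
     \<and> (\<forall>i<m. \<forall>j<n. s ''A'' (int i * int n + int j) = A i j)
     \<and> (\<forall>i<m. s ''b'' (int i) = b i) \<and> (\<forall>j<n. s ''c'' (int j) = c j)"

lemma stores_input_same:
  "stores_input s \<Longrightarrow> same_outside X s s' \<Longrightarrow> X \<inter> {''m'', ''n'', ''A'', ''b'', ''c''} = {} \<Longrightarrow> stores_input s'"
  by (auto simp: stores_input_def)

lemma mn_ge: "1 \<le> m * n" "m \<le> m * n" "n \<le> m * n"
  using m n by auto

lemma runs_compute_max:
  assumes s: "stores_input s" "s ''d'' 0 = 0" and attained: "\<exists>i<m. \<exists>j<n. \<bar>A i j\<bar> = int \<Delta>"
  shows "runs compute_max s (60 * (m * n)) (\<lambda>s'. s' ''d'' 0 = int \<Delta>)"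
proof -
  have A: "s ''A'' (int l) = A (l div n) (l mod n)" "\<bar>s ''A'' (int l)\<bar> \<le> int \<Delta>" if "l < m * n" for l
  proof -
    have *: "l div n < m" "l mod n < n" using that n by (auto simp: less_mult_imp_div_less)
    have "int l = int (l div n) * int n + int (l mod n)"
      by (simp flip: of_nat_mult of_nat_add)
    then show "s ''A'' (int l) = A (l div n) (l mod n)" using s(1) * by (simp add: stores_input_def)
    then show "\<bar>s ''A'' (int l)\<bar> \<le> int \<Delta>" using A_le * by simp
  qed
  let ?I = "\<lambda>k s'. 0 \<le> s' ''d'' 0 \<and> s' ''d'' 0 \<le> int \<Delta> \<and> (\<forall>l<k. \<bar>s ''A'' (int l)\<bar> \<le> s' ''d'' 0)"
  show ?thesis
    unfolding compute_max_def
  proof (rule runs_For[where I = ?I and N = "m * n" and T = 30])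
    fix k s'
    assume k: "k < m * n" and I: "?I k s'" and s': "same_outside (insert ''k'' (mods (Seq (maximize ''d'' (Cell ''A'' (scalar ''k'')))
          (maximize ''d'' (Sub (Const 0) (Cell ''A'' (scalar ''k''))))))) s s'" "s' ''k'' 0 = int k"
    have sA: "s' ''A'' = s ''A''" using s' by simp
    show "runs (Seq (maximize ''d'' (Cell ''A'' (scalar ''k'')))
          (maximize ''d'' (Sub (Const 0) (Cell ''A'' (scalar ''k''))))) s' 30
          (\<lambda>s''. ?I (Suc k) (s''(''k'' := (s'' ''k'')(0 := int (Suc k)))))"
      apply (rule runs_Seq_wp[where T = 13 and T' = 17], rule runs_maximize, rule runs_maximize)
      using A(2)[OF k] I k
      by (auto simp: less_Suc_eq sA s'(2))
  next
    fix s' assume I: "?I (m * n) s'"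
    obtain i j where ij: "i < m" "j < n" "\<bar>A i j\<bar> = int \<Delta>" using attained by blast
    have "i * n + j < (i + 1) * n" using ij by simp
    also have "\<dots> \<le> m * n" using ij by (intro mult_right_mono) auto
    finally have l: "i * n + j < m * n" .
    have "int \<Delta> \<le> s' ''d'' 0" using I l A(1)[OF l] ij by auto
    then show "s' ''d'' 0 = int \<Delta>" using I by simp
  next
    show "m * n * (30 + itime (Mul (scalar ''m'') (scalar ''n'')) + 10)
        + itime (Mul (scalar ''m'') (scalar ''n'')) + 7 \<le> 60 * (m * n)"
      using mn_ge(1) by (simp del: one_le_mult_iff)
  qed (use s in \<open>auto simp: stores_input_def\<close>)
qed

lemma runs_compute_sizes:
  assumes s: "stores_input s" "s ''d'' 0 = int \<Delta>"
  shows "runs compute_sizes s (200 * (m * n)) (\<lambda>s'. s' ''M'' 0 = int M \<and> s' ''D'' 0 = int D \<and> s' ''K'' 0 = K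
    \<and> s' ''Q'' 0 = Q \<and> s' ''r'' 0 = int r \<and> s' ''P'' 0 = 1 \<and> s' ''G'' 0 = int n)"
  unfolding compute_sizes_def
proof (rule runs_Seq_Assign[where T = "25 * m + 100"], rule runs_Seq[where T = "25 * m + 10" and T' = 90 and R = "\<lambda>s'. s' ''M'' 0 = int M"])
  let ?s = "s(''M'' := (s ''M'')(ival (Const 0) s := ival (Const 1) s))"
  show "runs (For ''k'' (scalar ''m'') (assign ''M'' (Mul (scalar ''M'') (Mul (scalar ''n'') (scalar ''d''))))) ?s
     (25 * m + 10) (\<lambda>s'. s' ''M'' 0 = int M)"
  proof (rule runs_For[where I = "\<lambda>k s'. s' ''M'' 0 = int ((n * \<Delta>) ^ k)" and N = m and T = 10])
    fix k s'
    assume I: "s' ''M'' 0 = int ((n * \<Delta>) ^ k)" and s': "same_outside (insert ''k'' (mods (assign ''M'' (Mul (scalar ''M'') (Mul (scalar ''n'') (scalar ''d'')))))) ?s s'"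
    have "s' ''n'' 0 = int n" "s' ''d'' 0 = int \<Delta>" using s' s by (auto simp: stores_input_def)
    then show "runs (assign ''M'' (Mul (scalar ''M'') (Mul (scalar ''n'') (scalar ''d'')))) s' 10
      (\<lambda>s''. (s''(''k'' := (s'' ''k'')(0 := int (Suc k)))) ''M'' 0 = int ((n * \<Delta>) ^ Suc k))"
      using I by (intro runs_Assign) auto
  qed (use s in \<open>auto simp: stores_input_def M_def\<close>)
next
  fix s'
  assume M: "s' ''M'' 0 = int M" and "same_outside (mods (For ''k'' (scalar ''m'') (assign ''M'' (Mul (scalar ''M'') (Mul (scalar ''n'') (scalar ''d'')))))) (s(''M'' := (s ''M'')(ival (Const 0) s := ival (Const 1) s))) s'"
  then have s': "s' ''n'' 0 = int n" "s' ''m'' 0 = int m" "s' ''d'' 0 = int \<Delta>" using s by (auto simp: stores_input_def)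
  have D: "int n * (int M - 1) = int D" using M_ge_1 by (simp add: D_def)
  show "runs (
     assign ''D'' (Mul (scalar ''n'') (Sub (scalar ''M'') (Const 1))) ;;
     assign ''K'' (Mul (Mul (Const 4) (Add (scalar ''D'') (Const 1))) (scalar ''d'')) ;;
     assign ''Q'' (Add (Mul (Const 2) (scalar ''M'')) (Const 1)) ;;
     assign ''P'' (Const 1) ;;
     assign ''G'' (scalar ''n'') ;;
     If (Lt (scalar ''m'') (scalar ''n'')) (assign ''r'' (scalar ''m'')) (assign ''r'' (scalar ''n''))) s' 90 (\<lambda>s'. s' ''M'' 0 = int M \<and> s' ''D'' 0 = int D \<and> s' ''K'' 0 = K
    \<and> s' ''Q'' 0 = Q \<and> s' ''r'' 0 = int r \<and> s' ''P'' 0 = 1 \<and> s' ''G'' 0 = int n)"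
    apply (rule runs_Seq_Assign[where T = 75], rule runs_Seq_Assign[where T = 50], rule runs_Seq_Assign[where T = 40],
        rule runs_Seq_Assign[where T = 30], rule runs_Seq_Assign[where T = 20], rule runs_If[where T = 10]; (rule runs_Assign)?)
    using M s' D apply (simp_all add: K_def Q_def r_def)
    done
qed (simp_all, use mn_ge in linarith)

definition stores_sizes :: "state \<Rightarrow> bool" where
  "stores_sizes s \<longleftrightarrow> s ''M'' 0 = int M \<and> s ''Q'' 0 = Q \<and> s ''r'' 0 = int r \<and> s ''P'' 0 = K ^ m
     \<and> s ''E'' 0 = G ^ r \<and> s ''H'' 0 = int H \<and> (\<forall>j<n. s ''w'' (int j) = w j)"

lemma runs_add_row:
  assumes s: "stores_input s" and i: "i < m" "s ''i'' 0 = int i"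
  shows "runs add_row s (40 * n + 10) (\<lambda>s'. \<forall>j<n. s' ''w'' (int j) = s ''w'' (int j) + A i j * s ''P'' 0)"
  unfolding add_row_def
proof (rule runs_For[where I = "\<lambda>k s'. \<forall>j<n. s' ''w'' (int j) = s ''w'' (int j) + (if j < k then A i j * s ''P'' 0 else 0)"
      and N = n and T = 20])
  let ?p = "Assign ''w'' (scalar ''j'') (Add (Cell ''w'' (scalar ''j''))
      (Mul (Cell ''A'' (Add (Mul (scalar ''i'') (scalar ''n'')) (scalar ''j''))) (scalar ''P'')))"
  fix k s'
  assume k: "k < n" and I: "\<forall>j<n. s' ''w'' (int j) = s ''w'' (int j) + (if j < k then A i j * s ''P'' 0 else 0)"
    and same: "same_outside (insert ''j'' (mods ?p)) s s'" and j: "s' ''j'' 0 = int k"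
  have s': "s' ''A'' = s ''A''" "s' ''i'' = s ''i''" "s' ''n'' = s ''n''" "s' ''P'' = s ''P''" using same by auto
  show "runs ?p s' 20 (\<lambda>s''. \<forall>j<n. (s''(''j'' := (s'' ''j'')(0 := int (Suc k)))) ''w'' (int j)
    = s ''w'' (int j) + (if j < Suc k then A i j * s ''P'' 0 else 0))"
    by (rule runs_Assign) (use I k j s i in \<open>auto simp: s' stores_input_def\<close>)
qed (use s in \<open>auto simp: stores_input_def\<close>)

lemma runs_compute_weights:
  assumes s: "stores_input s" "s ''M'' 0 = int M" "s ''D'' 0 = int D" "s ''K'' 0 = K" "s ''Q'' 0 = Q"
    "s ''r'' 0 = int r" "s ''P'' 0 = 1" "s ''G'' 0 = int n" "\<And>j. s ''w'' j = 0"
  shows "runs compute_weights s (300 * (m * n)) stores_sizes"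
  unfolding compute_weights_def
proof (rule runs_Seq[where T = "200 * (m * n)" and T' = "100 * (m * n)" and
      \<comment> \<open>After the loop over the rows the weights lack exactly the common summand
        \<open>K^m\<close>, which the next loop adds from \<open>P\<close>.\<close>
      R = "\<lambda>s'. s' ''P'' 0 = K ^ m \<and> s' ''G'' 0 = G \<and> (\<forall>j<n. s' ''w'' (int j) = w j - K ^ m)"])
  let ?p = "add_row ;; assign ''P'' (Mul (scalar ''P'') (scalar ''K'')) ;; assign ''G'' (Mul (scalar ''G'') (scalar ''Q''))"
  let ?I = "\<lambda>k s'. s' ''P'' 0 = K ^ k \<and> s' ''G'' 0 = int n * Q ^ k \<and> (\<forall>j<n. s' ''w'' (int j) = (\<Sum>i<k. A i j * K ^ i))"
  have mods: "mods ?p = {''j'', ''w'', ''P'', ''G''}" by (auto simp: add_row_def)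
  show "runs (For ''i'' (scalar ''m'') ?p) s (200 * (m * n)) (\<lambda>s'. s' ''P'' 0 = K ^ m \<and> s' ''G'' 0 = G \<and> (\<forall>j<n. s' ''w'' (int j) = w j - K ^ m))"
  proof (rule runs_For[where I = ?I and N = m and T = "40 * n + 30"])
    fix k s'
    assume k: "k < m" and I: "?I k s'" and same: "same_outside (insert ''i'' (mods ?p)) s s'" and i: "s' ''i'' 0 = int k"
    have inp: "stores_input s'" using s(1) same by (rule stores_input_same) (simp add: add_row_def)
    have s': "s' ''K'' = s ''K''" "s' ''Q'' = s ''Q''" using same unfolding mods by auto
    show "runs ?p s' (40 * n + 30) (\<lambda>s''. ?I (Suc k) (s''(''i'' := (s'' ''i'')(0 := int (Suc k)))))"
    proof (rule runs_Seq[OF runs_add_row[OF inp k i], where T' = 20])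
      fix s1
      assume w: "\<forall>j<n. s1 ''w'' (int j) = s' ''w'' (int j) + A k j * s' ''P'' 0" and same1: "same_outside (mods add_row) s' s1"
      have s1: "s1 ''K'' = s ''K''" "s1 ''Q'' = s ''Q''" "s1 ''P'' = s' ''P''" "s1 ''G'' = s' ''G''"
        using same1 s' by (auto simp: add_row_def)
      show "runs (assign ''P'' (Mul (scalar ''P'') (scalar ''K'')) ;; assign ''G'' (Mul (scalar ''G'') (scalar ''Q''))) s1 20
        (\<lambda>s''. ?I (Suc k) (s''(''i'' := (s'' ''i'')(0 := int (Suc k)))))"
        by (rule runs_Seq_Assign[where T = 10], rule runs_Assign) (use w I s in \<open>auto simp: s1\<close>)
    qed simp
  next
    show "m * (40 * n + 30 + itime (scalar ''m'') + 10) + itime (scalar ''m'') + 7 \<le> 200 * (m * n)"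
      by (simp add: algebra_simps) (use mn_ge in linarith)
  next
    fix k s'
    assume "same_outside (insert ''i'' (mods ?p)) s s'"
    then have "s' ''m'' = s ''m''" by (simp add: add_row_def)
    then show "ival (scalar ''m'') s' = int m" using s(1) by (simp add: stores_input_def)
  next
    fix s' assume "?I m s'"
    then show "s' ''P'' 0 = K ^ m \<and> s' ''G'' 0 = G \<and> (\<forall>j<n. s' ''w'' (int j) = w j - K ^ m)"
      by (simp add: G_def w_def)
  qed (simp_all add: s add_row_def)
next
  let ?p = "Assign ''w'' (scalar ''j'') (Add (Cell ''w'' (scalar ''j'')) (scalar ''P''))"
  fix s0
  assume R: "s0 ''P'' 0 = K ^ m \<and> s0 ''G'' 0 = G \<and> (\<forall>j<n. s0 ''w'' (int j) = w j - K ^ m)"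
    and same0: "same_outside (mods (For ''i'' (scalar ''m'') (add_row ;; assign ''P'' (Mul (scalar ''P'') (scalar ''K'')) ;; assign ''G'' (Mul (scalar ''G'') (scalar ''Q''))))) s s0"
  have s0: "s0 ''n'' 0 = int n" "s0 ''M'' 0 = int M" "s0 ''D'' 0 = int D" "s0 ''Q'' 0 = Q" "s0 ''r'' 0 = int r"
    using same0 s by (auto simp: add_row_def stores_input_def)
  show "runs (For ''j'' (scalar ''n'') ?p ;;
     assign ''E'' (Const 1) ;;
     For ''k'' (scalar ''r'') (assign ''E'' (Mul (scalar ''E'') (scalar ''G''))) ;;
     assign ''H'' (Add (Mul (Mul (Const 2) (scalar ''D'')) (scalar ''P'')) (Const 1))) s0 (100 * (m * n)) stores_sizes"
  proof (rule runs_Seq[where T = "30 * n + 10" and T' = "20 * n + 40" and R = "\<lambda>s'. \<forall>j<n. s' ''w'' (int j) = w j"])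
    show "runs (For ''j'' (scalar ''n'') ?p) s0 (30 * n + 10) (\<lambda>s'. \<forall>j<n. s' ''w'' (int j) = w j)"
    proof (rule runs_For[where I = "\<lambda>k s'. \<forall>j<n. s' ''w'' (int j) = (if j < k then w j else w j - K ^ m)" and N = n and T = 10])
      fix k s'
      assume k: "k < n" and I: "\<forall>j<n. s' ''w'' (int j) = (if j < k then w j else w j - K ^ m)"
        and same: "same_outside (insert ''j'' (mods ?p)) s0 s'" and j: "s' ''j'' 0 = int k"
      have "s' ''P'' = s0 ''P''" using same by auto
      then show "runs ?p s' 10 (\<lambda>s''. \<forall>j<n. (s''(''j'' := (s'' ''j'')(0 := int (Suc k)))) ''w'' (int j) = (if j < Suc k then w j else w j - K ^ m))"
        by (intro runs_Assign) (use I k j R in auto)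
    qed (use R s0 in auto)
  next
    fix s1
    assume w: "\<forall>j<n. s1 ''w'' (int j) = w j" and "same_outside (mods (For ''j'' (scalar ''n'') ?p)) s0 s1"
    then have s1: "s1 ''M'' 0 = int M" "s1 ''D'' 0 = int D" "s1 ''Q'' 0 = Q" "s1 ''r'' 0 = int r" "s1 ''P'' 0 = K ^ m" "s1 ''G'' 0 = G"
      using s0 R by auto
    let ?s2 = "s1(''E'' := (s1 ''E'')(ival (Const 0) s1 := ival (Const 1) s1))"
    show "runs (assign ''E'' (Const 1) ;;
       For ''k'' (scalar ''r'') (assign ''E'' (Mul (scalar ''E'') (scalar ''G''))) ;;
       assign ''H'' (Add (Mul (Mul (Const 2) (scalar ''D'')) (scalar ''P'')) (Const 1))) s1 (20 * n + 40) stores_sizes"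
    proof (rule runs_Seq_Assign[where T = "20 * n + 30"], rule runs_Seq[where T = "20 * n + 10" and T' = 20 and R = "\<lambda>s'. s' ''E'' 0 = G ^ r"])
      show "runs (For ''k'' (scalar ''r'') (assign ''E'' (Mul (scalar ''E'') (scalar ''G'')))) ?s2 (20 * n + 10) (\<lambda>s'. s' ''E'' 0 = G ^ r)"
      proof (rule runs_For[where I = "\<lambda>k s'. s' ''E'' 0 = G ^ k" and N = r and T = 8])
        fix k s'
        assume I: "s' ''E'' 0 = G ^ k" and same: "same_outside (insert ''k'' (mods (assign ''E'' (Mul (scalar ''E'') (scalar ''G''))))) ?s2 s'"
        have "s' ''G'' 0 = G" using same s1 by auto
        then show "runs (assign ''E'' (Mul (scalar ''E'') (scalar ''G''))) s' 8 (\<lambda>s''. (s''(''k'' := (s'' ''k'')(0 := int (Suc k)))) ''E'' 0 = G ^ Suc k)"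
          by (intro runs_Assign) (use I in auto)
      next
        have "r \<le> n" by (simp add: r_def)
        then show "r * (8 + itime (scalar ''r'') + 10) + itime (scalar ''r'') + 7 \<le> 20 * n + 10" by simp
      qed (use s1 in auto)
    next
      fix s3
      assume "s3 ''E'' 0 = G ^ r" and "same_outside (mods (For ''k'' (scalar ''r'') (assign ''E'' (Mul (scalar ''E'') (scalar ''G''))))) ?s2 s3"
      then show "runs (assign ''H'' (Add (Mul (Mul (Const 2) (scalar ''D'')) (scalar ''P'')) (Const 1))) s3 20 stores_sizes"
        by (intro runs_Assign) (use s1 w in \<open>auto simp: stores_sizes_def H_eq\<close>)
    qed auto
  next
    show "30 * n + 10 + (20 * n + 40) \<le> 100 * (m * n)" using mn_ge by linarith
  qed
qed simp

end

section \<open>The knapsack table\<close>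

text \<open>For the total weight \<open>V\<close>, the cell \<open>f[V]\<close> is positive iff \<open>V\<close> has been reached; then row \<open>V\<close> of \<open>u\<close> is a
  best solution of weight \<open>V\<close> and \<open>v[V]\<close> its value. The flag \<open>g\<close> records an improving ray. Negative
  weights need no test since the cells of \<open>f\<close> with a negative index are never written.\<close>

definition copy_row :: com where
  "copy_row = For ''l'' (scalar ''n'') (Assign ''u'' (Add (Mul (scalar ''V'') (scalar ''n'')) (scalar ''l''))
     (Cell ''u'' (Add (Mul (scalar ''p'') (scalar ''n'')) (scalar ''l''))))"

definition improve :: com where
  "improve =
     Assign ''f'' (scalar ''V'') (Const 1) ;;
     Assign ''v'' (scalar ''V'') (Add (Cell ''v'' (scalar ''p'')) (Cell ''c'' (scalar ''j''))) ;;
     copy_row ;;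
     Assign ''u'' (Add (Mul (scalar ''V'') (scalar ''n'')) (scalar ''j''))
       (Add (Cell ''u'' (Add (Mul (scalar ''V'') (scalar ''n'')) (scalar ''j''))) (Const 1))"

definition relax :: com where
  "relax =
     assign ''p'' (Sub (scalar ''V'') (Cell ''w'' (scalar ''j''))) ;;
     If (Lt (Const 0) (Cell ''f'' (scalar ''p'')))
       (If (Conj (Lt (Const 0) (Cell ''f'' (scalar ''V'')))
              (Neg (Lt (Cell ''v'' (scalar ''V'')) (Add (Cell ''v'' (scalar ''p'')) (Cell ''c'' (scalar ''j''))))))
          Skip improve)
       Skip"

text \<open>The remainder of \<open>V\<close> modulo \<open>P\<close> is expressed through floor
  division; it is nonnegative, so it vanishes if and only if it is not positive.\<close>

definition flag_ray :: com where
  "flag_ray =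
     If (Conj (Lt (Const 0) (Cell ''f'' (scalar ''V'')))
           (Conj (Lt (Const 0) (Cell ''v'' (scalar ''V'')))
              (Neg (Lt (Const 0) (Sub (scalar ''V'') (Mul (Quot (scalar ''V'') (scalar ''P'')) (scalar ''P'')))))))
       (assign ''g'' (Const 1)) Skip"

definition fill_table :: com where
  "fill_table = assign ''f'' (Const 1) ;;
     For ''V'' (scalar ''H'') (For ''j'' (scalar ''n'') relax ;; flag_ray)"

section \<open>The knapsack recursion, one column at a time\<close>

context integer_program
begin

text \<open>Row \<open>V\<close> after the columns below \<open>j\<close> have been tried as the last summand.\<close>

definition partial_entry :: "bool \<Rightarrow> int \<Rightarrow> (nat \<Rightarrow> int) \<Rightarrow> int \<Rightarrow> nat \<Rightarrow> bool" where
  "partial_entry reached v u V j \<longleftrightarrow> (reached \<longrightarrow> nonneg u \<and> weight u = V \<and> obj u = v)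
     \<and> (\<forall>x. nonneg x \<and> weight x = V \<and> ((\<forall>j'<n. x j' = 0) \<or> (\<exists>j'<j. 0 < x j')) \<longrightarrow> reached \<and> obj x \<le> v)"

lemma table_entry_partial: "table_entry reached v u V \<longleftrightarrow> partial_entry reached v u V n"
proof -
  have "(\<forall>j'<n. x j' = 0) \<or> (\<exists>j'<n. 0 < x j')" if "nonneg x" for x
    using that unfolding nonneg_def by (metis le_less)
  then show ?thesis unfolding table_entry_def partial_entry_def by blast
qed

lemma weight_nonneg: "nonneg x \<Longrightarrow> 0 \<le> weight x"
  unfolding weight_def nonneg_def using w_pos by (intro sum_nonneg mult_nonneg_nonneg) (auto intro: less_imp_le)

lemma partial_entry_neg: "V < 0 \<Longrightarrow> partial_entry False v u V j"
  using weight_nonneg by (fastforce simp: partial_entry_def)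

text \<open>Before any column is tried only the zero vector counts, and its weight is 0, so an
  unreached row is correct for every positive \<open>V\<close>.\<close>

lemma partial_entry_0: "0 < V \<Longrightarrow> partial_entry False v u V 0"
proof -
  assume "0 < V"
  then have "weight x \<noteq> V" if "\<forall>j<n. x j = 0" for x
    using that by (simp add: weight_def)
  then show ?thesis unfolding partial_entry_def by blast
qed

lemma partial_entry_zero: "\<forall>j<n. u j = 0 \<Longrightarrow> partial_entry True 0 u 0 0"
  by (auto simp: partial_entry_def nonneg_def weight_def obj_def)

lemma partial_entry_cong:
  assumes "\<And>j. j < n \<Longrightarrow> u j = u' j"
  shows "partial_entry reached v u V j = partial_entry reached v u' V j"
proof -
  have "nonneg u = nonneg u'" "weight u = weight u'" "obj u = obj u'"
    using assms by (auto simp: nonneg_def weight_def obj_def)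
  then show ?thesis by (simp add: partial_entry_def)
qed

lemma sum_increment:
  fixes a x :: "nat \<Rightarrow> int"
  assumes "j < n"
  shows "(\<Sum>l<n. a l * (x l + (if l = j then d else 0))) = (\<Sum>l<n. a l * x l) + d * a j"
proof -
  have "(\<Sum>l<n. a l * (x l + (if l = j then d else 0))) = (\<Sum>l<n. a l * x l + (if l = j then a l * d else 0))"
    by (intro sum.cong) (auto simp: distrib_left)
  then show ?thesis using assms by (simp add: sum.distrib)
qed

lemma weight_increment: "j < n \<Longrightarrow> weight (\<lambda>l. x l + (if l = j then d else 0)) = weight x + d * w j"
  and obj_increment: "j < n \<Longrightarrow> obj (\<lambda>l. x l + (if l = j then d else 0)) = obj x + d * c j"
  unfolding weight_def obj_def by (rule sum_increment, assumption)+

text \<open>A vector with a positive entry at \<open>j\<close> arises from one of weight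
  \<open>V - w j\<close> by adding one copy of column \<open>j\<close>. The predecessor row is taken
  complete, over all columns, since further copies of any column may occur. The three cases are the
  branches of \<open>relax\<close>.\<close>

lemma partial_entry_step:
  assumes old: "partial_entry R v u V j" and pred: "table_entry R' v' u' (V - w j)" and j: "j < n"
  shows "\<not> R' \<Longrightarrow> partial_entry R v u V (Suc j)"
    and "R' \<Longrightarrow> R \<Longrightarrow> v' + c j \<le> v \<Longrightarrow> partial_entry R v u V (Suc j)"
    and "R' \<Longrightarrow> \<not> (R \<and> v' + c j \<le> v) \<Longrightarrow>
      partial_entry True (v' + c j) (\<lambda>l. u' l + (if l = j then 1 else 0)) V (Suc j)"
proof -
  have through_j: "R' \<and> obj x \<le> v' + c j" if x: "nonneg x" "weight x = V" "0 < x j" for x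
  proof -
    let ?x = "\<lambda>l. x l + (if l = j then - 1 else 0)"
    have "nonneg ?x" using x by (auto simp: nonneg_def)
    moreover have "weight ?x = V - w j" "obj ?x = obj x - c j"
      using x(2) weight_increment[OF j, of x "- 1"] obj_increment[OF j, of x "- 1"] by auto
    ultimately show ?thesis using pred by (auto simp: table_entry_def)
  qed
  have split: "((\<forall>j'<n. x j' = 0) \<or> (\<exists>j'<Suc j. 0 < x j'))
      \<longleftrightarrow> ((\<forall>j'<n. x j' = 0) \<or> (\<exists>j'<j. 0 < x j')) \<or> 0 < x j" for x :: "nat \<Rightarrow> int"
    by (auto simp: less_Suc_eq)
  show "\<not> R' \<Longrightarrow> partial_entry R v u V (Suc j)"
    using old through_j unfolding partial_entry_def split by blast
  show "R' \<Longrightarrow> R \<Longrightarrow> v' + c j \<le> v \<Longrightarrow> partial_entry R v u V (Suc j)"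
    using old through_j unfolding partial_entry_def split by (meson order_trans)
  assume new: "R'" "\<not> (R \<and> v' + c j \<le> v)"
  have u': "nonneg u'" "weight u' = V - w j" "obj u' = v'" using pred new(1) by (auto simp: table_entry_def)
  have old': "obj x \<le> v' + c j" if "nonneg x" "weight x = V" "(\<forall>j'<n. x j' = 0) \<or> (\<exists>j'<j. 0 < x j')" for x
  proof -
    have "R" "obj x \<le> v" using old that unfolding partial_entry_def by blast+
    then show ?thesis using new(2) by simp
  qed
  have "nonneg (\<lambda>l. u' l + (if l = j then 1 else 0))" using u'(1) by (auto simp: nonneg_def)
  moreover have "weight (\<lambda>l. u' l + (if l = j then 1 else 0)) = V"
    "obj (\<lambda>l. u' l + (if l = j then 1 else 0)) = v' + c j"
    using u' weight_increment[OF j, of u' 1] obj_increment[OF j, of u' 1] by auto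
  ultimately show "partial_entry True (v' + c j) (\<lambda>l. u' l + (if l = j then 1 else 0)) V (Suc j)"
    using old' through_j unfolding partial_entry_def split by blast
qed

section \<open>The table in memory and the program that fills it\<close>

definition reached :: "state \<Rightarrow> int \<Rightarrow> bool" where
  "reached s V \<longleftrightarrow> 0 < s ''f'' V"
text \<open>For \<open>l \<ge> n\<close> this reads into later rows; comparisons of rows are
  therefore restricted to \<open>l < n\<close>.\<close>

definition stored :: "state \<Rightarrow> int \<Rightarrow> nat \<Rightarrow> int" where
  "stored s V l = s ''u'' (V * int n + int l)"
definition row :: "state \<Rightarrow> int \<Rightarrow> nat \<Rightarrow> bool" where
  "row s V j \<longleftrightarrow> partial_entry (reached s V) (s ''v'' V) (stored s V) V j"

lemma row_index_eq:
  assumes "l < n" "l' < n" "V * int n + int l = V' * int n + int l'"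
  shows "V = V'" "l = l'"
proof -
  have *: "(V * int n + int l) div int n = V" "(V' * int n + int l') div int n = V'" using assms(1,2) by simp_all
  then show "V = V'" using assms(3) by simp
  then show "l = l'" using assms by simp
qed

definition same_rows :: "state \<Rightarrow> state \<Rightarrow> int set \<Rightarrow> bool" where
  "same_rows s s' X \<longleftrightarrow> (\<forall>V. V \<notin> X \<longrightarrow> s' ''f'' V = s ''f'' V \<and> s' ''v'' V = s ''v'' V
      \<and> (\<forall>l<n. stored s' V l = stored s V l))"

lemma row_same_rows: "same_rows s s' X \<Longrightarrow> V \<notin> X \<Longrightarrow> row s' V j = row s V j"
  unfolding row_def same_rows_def reached_def using partial_entry_cong[of "stored s' V" "stored s V"] by simp

text \<open>With \<open>p \<noteq> V\<close> the source row is never written during the copy. The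
  condition holds in \<open>relax\<close> because weights are positive.\<close>

lemma runs_copy_row:
  assumes s: "s ''n'' 0 = int n" "s ''V'' 0 = V" "s ''p'' 0 = p" "p \<noteq> V"
  shows "runs copy_row s (30 * n + 10) (\<lambda>s'. \<forall>W. \<forall>l<n. stored s' W l = (if W = V then stored s p l else stored s W l))"
  unfolding copy_row_def
proof (rule runs_For[where N = n and T = 18 and
      I = "\<lambda>k s'. \<forall>W. \<forall>l<n. stored s' W l = (if W = V \<and> l < k then stored s p l else stored s W l)"])
  let ?p = "Assign ''u'' (Add (Mul (scalar ''V'') (scalar ''n'')) (scalar ''l''))
     (Cell ''u'' (Add (Mul (scalar ''p'') (scalar ''n'')) (scalar ''l'')))"
  fix k s'
  assume k: "k < n" and I: "\<forall>W. \<forall>l<n. stored s' W l = (if W = V \<and> l < k then stored s p l else stored s W l)"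
    and same: "same_outside (insert ''l'' (mods ?p)) s s'" and l: "s' ''l'' 0 = int k"
  have s': "s' ''n'' 0 = int n" "s' ''V'' 0 = V" "s' ''p'' 0 = p" using same s by auto
  have pk: "s' ''u'' (p * int n + int k) = stored s p k"
    using I k s(4) by (auto simp: stored_def)
  show "runs ?p s' 18 (\<lambda>s''. \<forall>W. \<forall>l<n. stored (s''(''l'' := (s'' ''l'')(0 := int (Suc k)))) W l
      = (if W = V \<and> l < Suc k then stored s p l else stored s W l))"
  proof (rule runs_Assign, intro allI impI)
    fix W l assume "l < n"
    show "stored ((s'(''u'' := (s' ''u'')(ival (Add (Mul (scalar ''V'') (scalar ''n'')) (scalar ''l'')) s'
        := ival (Cell ''u'' (Add (Mul (scalar ''p'') (scalar ''n'')) (scalar ''l''))) s')))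
        (''l'' := ((s'(''u'' := (s' ''u'')(ival (Add (Mul (scalar ''V'') (scalar ''n'')) (scalar ''l'')) s'
        := ival (Cell ''u'' (Add (Mul (scalar ''p'') (scalar ''n'')) (scalar ''l''))) s'))) ''l'')(0 := int (Suc k)))) W l
      = (if W = V \<and> l < Suc k then stored s p l else stored s W l)"
    proof (cases "W = V \<and> l = k")
      case True
      then show ?thesis using s' assms l pk by (simp add: stored_def)
    next
      case False
      then have "W * int n + int l \<noteq> V * int n + int k" using row_index_eq[OF \<open>l < n\<close> k] by blast
      moreover have "s' ''u'' (W * int n + int l) = (if W = V \<and> l < k then stored s p l else stored s W l)"
        using I \<open>l < n\<close> by (simp add: stored_def)
      ultimately show ?thesis using s' l False by (auto simp: stored_def less_Suc_eq)
    qed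
  qed simp
next
  fix k s'
  assume "same_outside (insert ''l'' (mods (Assign ''u'' (Add (Mul (scalar ''V'') (scalar ''n'')) (scalar ''l''))
     (Cell ''u'' (Add (Mul (scalar ''p'') (scalar ''n'')) (scalar ''l'')))))) s s'"
  then have "s' ''n'' = s ''n''" by simp
  then show "ival (scalar ''n'') s' = int n" using s(1) by simp
next
  fix s'
  assume "\<forall>W. \<forall>l<n. stored s' W l = (if W = V \<and> l < n then stored s p l else stored s W l)"
  then show "\<forall>W. \<forall>l<n. stored s' W l = (if W = V then stored s p l else stored s W l)" by simp
qed (simp_all add: stored_def)

lemma runs_relax:
  assumes s: "stores_input s" "stores_sizes s" and V: "s ''V'' 0 = V" and j: "j < n" "s ''j'' 0 = int j"
    and row: "row s V j" and pred: "row s (V - w j) n"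
  shows "runs relax s (30 * n + 150) (\<lambda>s'. row s' V (Suc j) \<and> same_rows s s' {V})"
proof -
  let ?p = "V - w j"
  have pV: "?p \<noteq> V" using w_pos[OF j(1)] by simp
  have c: "s ''c'' (int j) = c j" "s ''w'' (int j) = w j" "s ''n'' 0 = int n"
    using s j by (auto simp: stores_input_def stores_sizes_def)
  let ?s1 = "s(''p'' := (s ''p'')(0 := ?p))"
  have same1: "same_rows s ?s1 {}" by (simp add: same_rows_def stored_def)
  have row1: "row ?s1 V j'" if "row s V j'" for j'
    using row_same_rows[OF same1, of V j'] that by simp
  note old = partial_entry_step[OF row[unfolded row_def] pred[unfolded row_def table_entry_partial[symmetric]] j(1)]
  have improve: "runs improve ?s1 (30 * n + 60) (\<lambda>s'. row s' V (Suc j) \<and> same_rows s s' {V})"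
    if R: "reached s ?p" "\<not> (reached s V \<and> s ''v'' ?p + c j \<le> s ''v'' V)"
  proof -
    let ?s2 = "?s1(''f'' := (s ''f'')(V := 1), ''v'' := (s ''v'')(V := s ''v'' ?p + c j))"
    have s2: "?s2 ''n'' 0 = int n" "?s2 ''V'' 0 = V" "?s2 ''p'' 0 = ?p" using c V by auto
    have stored2: "stored ?s2 W l = stored s W l" for W l by (simp add: stored_def)
    show ?thesis
      unfolding improve_def
    proof (rule runs_Seq_Assign_eq[where T = "30 * n + 55" and s' = "?s1(''f'' := (s ''f'')(V := 1))"],
        rule runs_Seq_Assign_eq[where T = "30 * n + 40" and s' = ?s2])
      show "runs (copy_row ;; Assign ''u'' (Add (Mul (scalar ''V'') (scalar ''n'')) (scalar ''j''))
         (Add (Cell ''u'' (Add (Mul (scalar ''V'') (scalar ''n'')) (scalar ''j''))) (Const 1))) ?s2 (30 * n + 40)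
         (\<lambda>s'. row s' V (Suc j) \<and> same_rows s s' {V})"
      proof (rule runs_Seq[OF runs_copy_row[of ?s2 V ?p, OF s2 pV], where T' = 30])
        fix s3
        assume st: "\<forall>W. \<forall>l<n. stored s3 W l = (if W = V then stored ?s2 ?p l else stored ?s2 W l)"
          and same: "same_outside (mods copy_row) ?s2 s3"
        have s3: "s3 ''n'' 0 = int n" "s3 ''V'' 0 = V" "s3 ''j'' 0 = int j"
          "s3 ''f'' = (s ''f'')(V := 1)" "s3 ''v'' = (s ''v'')(V := s ''v'' ?p + c j)"
          using same c V j by (auto simp: copy_row_def)
        let ?k = "V * int n + int j"
        define s4 where "s4 = s3(''u'' := (s3 ''u'')(?k := s3 ''u'' ?k + 1))"
        have s4: "s4 ''f'' = (s ''f'')(V := 1)" "s4 ''v'' = (s ''v'')(V := s ''v'' ?p + c j)"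
          using s3 by (auto simp: s4_def)
        have st4: "stored s4 W l = (if W = V then stored s ?p l + (if l = j then 1 else 0) else stored s W l)"
          if "l < n" for W l
        proof -
          have "stored s4 W l = stored s3 W l + (if W = V \<and> l = j then 1 else 0)"
          proof (cases "W = V \<and> l = j")
            case False
            then have "W * int n + int l \<noteq> ?k" using row_index_eq[OF that j(1)] by blast
            then show ?thesis using False by (simp add: s4_def stored_def)
          qed (simp add: s4_def stored_def)
          then show ?thesis using st that unfolding stored2 by auto
        qed
        have "same_rows s s4 {V}" using st4 s4 by (auto simp: same_rows_def)
        moreover have "row s4 V (Suc j)"
        proof -
          have "partial_entry True (s ''v'' ?p + c j) (\<lambda>l. stored s ?p l + (if l = j then 1 else 0)) V (Suc j)"
            using old(3) R by blast
          moreover have "partial_entry True (s ''v'' ?p + c j) (stored s4 V) V (Suc j)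
              = partial_entry True (s ''v'' ?p + c j) (\<lambda>l. stored s ?p l + (if l = j then 1 else 0)) V (Suc j)"
            using st4 by (intro partial_entry_cong) auto
          ultimately show ?thesis by (simp add: row_def reached_def s4)
        qed
        ultimately show "runs (Assign ''u'' (Add (Mul (scalar ''V'') (scalar ''n'')) (scalar ''j''))
           (Add (Cell ''u'' (Add (Mul (scalar ''V'') (scalar ''n'')) (scalar ''j''))) (Const 1))) s3 30
           (\<lambda>s'. row s' V (Suc j) \<and> same_rows s s' {V})"
          using s3 by (intro runs_Assign) (auto simp: s4_def)
      qed simp
    next
      show "(?s1(''f'' := (s ''f'')(V := 1)))(''v'' := ((?s1(''f'' := (s ''f'')(V := 1))) ''v'')
          (ival (scalar ''V'') (?s1(''f'' := (s ''f'')(V := 1))) :=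
           ival (Add (Cell ''v'' (scalar ''p'')) (Cell ''c'' (scalar ''j''))) (?s1(''f'' := (s ''f'')(V := 1))))) = ?s2"
        using V j c by simp
    next
      show "?s1(''f'' := (?s1 ''f'')(ival (scalar ''V'') ?s1 := ival (Const 1) ?s1)) = ?s1(''f'' := (s ''f'')(V := 1))"
        using V by simp
    qed simp_all
  qed
  have skip: "runs Skip ?s1 T (\<lambda>s'. row s' V (Suc j) \<and> same_rows s s' {V})" if "row s V (Suc j)" "1 \<le> T" for T
    using row1[OF that(1)] same1 that(2) by (intro runs_Skip) (auto simp: same_rows_def)
  show ?thesis
    unfolding relax_def
  proof (rule runs_Seq_Assign_eq[where T = "30 * n + 130" and s' = ?s1])
    show "s(''p'' := (s ''p'')(ival (Const 0) s := ival (Sub (scalar ''V'') (Cell ''w'' (scalar ''j''))) s)) = ?s1"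
      using V j c by simp
  next
    show "runs (If (Lt (Const 0) (Cell ''f'' (scalar ''p'')))
       (If (Conj (Lt (Const 0) (Cell ''f'' (scalar ''V'')))
              (Neg (Lt (Cell ''v'' (scalar ''V'')) (Add (Cell ''v'' (scalar ''p'')) (Cell ''c'' (scalar ''j''))))))
          Skip improve)
       Skip) ?s1 (30 * n + 130) (\<lambda>s'. row s' V (Suc j) \<and> same_rows s s' {V})"
    proof (rule runs_If[where T = "30 * n + 100"])
      assume "bval (Lt (Const 0) (Cell ''f'' (scalar ''p''))) ?s1"
      then have R': "reached s ?p" by (simp add: reached_def)
      show "runs (If (Conj (Lt (Const 0) (Cell ''f'' (scalar ''V'')))
              (Neg (Lt (Cell ''v'' (scalar ''V'')) (Add (Cell ''v'' (scalar ''p'')) (Cell ''c'' (scalar ''j''))))))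
          Skip improve) ?s1 (30 * n + 100) (\<lambda>s'. row s' V (Suc j) \<and> same_rows s s' {V})"
      proof (rule runs_If[where T = "30 * n + 60"])
        assume "bval (Conj (Lt (Const 0) (Cell ''f'' (scalar ''V'')))
              (Neg (Lt (Cell ''v'' (scalar ''V'')) (Add (Cell ''v'' (scalar ''p'')) (Cell ''c'' (scalar ''j'')))))) ?s1"
        then have "reached s V" "s ''v'' ?p + c j \<le> s ''v'' V" using V j c by (auto simp: reached_def)
        then have "row s V (Suc j)" using old(2) R' by (simp add: row_def)
        then show "runs Skip ?s1 (30 * n + 60) (\<lambda>s'. row s' V (Suc j) \<and> same_rows s s' {V})" by (intro skip) auto
      next
        assume "\<not> bval (Conj (Lt (Const 0) (Cell ''f'' (scalar ''V'')))
              (Neg (Lt (Cell ''v'' (scalar ''V'')) (Add (Cell ''v'' (scalar ''p'')) (Cell ''c'' (scalar ''j'')))))) ?s1"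
        then show "runs improve ?s1 (30 * n + 60) (\<lambda>s'. row s' V (Suc j) \<and> same_rows s s' {V})"
          using improve[OF R'] V j c by (auto simp: reached_def)
      qed simp
    next
      assume "\<not> bval (Lt (Const 0) (Cell ''f'' (scalar ''p''))) ?s1"
      then have "\<not> reached s ?p" by (simp add: reached_def)
      then have "row s V (Suc j)" using old(1) by (simp add: row_def)
      then show "runs Skip ?s1 (30 * n + 100) (\<lambda>s'. row s' V (Suc j) \<and> same_rows s s' {V})" by (intro skip) auto
    qed simp
  qed simp
qed

end

lemma mods_relax: "mods relax = {''p'', ''f'', ''v'', ''l'', ''u''}"
  by (auto simp: relax_def improve_def copy_row_def)

lemma mods_flag_ray: "mods flag_ray = {''g''}"
  by (simp add: flag_ray_def)

context integer_program
begin

lemma stores_sizes_same: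
  "stores_sizes s \<Longrightarrow> same_outside X s s' \<Longrightarrow> X \<inter> {''M'', ''Q'', ''r'', ''P'', ''E'', ''H'', ''w''} = {}
    \<Longrightarrow> stores_sizes s'"
  by (simp add: stores_sizes_def)

lemma runs_fill_row:
  assumes s: "stores_input s" "stores_sizes s" and V: "s ''V'' 0 = V"
    and rows: "\<And>W. W < V \<Longrightarrow> row s W n" and row0: "row s V 0"
  shows "runs (For ''j'' (scalar ''n'') relax) s (n * (30 * n + 162) + 9) (\<lambda>s'. row s' V n \<and> same_rows s s' {V})"
proof (rule runs_For[where N = n and T = "30 * n + 150" and I = "\<lambda>k s'. row s' V k \<and> same_rows s s' {V}"])
  have "same_rows s (s(''j'' := (s ''j'')(0 := 0))) {}" by (simp add: same_rows_def stored_def)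
  then show "row (s(''j'' := (s ''j'')(0 := 0))) V 0 \<and> same_rows s (s(''j'' := (s ''j'')(0 := 0))) {V}"
    using row_same_rows[of s "s(''j'' := (s ''j'')(0 := 0))" "{}" V 0] row0 by (simp add: same_rows_def)
next
  fix k s'
  assume k: "k < n" and I: "row s' V k \<and> same_rows s s' {V}"
    and same: "same_outside (insert ''j'' (mods relax)) s s'" and j: "s' ''j'' 0 = int k"
  have "stores_input s'" using s(1) same by (rule stores_input_same) (simp add: mods_relax)
  moreover have "stores_sizes s'" using s(2) same by (rule stores_sizes_same) (simp add: mods_relax)
  moreover have "s' ''V'' 0 = V" using same V by (simp add: mods_relax)
  \<comment> \<open>Positive weights place the predecessor strictly below \<open>V\<close>, where
    rows are complete and untouched by this loop; negative indices are included.\<close>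
  moreover have "row s' (V - w k) n"
    using row_same_rows[of s s' "{V}" "V - w k" n] I w_pos[OF k] rows[of "V - w k"] by simp
  ultimately have "runs relax s' (30 * n + 150) (\<lambda>s''. row s'' V (Suc k) \<and> same_rows s' s'' {V})"
    using runs_relax k j I by blast
  then show "runs relax s' (30 * n + 150) (\<lambda>s''. row (s''(''j'' := (s'' ''j'')(0 := int (Suc k)))) V (Suc k)
     \<and> same_rows s (s''(''j'' := (s'' ''j'')(0 := int (Suc k)))) {V})"
  proof (rule runs_mono)
    fix s''
    assume "row s'' V (Suc k) \<and> same_rows s' s'' {V}"
    moreover have "same_rows s'' (s''(''j'' := (s'' ''j'')(0 := int (Suc k)))) {}" by (simp add: same_rows_def stored_def)
    ultimately show "row (s''(''j'' := (s'' ''j'')(0 := int (Suc k)))) V (Suc k)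
     \<and> same_rows s (s''(''j'' := (s'' ''j'')(0 := int (Suc k)))) {V}"
      using I row_same_rows[of s'' "s''(''j'' := (s'' ''j'')(0 := int (Suc k)))" "{}" V "Suc k"]
      by (simp add: same_rows_def)
  qed simp
next
  fix k s'
  assume "same_outside (insert ''j'' (mods relax)) s s'"
  then have "s' ''n'' = s ''n''" by (simp add: mods_relax)
  then show "ival (scalar ''n'') s' = int n" using s(1) by (simp add: stores_input_def)
qed (simp_all add: mods_relax)

definition ray_at :: "state \<Rightarrow> int \<Rightarrow> bool" where
  "ray_at s V \<longleftrightarrow> reached s V \<and> V mod K ^ m = 0 \<and> 0 < s ''v'' V"

lemma runs_flag_ray:
  assumes s: "s ''V'' 0 = V" "s ''P'' 0 = K ^ m"
  shows "runs flag_ray s 50 (\<lambda>s'. s' ''g'' 0 = (if ray_at s V then 1 else s ''g'' 0))"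
  unfolding flag_ray_def
proof (rule runs_If[where T = 10])
  have P: "0 < K ^ m" using K_ge by simp
  have "V - V div K ^ m * K ^ m = V mod K ^ m" by (rule minus_div_mult_eq_mod)
  moreover have "0 \<le> V mod K ^ m" using P by simp
  ultimately have cond: "bval (Conj (Lt (Const 0) (Cell ''f'' (scalar ''V'')))
           (Conj (Lt (Const 0) (Cell ''v'' (scalar ''V'')))
              (Neg (Lt (Const 0) (Sub (scalar ''V'') (Mul (Quot (scalar ''V'') (scalar ''P'')) (scalar ''P''))))))) s
      \<longleftrightarrow> ray_at s V" (is "bval ?\<beta> s \<longleftrightarrow> _")
    using s by (auto simp: ray_at_def reached_def)
  show "runs (assign ''g'' (Const 1)) s 10 (\<lambda>s'. s' ''g'' 0 = (if ray_at s V then 1 else s ''g'' 0))" if "bval ?\<beta> s"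
    using that cond by (intro runs_Assign) auto
  show "runs Skip s 10 (\<lambda>s'. s' ''g'' 0 = (if ray_at s V then 1 else s ''g'' 0))" if "\<not> bval ?\<beta> s"
    using that cond by (intro runs_Skip) auto
qed simp

lemma runs_fill_table:
  assumes s: "stores_input s" "stores_sizes s" and zero: "\<And>a V. a \<in> {''f'', ''v'', ''u'', ''g''} \<Longrightarrow> s a V = 0"
  shows "runs fill_table s (400 * (H * (n * n))) (\<lambda>s'.
     (\<forall>V. 0 \<le> V \<and> V < int H \<longrightarrow> table_entry (reached s' V) (s' ''v'' V) (stored s' V) V)
     \<and> (0 < s' ''g'' 0 \<longleftrightarrow> (\<exists>V. 0 \<le> V \<and> V < int H \<and> ray_at s' V)))"
  unfolding fill_table_def
proof (rule runs_Seq_Assign_eq[where s' = "s(''f'' := (s ''f'')(0 := 1))" and T = "H * (n * (30 * n + 162) + 80) + 9"])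
  let ?s0 = "s(''f'' := (s ''f'')(0 := 1))"
  let ?p = "For ''j'' (scalar ''n'') relax ;; flag_ray"
  \<comment> \<open>Rows below \<open>k\<close>, including the negative ones, are complete and all
    others are at stage 0. The start value \<open>f[0] = 1\<close> is what makes row 0 correct at
    stage 0.\<close>
  let ?I = "\<lambda>k s'. (\<forall>W. row s' W (if W < int k then n else 0))
      \<and> (0 < s' ''g'' 0 \<longleftrightarrow> (\<exists>W. 0 \<le> W \<and> W < int k \<and> ray_at s' W))"
  show "runs (For ''V'' (scalar ''H'') ?p) ?s0 (H * (n * (30 * n + 162) + 80) + 9) (\<lambda>s'.
     (\<forall>V. 0 \<le> V \<and> V < int H \<longrightarrow> table_entry (reached s' V) (s' ''v'' V) (stored s' V) V)
     \<and> (0 < s' ''g'' 0 \<longleftrightarrow> (\<exists>V. 0 \<le> V \<and> V < int H \<and> ray_at s' V)))"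
  proof (rule runs_For[where I = ?I and N = H and T = "n * (30 * n + 162) + 59"])
    let ?s1 = "?s0(''V'' := (?s0 ''V'')(0 := 0))"
    have "row ?s1 W (if W < int 0 then n else 0)" for W
    proof -
      consider "W < 0" | "W = 0" | "0 < W" by linarith
      then show ?thesis
      proof cases
        case 1
        then show ?thesis using partial_entry_neg[of W] zero by (simp add: row_def reached_def)
      next
        case 2
        then show ?thesis using partial_entry_zero[of "stored ?s1 0"] zero by (simp add: row_def reached_def stored_def)
      next
        case 3
        then show ?thesis using partial_entry_0[of W] zero by (simp add: row_def reached_def)
      qed
    qed
    then show "?I 0 ?s1" using zero by simp
  next
    fix k s'
    assume k: "k < H" and I: "?I k s'" and same: "same_outside (insert ''V'' (mods ?p)) ?s0 s'" and V: "s' ''V'' 0 = int k"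
    have mods: "insert ''V'' (mods ?p) = {''V'', ''j'', ''p'', ''f'', ''v'', ''l'', ''u'', ''g''}"
      by (auto simp: mods_relax mods_flag_ray)
    have same': "same_outside {''V'', ''j'', ''p'', ''f'', ''v'', ''l'', ''u'', ''g''} s s'"
      using same unfolding mods by simp
    have inp: "stores_input s'" using s(1) same' by (rule stores_input_same) simp
    have siz: "stores_sizes s'" using s(2) same' by (rule stores_sizes_same) simp
    have rows: "row s' W n" if "W < int k" for W using I that by (metis (mono_tags, lifting))
    have row0: "row s' (int k) 0" using I by (metis (mono_tags, lifting) less_irrefl)
    show "runs ?p s' (n * (30 * n + 162) + 59) (\<lambda>s''. ?I (Suc k) (s''(''V'' := (s'' ''V'')(0 := int (Suc k)))))"
    proof (rule runs_Seq[OF runs_fill_row[OF inp siz V rows row0], where T' = 50])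
      fix s1
      assume R: "row s1 (int k) n \<and> same_rows s' s1 {int k}" and same1: "same_outside (mods (For ''j'' (scalar ''n'') relax)) s' s1"
      have s1: "s1 ''V'' 0 = int k" "s1 ''P'' 0 = K ^ m" "s1 ''g'' 0 = s' ''g'' 0"
        using same1 V siz by (auto simp: mods_relax stores_sizes_def)
      have rows1: "row s1 W (if W < int (Suc k) then n else 0)" for W
      proof (cases "W = int k")
        case True
        then show ?thesis using R by simp
      next
        case False
        then have "row s1 W (if W < int k then n else 0)"
          using row_same_rows[of s' s1 "{int k}" W] R I by simp
        moreover have "W < int (Suc k) \<longleftrightarrow> W < int k" using False by auto
        ultimately show ?thesis by simp
      qed
      have ray1: "ray_at s1 W = ray_at s' W" if "W \<noteq> int k" for W
        using R that by (simp add: ray_at_def reached_def same_rows_def)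
      show "runs flag_ray s1 50 (\<lambda>s''. ?I (Suc k) (s''(''V'' := (s'' ''V'')(0 := int (Suc k)))))"
      proof (rule runs_mono[OF runs_flag_ray[of s1 "int k", OF s1(1,2)]])
        fix s2
        assume g: "s2 ''g'' 0 = (if ray_at s1 (int k) then 1 else s1 ''g'' 0)" and same2: "same_outside (mods flag_ray) s1 s2"
        let ?s3 = "s2(''V'' := (s2 ''V'')(0 := int (Suc k)))"
        have s3: "?s3 ''f'' = s1 ''f''" "?s3 ''v'' = s1 ''v''" "?s3 ''u'' = s1 ''u''"
          using same2 by (simp_all add: mods_flag_ray)
        have row3: "row ?s3 W j = row s1 W j" for W j
          using row_same_rows[of s1 ?s3 "{}" W j] s3 by (simp add: same_rows_def stored_def)
        have ray3: "ray_at ?s3 W = ray_at s1 W" for W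
          using s3 by (simp add: ray_at_def reached_def)
        have "(\<exists>W. 0 \<le> W \<and> W < int (Suc k) \<and> ray_at s1 W)
            \<longleftrightarrow> ray_at s1 (int k) \<or> (\<exists>W. 0 \<le> W \<and> W < int k \<and> ray_at s1 W)"
        proof -
          have "W < int (Suc k) \<longleftrightarrow> W = int k \<or> W < int k" for W by auto
          then show ?thesis by (metis of_nat_0_le_iff)
        qed
        also have "(\<exists>W. 0 \<le> W \<and> W < int k \<and> ray_at s1 W) \<longleftrightarrow> (\<exists>W. 0 \<le> W \<and> W < int k \<and> ray_at s' W)"
          using ray1 by (metis less_irrefl)
        finally have "0 < s2 ''g'' 0 \<longleftrightarrow> (\<exists>W. 0 \<le> W \<and> W < int (Suc k) \<and> ray_at s1 W)"
          using g I s1(3) by simp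
        then show "?I (Suc k) ?s3" unfolding row3 ray3 using rows1 by simp
      qed simp
    qed simp_all
  next
    fix k s'
    assume "same_outside (insert ''V'' (mods ?p)) ?s0 s'"
    then have "s' ''H'' = s ''H''" by (simp add: mods_relax mods_flag_ray)
    then show "ival (scalar ''H'') s' = int H" using s(2) by (simp add: stores_sizes_def)
  next
    fix s' assume I: "?I H s'"
    have "row s' V n" if "V < int H" for V using I that by (metis (mono_tags, lifting))
    then show "(\<forall>V. 0 \<le> V \<and> V < int H \<longrightarrow> table_entry (reached s' V) (s' ''v'' V) (stored s' V) V)
     \<and> (0 < s' ''g'' 0 \<longleftrightarrow> (\<exists>V. 0 \<le> V \<and> V < int H \<and> ray_at s' V))"
      using I by (simp add: table_entry_partial row_def)
  qed (simp_all add: mods_relax mods_flag_ray)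
next
  have "n * (30 * n + 162) + 80 \<le> 300 * (n * n)"
  proof -
    have "n \<le> n * n" "1 \<le> n * n" using n by auto
    moreover have "n * (30 * n + 162) + 80 = 30 * (n * n) + 162 * n + 80" by (simp add: algebra_simps)
    ultimately show ?thesis by linarith
  qed
  then have "H * (n * (30 * n + 162) + 80) \<le> H * (300 * (n * n))" by (rule mult_left_mono) simp
  moreover have "1 \<le> H * (n * n)" using mult_le_mono[of 1 H 1 "n * n"] n by (simp add: H_def)
  moreover have "H * (300 * (n * n)) = 300 * (H * (n * n))" by simp
  ultimately have "H * (n * (30 * n + 162) + 80) + 12 \<le> 400 * (H * (n * n))" by linarith
  then show "itime (Const 0) + itime (Const 1) + 1 + (H * (n * (30 * n + 162) + 80) + 9) \<le> 400 * (H * (n * n))"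
    unfolding itime.simps by linarith
qed simp

end

section \<open>Trying a candidate\<close>

definition load_row :: com where
  "load_row = For ''j'' (scalar ''n'')
     (Assign ''z'' (scalar ''j'') (Cell ''u'' (Add (Mul (scalar ''V'') (scalar ''n'')) (scalar ''j''))))"

definition residual_row :: com where
  "residual_row = For ''j'' (scalar ''n'')
     (Assign ''R'' (scalar ''i'') (Sub (Cell ''R'' (scalar ''i''))
       (Mul (Cell ''A'' (Add (Mul (scalar ''i'') (scalar ''n'')) (scalar ''j''))) (Cell ''z'' (scalar ''j'')))))"

definition residual :: com where
  "residual = For ''i'' (scalar ''m'') (Assign ''R'' (scalar ''i'') (Cell ''b'' (scalar ''i'')) ;; residual_row)"

definition digit_step :: com where
  "digit_step =
     assign ''a'' (Sub (Sub (scalar ''t'') (Mul (Quot (scalar ''t'') (scalar ''Q'')) (scalar ''Q''))) (scalar ''M'')) ;;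
     assign ''t'' (Quot (scalar ''t'') (scalar ''Q'')) ;;
     assign ''N'' (Add (scalar ''N'') (Mul (scalar ''a'') (Cell ''R'' (scalar ''i'')))) ;;
     assign ''S'' (Add (scalar ''S'') (Mul (scalar ''a'')
       (Cell ''A'' (Add (Mul (scalar ''i'') (scalar ''n'')) (scalar ''q'')))))"

text \<open>Neither divisibility nor \<open>S = 0\<close> is tested: quotients that make no sense
  only produce points that \<open>check\<close> rejects.\<close>

definition pivot_step :: com where
  "pivot_step =
     assign ''q'' (Sub (scalar ''t'') (Mul (Quot (scalar ''t'') (scalar ''n'')) (scalar ''n''))) ;;
     assign ''t'' (Quot (scalar ''t'') (scalar ''n'')) ;;
     assign ''N'' (Const 0) ;;
     assign ''S'' (Const 0) ;;
     For ''i'' (scalar ''m'') digit_step ;;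
     Assign ''z'' (scalar ''q'') (Add (Cell ''z'' (scalar ''q'')) (Quot (scalar ''N'') (scalar ''S'')))"

definition check_step :: com where
  "check_step =
     If (Lt (Cell ''z'' (scalar ''j'')) (Const 0)) (assign ''o'' (Const 0)) Skip ;;
     assign ''y'' (Add (scalar ''y'') (Mul (Cell ''c'' (scalar ''j'')) (Cell ''z'' (scalar ''j''))))"

definition check :: com where
  "check =
     assign ''o'' (Const 1) ;;
     assign ''y'' (Const 0) ;;
     For ''i'' (scalar ''m'') (If (Conj (Neg (Lt (Cell ''R'' (scalar ''i'')) (Const 0)))
         (Neg (Lt (Const 0) (Cell ''R'' (scalar ''i''))))) Skip (assign ''o'' (Const 0))) ;;
     For ''j'' (scalar ''n'') check_step"

definition keep_best :: com where
  "keep_best =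
     If (Conj (Lt (Const 0) (scalar ''o''))
          (Neg (Conj (Lt (Const 0) (scalar ''status'')) (Neg (Lt (scalar ''h'') (scalar ''y''))))))
       (assign ''status'' (Const 1) ;;
        assign ''h'' (scalar ''y'') ;;
        For ''j'' (scalar ''n'') (Assign ''x'' (scalar ''j'') (Cell ''z'' (scalar ''j''))))
       Skip"

text \<open>All pivots use the residual of the table entry, which stays fixed while \<open>z\<close>
  changes; the second residual belongs to the completed point and decides whether the equations
  hold.\<close>

definition try_candidate :: com where
  "try_candidate =
     assign ''t'' (scalar ''e'') ;; load_row ;; residual ;; For ''k'' (scalar ''r'') pivot_step ;;
     residual ;; check ;; keep_best"

lemma mods_load_row: "mods load_row = {''j'', ''z''}"
  and mods_residual_row: "mods residual_row = {''j'', ''R''}"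
  and mods_residual: "mods residual = {''i'', ''j'', ''R''}"
  and mods_digit_step: "mods digit_step = {''a'', ''t'', ''N'', ''S''}"
  and mods_pivot_step: "mods pivot_step = {''q'', ''t'', ''N'', ''S'', ''i'', ''a'', ''z''}"
  and mods_check_step: "mods check_step = {''o'', ''y''}"
  and mods_check: "mods check = {''o'', ''y'', ''i'', ''j''}"
  and mods_keep_best: "mods keep_best = {''status'', ''h'', ''j'', ''x''}"
  by (auto simp: load_row_def residual_row_def residual_def digit_step_def pivot_step_def check_step_def check_def keep_best_def)

section \<open>Correctness of the test of a single candidate\<close>

context integer_program
begin

definition vector_at :: "string \<Rightarrow> state \<Rightarrow> nat \<Rightarrow> int" where
  "vector_at a s j = s a (int j)"

lemma runs_load_row:
  assumes s: "s ''n'' 0 = int n" "s ''V'' 0 = V"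
  shows "runs load_row s (24 * n + 9) (\<lambda>s'. \<forall>j<n. vector_at ''z'' s' j = stored s V j)"
  unfolding load_row_def
proof (rule runs_For[where N = n and T = 12 and I = "\<lambda>k s'. \<forall>j<k. vector_at ''z'' s' j = stored s V j"])
  let ?p = "Assign ''z'' (scalar ''j'') (Cell ''u'' (Add (Mul (scalar ''V'') (scalar ''n'')) (scalar ''j'')))"
  fix k s'
  assume I: "\<forall>j<k. vector_at ''z'' s' j = stored s V j"
    and same: "same_outside (insert ''j'' (mods ?p)) s s'" and j: "s' ''j'' 0 = int k"
  have s': "s' ''n'' = s ''n''" "s' ''V'' = s ''V''" "s' ''u'' = s ''u''" using same by simp_all
  show "runs ?p s' 12 (\<lambda>s''. \<forall>j<Suc k. vector_at ''z'' (s''(''j'' := (s'' ''j'')(0 := int (Suc k)))) j = stored s V j)"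
    by (rule runs_Assign) (use I j s in \<open>auto simp: s' vector_at_def stored_def less_Suc_eq\<close>)
next
  fix k s'
  assume "same_outside (insert ''j'' (mods (Assign ''z'' (scalar ''j'') (Cell ''u'' (Add (Mul (scalar ''V'') (scalar ''n'')) (scalar ''j'')))))) s s'"
  then have "s' ''n'' = s ''n''" by simp
  then show "ival (scalar ''n'') s' = int n" using s by simp
qed simp_all

lemma runs_residual_row:
  assumes s: "stores_input s" and i: "i < m" "s ''i'' 0 = int i"
  shows "runs residual_row s (32 * n + 9)
    (\<lambda>s'. s' ''R'' = (s ''R'')(int i := s ''R'' (int i) - lhs (vector_at ''z'' s) i))"
  unfolding residual_row_def
proof (rule runs_For[where N = n and T = 20 and
      I = "\<lambda>k s'. s' ''R'' = (s ''R'')(int i := s ''R'' (int i) - (\<Sum>j<k. A i j * vector_at ''z'' s j))"])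
  let ?p = "Assign ''R'' (scalar ''i'') (Sub (Cell ''R'' (scalar ''i''))
       (Mul (Cell ''A'' (Add (Mul (scalar ''i'') (scalar ''n'')) (scalar ''j''))) (Cell ''z'' (scalar ''j''))))"
  fix k s'
  assume k: "k < n" and I: "s' ''R'' = (s ''R'')(int i := s ''R'' (int i) - (\<Sum>j<k. A i j * vector_at ''z'' s j))"
    and same: "same_outside (insert ''j'' (mods ?p)) s s'" and j: "s' ''j'' 0 = int k"
  have s': "s' ''n'' = s ''n''" "s' ''A'' = s ''A''" "s' ''z'' = s ''z''" "s' ''i'' = s ''i''" using same by simp_all
  show "runs ?p s' 20 (\<lambda>s''. (s''(''j'' := (s'' ''j'')(0 := int (Suc k)))) ''R''
      = (s ''R'')(int i := s ''R'' (int i) - (\<Sum>j<Suc k. A i j * vector_at ''z'' s j)))"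
    by (rule runs_Assign) (use I j k s i in \<open>simp_all add: s' vector_at_def stores_input_def algebra_simps\<close>)
next
  fix k s'
  assume "same_outside (insert ''j'' (mods (Assign ''R'' (scalar ''i'') (Sub (Cell ''R'' (scalar ''i''))
       (Mul (Cell ''A'' (Add (Mul (scalar ''i'') (scalar ''n'')) (scalar ''j''))) (Cell ''z'' (scalar ''j'')))))))  s s'"
  then have "s' ''n'' = s ''n''" by simp
  then show "ival (scalar ''n'') s' = int n" using s by (simp add: stores_input_def)
qed (simp_all add: lhs_def)

lemma runs_residual:
  assumes s: "stores_input s"
  shows "runs residual s (70 * (m * n)) (\<lambda>s'. \<forall>i<m. s' ''R'' (int i) = b i - lhs (vector_at ''z'' s) i)"
  unfolding residual_def
proof (rule runs_For[where N = m and T = "32 * n + 15" and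
      I = "\<lambda>k s'. \<forall>i<k. s' ''R'' (int i) = b i - lhs (vector_at ''z'' s) i"])
  let ?p = "Assign ''R'' (scalar ''i'') (Cell ''b'' (scalar ''i'')) ;; residual_row"
  fix k s'
  assume k: "k < m" and I: "\<forall>i<k. s' ''R'' (int i) = b i - lhs (vector_at ''z'' s) i"
    and same: "same_outside (insert ''i'' (mods ?p)) s s'" and i: "s' ''i'' 0 = int k"
  have "stores_input s'" using s same by (rule stores_input_same) (simp add: mods_residual_row)
  have z: "s' ''z'' = s ''z''" "s' ''b'' = s ''b''" using same by (simp_all add: mods_residual_row)
  let ?s1 = "s'(''R'' := (s' ''R'')(int k := b k))"
  have inp: "stores_input ?s1" using \<open>stores_input s'\<close> by (simp add: stores_input_def)
  have i1: "?s1 ''i'' 0 = int k" using i by simp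
  show "runs ?p s' (32 * n + 15) (\<lambda>s''. \<forall>i<Suc k. (s''(''i'' := (s'' ''i'')(0 := int (Suc k)))) ''R'' (int i)
      = b i - lhs (vector_at ''z'' s) i)"
  proof (rule runs_Seq_Assign_eq[where T = "32 * n + 9" and s' = ?s1])
    show "runs residual_row ?s1 (32 * n + 9) (\<lambda>s''. \<forall>i<Suc k. (s''(''i'' := (s'' ''i'')(0 := int (Suc k)))) ''R'' (int i)
      = b i - lhs (vector_at ''z'' s) i)"
    proof (rule runs_mono[OF runs_residual_row[of ?s1 k, OF inp k i1]])
      fix s''
      assume R: "s'' ''R'' = (?s1 ''R'')(int k := ?s1 ''R'' (int k) - lhs (vector_at ''z'' ?s1) k)"
      have "vector_at ''z'' ?s1 = vector_at ''z'' s" using z by (simp add: vector_at_def fun_eq_iff)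
      then show "\<forall>i<Suc k. (s''(''i'' := (s'' ''i'')(0 := int (Suc k)))) ''R'' (int i)
          = b i - lhs (vector_at ''z'' s) i"
        using R I by (simp add: less_Suc_eq)
    qed simp
  next
    show "s'(''R'' := (s' ''R'')(ival (scalar ''i'') s' := ival (Cell ''b'' (scalar ''i'')) s')) = ?s1"
      using i k \<open>stores_input s'\<close> by (simp add: stores_input_def)
  qed simp
next
  fix k s'
  assume "same_outside (insert ''i'' (mods (Assign ''R'' (scalar ''i'') (Cell ''b'' (scalar ''i'')) ;; residual_row))) s s'"
  then have "s' ''m'' = s ''m''" by (simp add: mods_residual_row)
  then show "ival (scalar ''m'') s' = int m" using s by (simp add: stores_input_def)
next
  show "m * (32 * n + 15 + itime (scalar ''m'') + 10) + itime (scalar ''m'') + 7 \<le> 70 * (m * n)"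
    by (simp add: algebra_simps) (use mn_ge in linarith)
qed (simp_all add: mods_residual_row)

definition digit :: "int \<Rightarrow> nat \<Rightarrow> int" where
  "digit t i = t div Q ^ i mod Q - int M"

lemma runs_digits:
  assumes s: "stores_input s" "stores_sizes s" and q: "q < n" "s ''q'' 0 = int q"
    and t: "s ''t'' 0 = t" "s ''N'' 0 = 0" "s ''S'' 0 = 0"
  shows "runs (For ''i'' (scalar ''m'') digit_step) s (63 * m + 9) (\<lambda>s'. s' ''t'' 0 = t div Q ^ m
     \<and> s' ''N'' 0 = (\<Sum>i<m. digit t i * s ''R'' (int i)) \<and> s' ''S'' 0 = (\<Sum>i<m. digit t i * A i q))"
proof (rule runs_For[where N = m and T = 51 and I = "\<lambda>k s'. s' ''t'' 0 = t div Q ^ k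
     \<and> s' ''N'' 0 = (\<Sum>i<k. digit t i * s ''R'' (int i)) \<and> s' ''S'' 0 = (\<Sum>i<k. digit t i * A i q)"])
  fix k s'
  assume k: "k < m" and I: "s' ''t'' 0 = t div Q ^ k
     \<and> s' ''N'' 0 = (\<Sum>i<k. digit t i * s ''R'' (int i)) \<and> s' ''S'' 0 = (\<Sum>i<k. digit t i * A i q)"
    and same: "same_outside (insert ''i'' (mods digit_step)) s s'" and i: "s' ''i'' 0 = int k"
  have s': "s' ''Q'' = s ''Q''" "s' ''M'' = s ''M''" "s' ''R'' = s ''R''" "s' ''A'' = s ''A''" "s' ''n'' = s ''n''" "s' ''q'' = s ''q''"
    using same by (simp_all add: mods_digit_step)
  have c: "s ''Q'' 0 = Q" "s ''M'' 0 = int M" "s ''n'' 0 = int n" "s ''A'' (int k * int n + int q) = A k q"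
    using s k q by (simp_all add: stores_input_def stores_sizes_def)
  have tk: "t div Q ^ k div Q = t div Q ^ Suc k"
    using Q_pos by (simp add: power_Suc2 zdiv_zmult2_eq del: power_Suc)
  have "t div Q ^ k - t div Q ^ k div Q * Q - int M = digit t k"
    by (simp add: digit_def minus_div_mult_eq_mod)
  then have d: "t div Q ^ k - t div (Q * Q ^ k) * Q - int M = digit t k" using tk by simp
  let ?s1 = "s'(''a'' := (s' ''a'')(0 := digit t k))"
  let ?s2 = "?s1(''t'' := (?s1 ''t'')(0 := t div Q ^ Suc k))"
  let ?s3 = "?s2(''N'' := (?s2 ''N'')(0 := s' ''N'' 0 + digit t k * s ''R'' (int k)))"
  show "runs digit_step s' 51 (\<lambda>s''. (s''(''i'' := (s'' ''i'')(0 := int (Suc k)))) ''t'' 0 = t div Q ^ Suc k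
     \<and> (s''(''i'' := (s'' ''i'')(0 := int (Suc k)))) ''N'' 0 = (\<Sum>i<Suc k. digit t i * s ''R'' (int i))
     \<and> (s''(''i'' := (s'' ''i'')(0 := int (Suc k)))) ''S'' 0 = (\<Sum>i<Suc k. digit t i * A i q))"
    unfolding digit_step_def
    apply (rule runs_Seq_Assign_eq[where T = 35 and s' = ?s1], rule runs_Seq_Assign_eq[where T = 28 and s' = ?s2],
        rule runs_Seq_Assign_eq[where T = 17 and s' = ?s3], rule runs_Assign)
    using I i q by (simp_all add: s' c tk d)
next
  fix k s'
  assume "same_outside (insert ''i'' (mods digit_step)) s s'"
  then have "s' ''m'' = s ''m''" by (simp add: mods_digit_step)
  then show "ival (scalar ''m'') s' = int m" using s by (simp add: stores_input_def)
qed (use t in \<open>simp_all add: mods_digit_step\<close>)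

text \<open>The digits of \<open>e\<close> are consumed from the lowest upwards, so \<open>t\<close>
  holds \<open>e div G ^ k\<close> after \<open>k\<close> pivots. \<open>R\<close> keeps the
  residual of the initial \<open>u\<close>, as the definition of \<open>cand\<close>
  demands.\<close>

lemma runs_pivots:
  assumes s: "stores_input s" "stores_sizes s" and t: "s ''t'' 0 = e"
    and z: "\<And>j. j < n \<Longrightarrow> vector_at ''z'' s j = u j" and R: "\<And>i. i < m \<Longrightarrow> s ''R'' (int i) = b i - lhs u i"
  shows "runs (For ''k'' (scalar ''r'') pivot_step) s (140 * (m * n)) (\<lambda>s'. \<forall>j<n. vector_at ''z'' s' j = cand e u j)"
proof (rule runs_For[where N = r and T = "63 * m + 47" and I = "\<lambda>k s'. s' ''t'' 0 = e div G ^ k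
     \<and> (\<forall>j<n. vector_at ''z'' s' j = u j + (\<Sum>k'<k. if col e k' = j then pivot_num e u k' div pivot_den e k' else 0))"])
  fix k s'
  assume k: "k < r" and I: "s' ''t'' 0 = e div G ^ k
     \<and> (\<forall>j<n. vector_at ''z'' s' j = u j + (\<Sum>k'<k. if col e k' = j then pivot_num e u k' div pivot_den e k' else 0))"
    and same: "same_outside (insert ''k'' (mods pivot_step)) s s'" and kk: "s' ''k'' 0 = int k"
  have inp: "stores_input s'" using s(1) same by (rule stores_input_same) (simp add: mods_pivot_step)
  have siz: "stores_sizes s'" using s(2) same by (rule stores_sizes_same) (simp add: mods_pivot_step)
  have R': "s' ''R'' = s ''R''" using same by (simp add: mods_pivot_step)
  let ?t = "e div G ^ k div int n"
  have q: "e div G ^ k - e div G ^ k div int n * int n = int (col e k)" "col e k < n"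
    using n by (simp_all add: col_def minus_div_mult_eq_mod nat_less_iff)
  let ?s1 = "s'(''q'' := (s' ''q'')(0 := int (col e k)))"
  let ?s2 = "?s1(''t'' := (?s1 ''t'')(0 := ?t))"
  let ?s3 = "?s2(''N'' := (?s2 ''N'')(0 := 0))"
  let ?s4 = "?s3(''S'' := (?s3 ''S'')(0 := 0))"
  have inp4: "stores_input ?s4" using inp by (simp add: stores_input_def)
  have siz4: "stores_sizes ?s4" using siz by (simp add: stores_sizes_def)
  have num: "(\<Sum>i<m. digit ?t i * s ''R'' (int i)) = pivot_num e u k"
    using R by (simp add: digit_def pivot_num_def fun_coeff_def)
  have den: "(\<Sum>i<m. digit ?t i * A i (col e k)) = pivot_den e k"
    by (simp add: digit_def pivot_den_def fun_coeff_def)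
  \<comment> \<open>One division by \<open>n\<close> and \<open>m\<close> divisions by
    \<open>Q\<close> together remove one digit in base \<open>G = n * Q^m\<close>.\<close>
  have t': "?t div Q ^ m = e div G ^ Suc k"
    using n Q_pos by (simp add: G_def zdiv_zmult2_eq[symmetric] mult_ac)
  let ?Q = "\<lambda>s''. (s''(''k'' := (s'' ''k'')(0 := int (Suc k)))) ''t'' 0 = e div G ^ Suc k
     \<and> (\<forall>j<n. vector_at ''z'' (s''(''k'' := (s'' ''k'')(0 := int (Suc k)))) j
         = u j + (\<Sum>k'<Suc k. if col e k' = j then pivot_num e u k' div pivot_den e k' else 0))"
  have main: "runs (For ''i'' (scalar ''m'') digit_step ;;
     Assign ''z'' (scalar ''q'') (Add (Cell ''z'' (scalar ''q'')) (Quot (scalar ''N'') (scalar ''S''))))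
     ?s4 (63 * m + 21) ?Q"
  proof (rule runs_Seq[where T' = 12])
    show "runs (For ''i'' (scalar ''m'') digit_step) ?s4 (63 * m + 9) (\<lambda>s'. s' ''t'' 0 = ?t div Q ^ m
     \<and> s' ''N'' 0 = (\<Sum>i<m. digit ?t i * ?s4 ''R'' (int i)) \<and> s' ''S'' 0 = (\<Sum>i<m. digit ?t i * A i (col e k)))"
      using runs_digits[of ?s4 "col e k" ?t, OF inp4 siz4 q(2)] by simp
  next
    fix s5
    assume "s5 ''t'' 0 = ?t div Q ^ m
     \<and> s5 ''N'' 0 = (\<Sum>i<m. digit ?t i * ?s4 ''R'' (int i)) \<and> s5 ''S'' 0 = (\<Sum>i<m. digit ?t i * A i (col e k))"
      and same5: "same_outside (mods (For ''i'' (scalar ''m'') digit_step)) ?s4 s5"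
    then have s5: "s5 ''t'' 0 = e div G ^ Suc k" "s5 ''N'' 0 = pivot_num e u k" "s5 ''S'' 0 = pivot_den e k"
      by (simp_all add: t' num den R')
    have s5': "s5 ''z'' = s' ''z''" "s5 ''q'' 0 = int (col e k)"
      using same5 by (simp_all add: mods_digit_step)
    show "runs (Assign ''z'' (scalar ''q'') (Add (Cell ''z'' (scalar ''q'')) (Quot (scalar ''N'') (scalar ''S'')))) s5 12 ?Q"
      by (rule runs_Assign) (use I s5 s5' in \<open>auto simp: vector_at_def\<close>)
  qed simp
  have n': "s' ''n'' 0 = int n" using inp by (simp add: stores_input_def)
  show "runs pivot_step s' (63 * m + 47) ?Q"
    unfolding pivot_step_def
    apply (rule runs_Seq_Assign_eq[where T = "63 * m + 34" and s' = ?s1], rule runs_Seq_Assign_eq[where T = "63 * m + 27" and s' = ?s2],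
        rule runs_Seq_Assign_eq[where T = "63 * m + 24" and s' = ?s3], rule runs_Seq_Assign_eq[where T = "63 * m + 21" and s' = ?s4],
        rule main)
    using I by (simp_all add: n' q)
next
  fix k s'
  assume "same_outside (insert ''k'' (mods pivot_step)) s s'"
  then have "s' ''r'' = s ''r''" by (simp add: mods_pivot_step)
  then show "ival (scalar ''r'') s' = int r" using s by (simp add: stores_sizes_def)
next
  have "r * (63 * m + 59) \<le> n * (63 * m + 59)" by (intro mult_right_mono) (simp_all add: r_def)
  also have "\<dots> = 63 * (m * n) + 59 * n" by (simp add: algebra_simps)
  finally have "r * (63 * m + 59) + 9 \<le> 140 * (m * n)" using mn_ge by linarith
  moreover have "r * (63 * m + 47 + itime (scalar ''r'') + 10) + itime (scalar ''r'') + 7 = r * (63 * m + 59) + 9"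
    by (simp add: algebra_simps)
  ultimately show "r * (63 * m + 47 + itime (scalar ''r'') + 10) + itime (scalar ''r'') + 7 \<le> 140 * (m * n)"
    by (simp only:)
qed (use t z in \<open>simp_all add: mods_pivot_step vector_at_def cand_def\<close>)

lemma runs_check:
  assumes s: "stores_input s"
  shows "runs check s (100 * (m * n)) (\<lambda>s'. (0 < s' ''o'' 0 \<longleftrightarrow> (\<forall>i<m. s ''R'' (int i) = 0) \<and> nonneg (vector_at ''z'' s))
     \<and> s' ''y'' 0 = obj (vector_at ''z'' s))"
  unfolding check_def
proof (rule runs_Seq_Assign_eq[where T = "29 * m + 33 * n + 30" and s' = "s(''o'' := (s ''o'')(0 := 1))"],
    rule runs_Seq_Assign_eq[where T = "29 * m + 33 * n + 20" and s' = "s(''o'' := (s ''o'')(0 := 1), ''y'' := (s ''y'')(0 := 0))"])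
  let ?s0 = "s(''o'' := (s ''o'')(0 := 1), ''y'' := (s ''y'')(0 := 0))"
  let ?p = "If (Conj (Neg (Lt (Cell ''R'' (scalar ''i'')) (Const 0)))
         (Neg (Lt (Const 0) (Cell ''R'' (scalar ''i''))))) Skip (assign ''o'' (Const 0))"
  let ?q = "For ''i'' (scalar ''m'') ?p"
  show "runs (?q ;; For ''j'' (scalar ''n'') check_step) ?s0 (29 * m + 33 * n + 20)
     (\<lambda>s'. (0 < s' ''o'' 0 \<longleftrightarrow> (\<forall>i<m. s ''R'' (int i) = 0) \<and> nonneg (vector_at ''z'' s))
     \<and> s' ''y'' 0 = obj (vector_at ''z'' s))"
  proof (rule runs_Seq[where T = "29 * m + 9" and T' = "33 * n + 9" and R = "\<lambda>s'. 0 < s' ''o'' 0 \<longleftrightarrow> (\<forall>i<m. s ''R'' (int i) = 0)"])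
    show "runs ?q ?s0 (29 * m + 9) (\<lambda>s'. 0 < s' ''o'' 0 \<longleftrightarrow> (\<forall>i<m. s ''R'' (int i) = 0))"
    proof (rule runs_For[where N = m and T = 17 and I = "\<lambda>k s'. 0 < s' ''o'' 0 \<longleftrightarrow> (\<forall>i<k. s ''R'' (int i) = 0)"])
      fix k s'
      assume I: "0 < s' ''o'' 0 \<longleftrightarrow> (\<forall>i<k. s ''R'' (int i) = 0)"
        and same: "same_outside (insert ''i'' (mods ?p)) ?s0 s'" and i: "s' ''i'' 0 = int k"
      have R: "s' ''R'' = s ''R''" using same by simp
      show "runs ?p s' 17 (\<lambda>s''. 0 < (s''(''i'' := (s'' ''i'')(0 := int (Suc k)))) ''o'' 0 \<longleftrightarrow> (\<forall>i<Suc k. s ''R'' (int i) = 0))"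
      proof (rule runs_If[where T = 3])
        assume "bval (Conj (Neg (Lt (Cell ''R'' (scalar ''i'')) (Const 0))) (Neg (Lt (Const 0) (Cell ''R'' (scalar ''i''))))) s'"
        then have "s ''R'' (int k) = 0" by (simp add: R i)
        then show "runs Skip s' 3 (\<lambda>s''. 0 < (s''(''i'' := (s'' ''i'')(0 := int (Suc k)))) ''o'' 0 \<longleftrightarrow> (\<forall>i<Suc k. s ''R'' (int i) = 0))"
          using I by (intro runs_Skip) (auto simp: less_Suc_eq)
      next
        assume "\<not> bval (Conj (Neg (Lt (Cell ''R'' (scalar ''i'')) (Const 0))) (Neg (Lt (Const 0) (Cell ''R'' (scalar ''i''))))) s'"
        then have "s ''R'' (int k) \<noteq> 0" by (auto simp: R i)
        then show "runs (assign ''o'' (Const 0)) s' 3 (\<lambda>s''. 0 < (s''(''i'' := (s'' ''i'')(0 := int (Suc k)))) ''o'' 0 \<longleftrightarrow> (\<forall>i<Suc k. s ''R'' (int i) = 0))"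
          by (intro runs_Assign) auto
      qed simp
    next
      fix k s'
      assume "same_outside (insert ''i'' (mods ?p)) ?s0 s'"
      then have "s' ''m'' = s ''m''" by simp
      then show "ival (scalar ''m'') s' = int m" using s by (simp add: stores_input_def)
    qed simp_all
  next
    fix s1
    assume o1: "0 < s1 ''o'' 0 \<longleftrightarrow> (\<forall>i<m. s ''R'' (int i) = 0)" and same1: "same_outside (mods ?q) ?s0 s1"
    have s1: "s1 ''y'' 0 = 0" "s1 ''z'' = s ''z''" "s1 ''c'' = s ''c''" "s1 ''n'' = s ''n''" using same1 by simp_all
    show "runs (For ''j'' (scalar ''n'') check_step) s1 (33 * n + 9)
     (\<lambda>s'. (0 < s' ''o'' 0 \<longleftrightarrow> (\<forall>i<m. s ''R'' (int i) = 0) \<and> nonneg (vector_at ''z'' s))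
     \<and> s' ''y'' 0 = obj (vector_at ''z'' s))"
    proof (rule runs_For[where N = n and T = 21 and I = "\<lambda>k s'. (0 < s' ''o'' 0 \<longleftrightarrow> (\<forall>i<m. s ''R'' (int i) = 0) \<and> (\<forall>j<k. 0 \<le> vector_at ''z'' s j))
     \<and> s' ''y'' 0 = (\<Sum>j<k. c j * vector_at ''z'' s j)"])
      fix k s'
      assume k: "k < n" and I: "(0 < s' ''o'' 0 \<longleftrightarrow> (\<forall>i<m. s ''R'' (int i) = 0) \<and> (\<forall>j<k. 0 \<le> vector_at ''z'' s j))
     \<and> s' ''y'' 0 = (\<Sum>j<k. c j * vector_at ''z'' s j)"
        and same: "same_outside (insert ''j'' (mods check_step)) s1 s'" and j: "s' ''j'' 0 = int k"
      have s': "s' ''z'' = s ''z''" "s' ''c'' = s ''c''" using same s1 by (simp_all add: mods_check_step)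
      have ck: "s ''c'' (int k) = c k" using s k by (simp add: stores_input_def)
      define x where "x = (if vector_at ''z'' s k < 0 then 0 else s' ''o'' 0)"
      have x: "0 < x \<longleftrightarrow> (\<forall>i<m. s ''R'' (int i) = 0) \<and> (\<forall>j<Suc k. 0 \<le> vector_at ''z'' s j)"
        using I by (auto simp: x_def less_Suc_eq)
      show "runs check_step s' 21 (\<lambda>s''.
         (0 < (s''(''j'' := (s'' ''j'')(0 := int (Suc k)))) ''o'' 0 \<longleftrightarrow> (\<forall>i<m. s ''R'' (int i) = 0) \<and> (\<forall>j<Suc k. 0 \<le> vector_at ''z'' s j))
         \<and> (s''(''j'' := (s'' ''j'')(0 := int (Suc k)))) ''y'' 0 = (\<Sum>j<Suc k. c j * vector_at ''z'' s j))"
        unfolding check_step_def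
      proof (rule runs_Seq[where T = 9 and T' = 12 and R = "\<lambda>s''. s'' ''o'' 0 = x"])
        show "runs (If (Lt (Cell ''z'' (scalar ''j'')) (Const 0)) (assign ''o'' (Const 0)) Skip) s' 9 (\<lambda>s''. s'' ''o'' 0 = x)"
        proof (rule runs_If[where T = 3])
          assume "bval (Lt (Cell ''z'' (scalar ''j'')) (Const 0)) s'"
          then show "runs (assign ''o'' (Const 0)) s' 3 (\<lambda>s''. s'' ''o'' 0 = x)"
            by (intro runs_Assign) (simp_all add: x_def s' j vector_at_def)
        next
          assume "\<not> bval (Lt (Cell ''z'' (scalar ''j'')) (Const 0)) s'"
          then show "runs Skip s' 3 (\<lambda>s''. s'' ''o'' 0 = x)"
            by (intro runs_Skip) (simp_all add: x_def s' j vector_at_def)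
        qed simp
      next
        fix s2
        assume o2: "s2 ''o'' 0 = x" and same2: "same_outside (mods (If (Lt (Cell ''z'' (scalar ''j'')) (Const 0)) (assign ''o'' (Const 0)) Skip)) s' s2"
        have s2: "s2 ''y'' 0 = s' ''y'' 0" "s2 ''z'' = s ''z''" "s2 ''c'' = s ''c''" "s2 ''j'' 0 = int k" using same2 s' j by simp_all
        show "runs (assign ''y'' (Add (scalar ''y'') (Mul (Cell ''c'' (scalar ''j'')) (Cell ''z'' (scalar ''j''))))) s2 12 (\<lambda>s''.
         (0 < (s''(''j'' := (s'' ''j'')(0 := int (Suc k)))) ''o'' 0 \<longleftrightarrow> (\<forall>i<m. s ''R'' (int i) = 0) \<and> (\<forall>j<Suc k. 0 \<le> vector_at ''z'' s j))
         \<and> (s''(''j'' := (s'' ''j'')(0 := int (Suc k)))) ''y'' 0 = (\<Sum>j<Suc k. c j * vector_at ''z'' s j))"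
        proof (rule runs_Assign, rule conjI)
        qed (use I in \<open>simp_all add: s2 o2 x ck vector_at_def\<close>)
      qed simp
    next
      fix k s'
      assume "same_outside (insert ''j'' (mods check_step)) s1 s'"
      then have "s' ''n'' = s ''n''" using s1 by (simp add: mods_check_step)
      then show "ival (scalar ''n'') s' = int n" using s by (simp add: stores_input_def)
    next
      fix s'
      assume "(0 < s' ''o'' 0 \<longleftrightarrow> (\<forall>i<m. s ''R'' (int i) = 0) \<and> (\<forall>j<n. 0 \<le> vector_at ''z'' s j))
     \<and> s' ''y'' 0 = (\<Sum>j<n. c j * vector_at ''z'' s j)"
      then show "(0 < s' ''o'' 0 \<longleftrightarrow> (\<forall>i<m. s ''R'' (int i) = 0) \<and> nonneg (vector_at ''z'' s))
     \<and> s' ''y'' 0 = obj (vector_at ''z'' s)"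
        by (simp add: nonneg_def obj_def)
    qed (use o1 s1 in \<open>simp_all add: mods_check_step\<close>)
  qed simp
next
  show "itime (Const 0) + itime (Const 1) + 1 + (29 * m + 33 * n + 30) \<le> 100 * (m * n)"
    unfolding itime.simps btime.simps using mn_ge by linarith
qed simp_all

lemma feasible_cong: "(\<And>j. j < n \<Longrightarrow> x j = y j) \<Longrightarrow> feasible x = feasible y"
  and obj_cong: "(\<And>j. j < n \<Longrightarrow> x j = y j) \<Longrightarrow> obj x = obj y"
  by (simp_all add: feasible_def nonneg_def lhs_def obj_def)

text \<open>\<open>Z\<close> is the set of candidates tried so far. The stored point only has to be
  feasible, not a member of \<open>Z\<close>: together with a candidate that is at least as good as
  every feasible point this already gives optimality.\<close>

definition best_of :: "state \<Rightarrow> (nat \<Rightarrow> int) set \<Rightarrow> bool" where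
  "best_of s Z \<longleftrightarrow> (s ''status'' 0 = 0 \<or> s ''status'' 0 = 1)
     \<and> (s ''status'' 0 = 1 \<longrightarrow> feasible (vector_at ''x'' s) \<and> obj (vector_at ''x'' s) = s ''h'' 0)
     \<and> (\<forall>z\<in>Z. feasible z \<longrightarrow> s ''status'' 0 = 1 \<and> obj z \<le> s ''h'' 0)"

lemma best_of_same:
  "best_of s Z \<Longrightarrow> s' ''status'' = s ''status'' \<Longrightarrow> s' ''h'' = s ''h'' \<Longrightarrow> s' ''x'' = s ''x'' \<Longrightarrow> best_of s' Z"
  by (simp add: best_of_def vector_at_def[abs_def])

lemma runs_keep_best:
  assumes s: "stores_input s" "best_of s Z" and z: "\<And>j. j < n \<Longrightarrow> vector_at ''z'' s j = z j"
    and o: "0 < s ''o'' 0 \<longleftrightarrow> feasible z" and y: "s ''y'' 0 = obj z"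
  shows "runs keep_best s (60 * (m * n)) (\<lambda>s'. best_of s' (insert z Z))"
  unfolding keep_best_def
proof (rule runs_If[where T = "18 * n + 20"])
  let ?\<beta> = "Conj (Lt (Const 0) (scalar ''o''))
          (Neg (Conj (Lt (Const 0) (scalar ''status'')) (Neg (Lt (scalar ''h'') (scalar ''y'')))))"
  {
    assume "bval ?\<beta> s"
    then have new: "feasible z" "s ''status'' 0 \<le> 0 \<or> s ''h'' 0 < obj z" using o y by auto
    let ?s1 = "s(''status'' := (s ''status'')(0 := 1))"
    let ?s2 = "?s1(''h'' := (s ''h'')(0 := obj z))"
    let ?p = "Assign ''x'' (scalar ''j'') (Cell ''z'' (scalar ''j''))"
    have copy: "runs (For ''j'' (scalar ''n'') ?p) ?s2 (18 * n + 9) (\<lambda>s'. best_of s' (insert z Z))"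
    proof (rule runs_For[where N = n and T = 6 and I = "\<lambda>k s'. \<forall>j<k. vector_at ''x'' s' j = z j"])
      fix k s'
      assume k: "k < n" and I: "\<forall>j<k. vector_at ''x'' s' j = z j"
        and same: "same_outside (insert ''j'' (mods ?p)) ?s2 s'" and j: "s' ''j'' 0 = int k"
      have z': "s' ''z'' = s ''z''" using same by simp
      show "runs ?p s' 6 (\<lambda>s''. \<forall>j<Suc k. vector_at ''x'' (s''(''j'' := (s'' ''j'')(0 := int (Suc k)))) j = z j)"
        by (rule runs_Assign) (use I z[OF k] j in \<open>auto simp: z' vector_at_def less_Suc_eq\<close>)
    next
      fix k s'
      assume "same_outside (insert ''j'' (mods ?p)) ?s2 s'"
      then have "s' ''n'' = s ''n''" by simp
      then show "ival (scalar ''n'') s' = int n" using s by (simp add: stores_input_def)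
    next
      fix s'
      assume x: "\<forall>j<n. vector_at ''x'' s' j = z j" and same: "same_outside (insert ''j'' (mods ?p)) ?s2 s'"
      have s': "s' ''status'' 0 = 1" "s' ''h'' 0 = obj z" using same by simp_all
      have "feasible (vector_at ''x'' s')" "obj (vector_at ''x'' s') = obj z"
        using feasible_cong[of "vector_at ''x'' s'" z] obj_cong[of "vector_at ''x'' s'" z] x new(1) by blast+
      moreover have "obj z' \<le> obj z" if "z' \<in> Z" "feasible z'" for z'
      proof -
        have "s ''status'' 0 = 1" "obj z' \<le> s ''h'' 0" using s(2) that by (auto simp: best_of_def)
        then show ?thesis using new(2) by simp
      qed
      ultimately show "best_of s' (insert z Z)" by (auto simp: best_of_def s')
    qed simp_all
    show "runs (assign ''status'' (Const 1) ;; assign ''h'' (scalar ''y'') ;; For ''j'' (scalar ''n'') ?p) s (18 * n + 20)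
        (\<lambda>s'. best_of s' (insert z Z))"
      by (rule runs_Seq_Assign_eq[where s' = ?s1 and T = "18 * n + 13"],
          rule runs_Seq_Assign_eq[where s' = ?s2 and T = "18 * n + 9"], rule copy) (simp_all add: y)
  next
    assume "\<not> bval ?\<beta> s"
    then have "feasible z \<longrightarrow> 0 < s ''status'' 0 \<and> obj z \<le> s ''h'' 0" using o y by auto
    then have "best_of s (insert z Z)" using s(2) by (auto simp: best_of_def)
    then show "runs Skip s (18 * n + 20) (\<lambda>s'. best_of s' (insert z Z))" by (intro runs_Skip) simp_all
  }
  show "btime ?\<beta> + 1 + (18 * n + 20) \<le> 60 * (m * n)"
    unfolding itime.simps btime.simps using mn_ge by linarith
qed

lemma runs_try_candidate:
  assumes s: "stores_input s" "stores_sizes s" "best_of s Z" and V: "s ''V'' 0 = V" and e: "s ''e'' 0 = e"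
  shows "runs try_candidate s (500 * (m * n)) (\<lambda>s'. best_of s' (insert (cand e (stored s V)) Z))"
  unfolding try_candidate_def
proof (rule runs_Seq_Assign_eq[where s' = "s(''t'' := (s ''t'')(0 := e))" and T = "24 * n + 9 + 440 * (m * n)"])
  let ?z = "cand e (stored s V)"
  let ?Q = "\<lambda>s'. best_of s' (insert ?z Z)"
  let ?s0 = "s(''t'' := (s ''t'')(0 := e))"
  have s0: "?s0 ''n'' 0 = int n" "?s0 ''V'' 0 = V" using s V by (simp_all add: stores_input_def)
  have st0: "stored ?s0 V j = stored s V j" for j by (simp add: stored_def)
  let ?pivots = "For ''k'' (scalar ''r'') pivot_step"
  show "runs (load_row ;; residual ;; ?pivots ;; residual ;; check ;; keep_best) ?s0 (24 * n + 9 + 440 * (m * n)) ?Q"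
  proof (rule runs_Seq[OF runs_load_row[of ?s0 V, OF s0]])
    fix s1
    assume z1: "\<forall>j<n. vector_at ''z'' s1 j = stored ?s0 V j" and same: "same_outside (mods load_row) ?s0 s1"
    have same1: "same_outside {''t'', ''j'', ''z''} s s1" using same by (simp add: mods_load_row)
    have inp1: "stores_input s1" using s(1) same1 by (rule stores_input_same) simp
    have lhs1: "lhs (vector_at ''z'' s1) i = lhs (stored s V) i" for i
      using z1 by (simp add: lhs_def st0)
    have t1: "s1 ''t'' 0 = e" using same by (simp add: mods_load_row)
    show "runs (residual ;; ?pivots ;; residual ;; check ;; keep_best) s1 (440 * (m * n)) ?Q"
    proof (rule runs_Seq[OF runs_residual[OF inp1], where T' = "370 * (m * n)"])
      fix s2
      assume R: "\<forall>i<m. s2 ''R'' (int i) = b i - lhs (vector_at ''z'' s1) i" and "same_outside (mods residual) s1 s2"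
      then have same: "same_outside {''i'', ''j'', ''R''} s1 s2" by (simp add: mods_residual)
      have same2: "same_outside {''t'', ''j'', ''z'', ''i'', ''R''} s s2" using same same1 by simp
      have inp2: "stores_input s2" using s(1) same2 by (rule stores_input_same) simp
      have siz2: "stores_sizes s2" using s(2) same2 by (rule stores_sizes_same) simp
      have t2: "s2 ''t'' 0 = e" using same t1 by simp
      have "s2 ''z'' = s1 ''z''" using same by simp
      then have z2: "vector_at ''z'' s2 j = stored s V j" if "j < n" for j
        using z1 that by (simp add: vector_at_def st0)
      have R2: "s2 ''R'' (int i) = b i - lhs (stored s V) i" if "i < m" for i using R lhs1 that by simp
      show "runs (?pivots ;; residual ;; check ;; keep_best) s2 (370 * (m * n)) ?Q"
      proof (rule runs_Seq[OF runs_pivots[of s2 e "stored s V", OF inp2 siz2 t2 z2 R2], where T' = "230 * (m * n)"])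
        fix s3
        assume z3: "\<forall>j<n. vector_at ''z'' s3 j = ?z j" and "same_outside (mods ?pivots) s2 s3"
        then have same: "same_outside {''k'', ''q'', ''t'', ''N'', ''S'', ''i'', ''a'', ''z''} s2 s3" by (simp add: mods_pivot_step)
        have same3: "same_outside {''t'', ''j'', ''z'', ''i'', ''R'', ''k'', ''q'', ''N'', ''S'', ''a''} s s3"
          using same same2 by simp
        have inp3: "stores_input s3" using s(1) same3 by (rule stores_input_same) simp
        have lhs3: "lhs (vector_at ''z'' s3) i = lhs ?z i" for i using z3 by (simp add: lhs_def)
        show "runs (residual ;; check ;; keep_best) s3 (230 * (m * n)) ?Q"
        proof (rule runs_Seq[OF runs_residual[OF inp3], where T' = "160 * (m * n)"])
          fix s4
          assume R4: "\<forall>i<m. s4 ''R'' (int i) = b i - lhs (vector_at ''z'' s3) i" and "same_outside (mods residual) s3 s4"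
          then have same: "same_outside {''i'', ''j'', ''R''} s3 s4" by (simp add: mods_residual)
          have same4: "same_outside {''t'', ''j'', ''z'', ''i'', ''R'', ''k'', ''q'', ''N'', ''S'', ''a''} s s4"
            using same same3 by simp
          have inp4: "stores_input s4" using s(1) same4 by (rule stores_input_same) simp
          have "s4 ''z'' = s3 ''z''" using same by simp
          then have z4: "\<forall>j<n. vector_at ''z'' s4 j = ?z j" using z3 by (simp add: vector_at_def)
          have "(\<forall>i<m. s4 ''R'' (int i) = 0) \<and> nonneg (vector_at ''z'' s4) \<longleftrightarrow> feasible ?z"
            using R4 z4 by (auto simp: lhs3 feasible_def nonneg_def)
          moreover have "obj (vector_at ''z'' s4) = obj ?z" using z4 by (intro obj_cong) blast
          moreover note check = runs_check[OF inp4]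
          ultimately have check: "runs check s4 (100 * (m * n)) (\<lambda>s'. (0 < s' ''o'' 0 \<longleftrightarrow> feasible ?z) \<and> s' ''y'' 0 = obj ?z)"
            by (simp only:)
          show "runs (check ;; keep_best) s4 (160 * (m * n)) ?Q"
          proof (rule runs_Seq[OF check, where T' = "60 * (m * n)"])
            fix s5
            assume oy: "(0 < s5 ''o'' 0 \<longleftrightarrow> feasible ?z) \<and> s5 ''y'' 0 = obj ?z" and "same_outside (mods check) s4 s5"
            then have same: "same_outside {''o'', ''y'', ''i'', ''j''} s4 s5" by (simp add: mods_check)
            have same5: "same_outside {''t'', ''j'', ''z'', ''i'', ''R'', ''k'', ''q'', ''N'', ''S'', ''a'', ''o'', ''y''} s s5"
              using same same4 by simp
            have inp5: "stores_input s5" using s(1) same5 by (rule stores_input_same) simp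
            have best5: "best_of s5 Z" by (rule best_of_same[OF s(3)]) (use same5 in simp_all)
            have "s5 ''z'' = s4 ''z''" using same by simp
            then have z5: "vector_at ''z'' s5 j = ?z j" if "j < n" for j using z4 that by (simp add: vector_at_def)
            show "runs keep_best s5 (60 * (m * n)) ?Q"
              using runs_keep_best[OF inp5 best5 z5] oy by blast
          qed simp
        qed simp
      qed simp_all
    qed simp
  qed simp
next
  show "s(''t'' := (s ''t'')(ival (Const 0) s := ival (scalar ''e'') s)) = s(''t'' := (s ''t'')(0 := e))" using e by simp
next
  show "itime (Const 0) + itime (scalar ''e'') + 1 + (24 * n + 9 + 440 * (m * n)) \<le> 500 * (m * n)"
    unfolding itime.simps btime.simps using mn_ge by linarith
qed

end

section \<open>The whole program\<close>

definition search :: com where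
  "search = For ''V'' (scalar ''H'') (If (Lt (Const 0) (Cell ''f'' (scalar ''V''))) (For ''e'' (scalar ''E'') try_candidate) Skip)"

text \<open>An improving ray means unboundedness only if some feasible point was found; otherwise
  \<open>status\<close> remains 0, the code for infeasibility.\<close>

definition solve_ip :: com where
  "solve_ip = compute_max ;; compute_sizes ;; compute_weights ;; fill_table ;; search ;;
     If (Conj (Lt (Const 0) (scalar ''g'')) (Lt (Const 0) (scalar ''status''))) (assign ''status'' (Const 2)) Skip"

lemma mods_try_candidate: "mods try_candidate =
    {''t'', ''j'', ''z'', ''i'', ''R'', ''k'', ''q'', ''N'', ''S'', ''a'', ''o'', ''y'', ''status'', ''h'', ''x''}"
  by (auto simp: try_candidate_def mods_load_row mods_residual mods_pivot_step mods_check mods_keep_best)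

section \<open>The search over all candidates and the correctness of the program\<close>

context integer_program
begin

definition candidates :: "state \<Rightarrow> int \<Rightarrow> (nat \<Rightarrow> int) set" where
  "candidates s k = {cand e (stored s V) | V e. 0 \<le> V \<and> V < k \<and> reached s V \<and> 0 \<le> e \<and> e < G ^ r}"

lemma runs_try_all:
  assumes s: "stores_input s" "stores_sizes s" "best_of s Z" and V: "s ''V'' 0 = V"
  shows "runs (For ''e'' (scalar ''E'') try_candidate) s (nat (G ^ r) * (500 * (m * n) + 12) + 9)
    (\<lambda>s'. best_of s' (Z \<union> {cand e (stored s V) | e. 0 \<le> e \<and> e < G ^ r}))"
proof (rule runs_For[where N = "nat (G ^ r)" and T = "500 * (m * n)" and
      I = "\<lambda>k s'. best_of s' (Z \<union> {cand e (stored s V) | e. 0 \<le> e \<and> e < int k})"])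
  fix k s'
  assume best: "best_of s' (Z \<union> {cand e (stored s V) | e. 0 \<le> e \<and> e < int k})"
    and same: "same_outside (insert ''e'' (mods try_candidate)) s s'" and e: "s' ''e'' 0 = int k"
  have inp: "stores_input s'" using s(1) same by (rule stores_input_same) (simp add: mods_try_candidate)
  have siz: "stores_sizes s'" using s(2) same by (rule stores_sizes_same) (simp add: mods_try_candidate)
  have V': "s' ''V'' 0 = V" using same V by (simp add: mods_try_candidate)
  have "s' ''u'' = s ''u''" using same by (simp add: mods_try_candidate)
  then have u: "stored s' V = stored s V" by (simp add: stored_def fun_eq_iff)
  have set: "insert (cand (int k) (stored s V)) (Z \<union> {cand e (stored s V) | e. 0 \<le> e \<and> e < int k})
      = Z \<union> {cand e (stored s V) | e. 0 \<le> e \<and> e < int (Suc k)}"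
  proof -
    have "(0 \<le> e \<and> e < int (Suc k)) \<longleftrightarrow> (0 \<le> e \<and> e < int k) \<or> e = int k" for e by auto
    then show ?thesis by blast
  qed
  show "runs try_candidate s' (500 * (m * n)) (\<lambda>s''. best_of (s''(''e'' := (s'' ''e'')(0 := int (Suc k))))
      (Z \<union> {cand e (stored s V) | e. 0 \<le> e \<and> e < int (Suc k)}))"
  proof (rule runs_mono[OF runs_try_candidate[of s' _ V "int k", OF inp siz best V' e]])
    fix s''
    assume "best_of s'' (insert (cand (int k) (stored s' V)) (Z \<union> {cand e (stored s V) | e. 0 \<le> e \<and> e < int k}))"
    then have "best_of s'' (Z \<union> {cand e (stored s V) | e. 0 \<le> e \<and> e < int (Suc k)})" unfolding u set .
    then show "best_of (s''(''e'' := (s'' ''e'')(0 := int (Suc k)))) (Z \<union> {cand e (stored s V) | e. 0 \<le> e \<and> e < int (Suc k)})"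
      by (rule best_of_same) simp_all
  qed simp
next
  fix k s'
  assume "same_outside (insert ''e'' (mods try_candidate)) s s'"
  then have "s' ''E'' = s ''E''" by (simp add: mods_try_candidate)
  then show "ival (scalar ''E'') s' = int (nat (G ^ r))" using s(2) G_pos by (simp add: stores_sizes_def)
next
  fix s'
  assume "best_of s' (Z \<union> {cand e (stored s V) | e. 0 \<le> e \<and> e < int (nat (G ^ r))})"
  then show "best_of s' (Z \<union> {cand e (stored s V) | e. 0 \<le> e \<and> e < G ^ r})" using G_pos by simp
next
  have eq: "Z \<union> {cand e (stored s V) | e. 0 \<le> e \<and> e < int 0} = Z" by auto
  show "best_of (s(''e'' := (s ''e'')(0 := 0))) (Z \<union> {cand e (stored s V) | e. 0 \<le> e \<and> e < int 0})"
    unfolding eq by (rule best_of_same[OF s(3)]) simp_all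
qed (simp_all add: mods_try_candidate)

lemma runs_search:
  assumes s: "stores_input s" "stores_sizes s" "best_of s {}"
  shows "runs search s (600 * (H * nat (G ^ r) * (m * n))) (\<lambda>s'. best_of s' (candidates s (int H)))"
  unfolding search_def
proof (rule runs_For[where N = H and T = "nat (G ^ r) * (500 * (m * n) + 12) + 15" and
      I = "\<lambda>k s'. best_of s' (candidates s (int k))"])
  let ?p = "If (Lt (Const 0) (Cell ''f'' (scalar ''V''))) (For ''e'' (scalar ''E'') try_candidate) Skip"
  fix k s'
  assume best: "best_of s' (candidates s (int k))"
    and same: "same_outside (insert ''V'' (mods ?p)) s s'" and V: "s' ''V'' 0 = int k"
  have inp: "stores_input s'" using s(1) same by (rule stores_input_same) (simp add: mods_try_candidate)
  have siz: "stores_sizes s'" using s(2) same by (rule stores_sizes_same) (simp add: mods_try_candidate)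
  have "s' ''u'' = s ''u''" "s' ''f'' = s ''f''" using same by (simp_all add: mods_try_candidate)
  then have tab: "stored s' W = stored s W" "reached s' W = reached s W" for W
    by (simp_all add: stored_def reached_def fun_eq_iff)
  have split: "0 \<le> W \<and> W < int (Suc k) \<longleftrightarrow> (0 \<le> W \<and> W < int k) \<or> W = int k" for W by auto
  show "runs ?p s' (nat (G ^ r) * (500 * (m * n) + 12) + 15) (\<lambda>s''. best_of (s''(''V'' := (s'' ''V'')(0 := int (Suc k)))) (candidates s (int (Suc k))))"
  proof (rule runs_If[where T = "nat (G ^ r) * (500 * (m * n) + 12) + 9"])
    assume "bval (Lt (Const 0) (Cell ''f'' (scalar ''V''))) s'"
    then have "reached s (int k)" using V tab(2)[of "int k"] by (simp add: reached_def)
    then have set: "candidates s (int k) \<union> {cand e (stored s (int k)) | e. 0 \<le> e \<and> e < G ^ r} = candidates s (int (Suc k))"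
      unfolding candidates_def using split by blast
    show "runs (For ''e'' (scalar ''E'') try_candidate) s' (nat (G ^ r) * (500 * (m * n) + 12) + 9)
       (\<lambda>s''. best_of (s''(''V'' := (s'' ''V'')(0 := int (Suc k)))) (candidates s (int (Suc k))))"
    proof (rule runs_mono[OF runs_try_all[of s' _ "int k", OF inp siz best V]])
      fix s''
      assume "best_of s'' (candidates s (int k) \<union> {cand e (stored s' (int k)) | e. 0 \<le> e \<and> e < G ^ r})"
      then have "best_of s'' (candidates s (int (Suc k)))" unfolding tab set .
      then show "best_of (s''(''V'' := (s'' ''V'')(0 := int (Suc k)))) (candidates s (int (Suc k)))"
        by (rule best_of_same) simp_all
    qed simp
  next
    assume "\<not> bval (Lt (Const 0) (Cell ''f'' (scalar ''V''))) s'"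
    then have "\<not> reached s (int k)" using V tab(2)[of "int k"] by (simp add: reached_def)
    then have "candidates s (int (Suc k)) = candidates s (int k)"
      unfolding candidates_def using split by blast
    moreover have "best_of (s'(''V'' := (s' ''V'')(0 := int (Suc k)))) (candidates s (int k))"
      using best by (rule best_of_same) simp_all
    ultimately show "runs Skip s' (nat (G ^ r) * (500 * (m * n) + 12) + 9)
       (\<lambda>s''. best_of (s''(''V'' := (s'' ''V'')(0 := int (Suc k)))) (candidates s (int (Suc k))))"
      by (intro runs_Skip) simp_all
  qed simp
next
  fix k s'
  assume "same_outside (insert ''V'' (mods (If (Lt (Const 0) (Cell ''f'' (scalar ''V''))) (For ''e'' (scalar ''E'') try_candidate) Skip))) s s'"
  then have "s' ''H'' = s ''H''" by (simp add: mods_try_candidate)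
  then show "ival (scalar ''H'') s' = int H" using s(2) by (simp add: stores_sizes_def)
next
  define E where "E = nat (G ^ r)"
  have E: "1 \<le> E" using G_pos by (simp add: E_def Suc_le_eq)
  have "1 * 1 \<le> E * (m * n)" using E mn_ge(1) by (rule mult_le_mono)
  moreover have "E * 1 \<le> E * (m * n)" using mn_ge(1) by (intro mult_le_mono) auto
  moreover have "E * (500 * (m * n) + 12) + 36 = 500 * (E * (m * n)) + 12 * E + 36" by (simp add: algebra_simps)
  ultimately have "E * (500 * (m * n) + 12) + 36 \<le> 600 * (E * (m * n))" by linarith
  then have "H * (E * (500 * (m * n) + 12) + 36) \<le> H * (600 * (E * (m * n)))" by (rule mult_le_mono2)
  moreover have "H * (E * (500 * (m * n) + 12) + 36) = H * (E * (500 * (m * n) + 12) + 27) + 9 * H" by (simp add: algebra_simps)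
  moreover have "1 \<le> H" by (simp add: H_def)
  ultimately have "H * (E * (500 * (m * n) + 12) + 27) + 9 \<le> H * (600 * (E * (m * n)))" by linarith
  moreover have "H * (600 * (E * (m * n))) = 600 * (H * E * (m * n))" by simp
  moreover have "E * (500 * (m * n) + 12) + 15 + itime (scalar ''H'') + 10 = E * (500 * (m * n) + 12) + 27" by simp
  ultimately show "H * (nat (G ^ r) * (500 * (m * n) + 12) + 15 + itime (scalar ''H'') + 10) + itime (scalar ''H'') + 7
      \<le> 600 * (H * nat (G ^ r) * (m * n))"
    unfolding E_def[symmetric] by (simp only: itime.simps)
next
  have eq: "candidates s (int 0) = {}" by (simp add: candidates_def)
  show "best_of (s(''V'' := (s ''V'')(0 := 0))) (candidates s (int 0))"
    unfolding eq by (rule best_of_same[OF s(3)]) simp_all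
qed (simp_all add: mods_try_candidate)

definition solved :: "state \<Rightarrow> bool" where
  "solved s \<longleftrightarrow> (if s ''status'' 0 = 0 then \<nexists>x. feasible x
     else if s ''status'' 0 = 1 then feasible (vector_at ''x'' s) \<and> (\<forall>y. feasible y \<longrightarrow> obj y \<le> obj (vector_at ''x'' s))
     else \<forall>t. \<exists>x. feasible x \<and> t < obj x)"

lemma runs_solve_ip:
  assumes s: "stores_input s" and zero: "\<And>a k. a \<notin> {''m'', ''n'', ''A'', ''b'', ''c''} \<Longrightarrow> s a k = 0"
    and attained: "\<exists>i<m. \<exists>j<n. \<bar>A i j\<bar> = int \<Delta>"
  shows "runs solve_ip s (2000 * (H * nat (G ^ r) * (m * n))) solved"
proof -
  let ?T5 = "600 * (H * nat (G ^ r) * (m * n))"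
  let ?T4 = "400 * (H * (n * n))"
  let ?fin = "If (Conj (Lt (Const 0) (scalar ''g'')) (Lt (Const 0) (scalar ''status''))) (assign ''status'' (Const 2)) Skip"
  have d: "s ''d'' 0 = 0" by (rule zero) simp
  have mods: "mods compute_max = {''k'', ''d''}" "mods compute_sizes = {''M'', ''k'', ''D'', ''K'', ''Q'', ''P'', ''G'', ''r''}"
    "mods compute_weights = {''i'', ''j'', ''w'', ''P'', ''G'', ''E'', ''k'', ''H''}"
    "mods fill_table = {''f'', ''V'', ''j'', ''p'', ''v'', ''l'', ''u'', ''g''}"
    "mods search = {''V'', ''e'', ''t'', ''j'', ''z'', ''i'', ''R'', ''k'', ''q'', ''N'', ''S'', ''a'', ''o'', ''y'', ''status'', ''h'', ''x''}"
    by (auto simp: compute_max_def compute_sizes_def compute_weights_def add_row_def fill_table_def mods_relax mods_flag_ray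
        search_def mods_try_candidate)
  have "runs solve_ip s (60 * (m * n) + (200 * (m * n) + (300 * (m * n) + (?T4 + (?T5 + 20))))) solved"
    unfolding solve_ip_def
  proof (rule runs_Seq[OF runs_compute_max[OF s d attained] _ order_refl])
    fix s1
    assume d1: "s1 ''d'' 0 = int \<Delta>" and "same_outside (mods compute_max) s s1"
    then have same1: "same_outside {''k'', ''d''} s s1" by (simp add: mods)
    have inp1: "stores_input s1" using s same1 by (rule stores_input_same) simp
    show "runs (compute_sizes ;; compute_weights ;; fill_table ;; search ;; ?fin) s1
        (200 * (m * n) + (300 * (m * n) + (?T4 + (?T5 + 20)))) solved"
    proof (rule runs_Seq[OF runs_compute_sizes[OF inp1 d1] _ order_refl])
      fix s2
      assume sizes: "s2 ''M'' 0 = int M \<and> s2 ''D'' 0 = int D \<and> s2 ''K'' 0 = K \<and> s2 ''Q'' 0 = Q \<and> s2 ''r'' 0 = int r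
          \<and> s2 ''P'' 0 = 1 \<and> s2 ''G'' 0 = int n" and "same_outside (mods compute_sizes) s1 s2"
      then have same2: "same_outside {''k'', ''d'', ''M'', ''D'', ''K'', ''Q'', ''P'', ''G'', ''r''} s s2"
        using same1 by (simp add: mods)
      have inp2: "stores_input s2" using s same2 by (rule stores_input_same) simp
      have w2: "s2 ''w'' j = 0" for j using same2 zero[of "''w''" j] by simp
      have wts: "runs compute_weights s2 (300 * (m * n)) stores_sizes"
        by (rule runs_compute_weights[OF inp2]) (use sizes w2 in simp_all)
      show "runs (compute_weights ;; fill_table ;; search ;; ?fin) s2 (300 * (m * n) + (?T4 + (?T5 + 20))) solved"
      proof (rule runs_Seq[OF wts _ order_refl])
        fix s3
        assume siz3: "stores_sizes s3" and "same_outside (mods compute_weights) s2 s3"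
        then have same3: "same_outside {''k'', ''d'', ''M'', ''D'', ''K'', ''Q'', ''P'', ''G'', ''r'', ''i'', ''j'', ''w'', ''E'', ''H''} s s3"
          using same2 by (simp add: mods)
        have inp3: "stores_input s3" using s same3 by (rule stores_input_same) simp
        have zero3: "s3 a V = 0" if "a \<in> {''f'', ''v'', ''u'', ''g''}" for a V
        proof -
          have "s3 ''f'' = s ''f''" "s3 ''v'' = s ''v''" "s3 ''u'' = s ''u''" "s3 ''g'' = s ''g''"
            using same3 by simp_all
          moreover have "s ''f'' V = 0" "s ''v'' V = 0" "s ''u'' V = 0" "s ''g'' V = 0"
            by (rule zero, simp)+
          ultimately show ?thesis using that by (elim insertE emptyE) simp_all
        qed
        show "runs (fill_table ;; search ;; ?fin) s3 (?T4 + (?T5 + 20)) solved"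
        proof (rule runs_Seq[OF runs_fill_table[OF inp3 siz3 zero3] _ order_refl])
          fix s4
          assume tab: "(\<forall>V. 0 \<le> V \<and> V < int H \<longrightarrow> table_entry (reached s4 V) (s4 ''v'' V) (stored s4 V) V)
             \<and> (0 < s4 ''g'' 0 \<longleftrightarrow> (\<exists>V. 0 \<le> V \<and> V < int H \<and> ray_at s4 V))"
            and "same_outside (mods fill_table) s3 s4"
          then have same: "same_outside {''f'', ''V'', ''j'', ''p'', ''v'', ''l'', ''u'', ''g''} s3 s4" by (simp add: mods)
          have inp4: "stores_input s4" using inp3 same by (rule stores_input_same) simp
          have siz4: "stores_sizes s4" using siz3 same by (rule stores_sizes_same) simp
          have "s4 ''status'' 0 = 0" using same same3 zero[of "''status''" 0] by simp
          then have best4: "best_of s4 {}" by (simp add: best_of_def)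
          have entry: "table_entry (reached s4 V) (s4 ''v'' V) (stored s4 V) V" if "0 \<le> V" "V < int H" for V
            using tab that by blast
          show "runs (search ;; ?fin) s4 (?T5 + 20) solved"
          proof (rule runs_Seq[OF runs_search[OF inp4 siz4 best4] _ order_refl])
            fix s5
            assume best: "best_of s5 (candidates s4 (int H))" and "same_outside (mods search) s4 s5"
            then have g5: "s5 ''g'' 0 = s4 ''g'' 0" by (simp add: mods)
            \<comment> \<open>\<open>candidate_exists\<close> makes no assumption about rays, so
              this holds whatever the flag \<open>g\<close> says.\<close>
            have infeasible: "\<nexists>x. feasible x" if "s5 ''status'' 0 = 0"
            proof
              assume "\<exists>x. feasible x"
              then obtain V e where "0 \<le> V" "V < int H" "reached s4 V" "0 \<le> e" "e < G ^ r" "feasible (cand e (stored s4 V))"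
                using candidate_exists[of "reached s4" "s4 ''v''" "stored s4", OF entry] by blast
              then have "s5 ''status'' 0 = 1" using best unfolding best_of_def candidates_def by blast
              then show False using that by simp
            qed
            have optimal: "obj y \<le> obj (vector_at ''x'' s5)"
              if st: "s5 ''status'' 0 = 1" and g: "\<not> 0 < s5 ''g'' 0" and y: "feasible y" for y
            proof -
              have "\<nexists>V. 0 \<le> V \<and> V < int H \<and> reached s4 V \<and> V mod K ^ m = 0 \<and> 0 < s4 ''v'' V"
                using tab g5 g unfolding ray_at_def by (metis (no_types))
              then obtain V e where "0 \<le> V" "V < int H" "reached s4 V" "0 \<le> e" "e < G ^ r"
                "feasible (cand e (stored s4 V))" "obj y \<le> obj (cand e (stored s4 V))"
                using best_candidate[of "reached s4" "s4 ''v''" "stored s4", OF entry y] by blast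
              moreover from this have "obj (cand e (stored s4 V)) \<le> s5 ''h'' 0"
                using best unfolding best_of_def candidates_def by blast
              moreover have "obj (vector_at ''x'' s5) = s5 ''h'' 0" using best st by (simp add: best_of_def)
              ultimately show ?thesis by simp
            qed
            have unbounded: "\<exists>x. feasible x \<and> t < obj x" if st: "s5 ''status'' 0 = 1" and g: "0 < s5 ''g'' 0" for t
            proof -
              obtain V where V: "0 \<le> V" "V < int H" "reached s4 V" "V mod K ^ m = 0" "0 < s4 ''v'' V"
                using tab g g5 by (auto simp: ray_at_def)
              have "ray (stored s4 V) \<and> 0 < obj (stored s4 V)"
                by (rule unbounded_direction[of "reached s4" "s4 ''v''" "stored s4" V]; (rule entry)?) (use V in simp_all)
              then show ?thesis using unbounded_along_ray best st unfolding best_of_def by blast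
            qed
            have st5: "s5 ''status'' 0 = 0 \<or> s5 ''status'' 0 = 1" and feas5: "s5 ''status'' 0 = 1 \<longrightarrow> feasible (vector_at ''x'' s5)"
              using best by (auto simp: best_of_def)
            show "runs ?fin s5 20 solved"
            proof (rule runs_If[where T = 5])
              assume "bval (Conj (Lt (Const 0) (scalar ''g'')) (Lt (Const 0) (scalar ''status''))) s5"
              then have "0 < s5 ''g'' 0" "s5 ''status'' 0 = 1" using st5 by auto
              then show "runs (assign ''status'' (Const 2)) s5 5 solved"
                by (intro runs_Assign) (simp_all add: solved_def unbounded)
            next
              assume "\<not> bval (Conj (Lt (Const 0) (scalar ''g'')) (Lt (Const 0) (scalar ''status''))) s5"
              then have "s5 ''status'' 0 = 0 \<or> s5 ''status'' 0 = 1 \<and> \<not> 0 < s5 ''g'' 0" using st5 by auto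
              then have sol: "solved s5" using infeasible optimal feas5 unfolding solved_def by auto
              show "runs Skip s5 5 solved"
              proof (rule runs_Skip)
                show "solved s5" by (rule sol)
              qed simp
            qed simp
          qed
        qed
      qed
    qed
  qed
  moreover have "60 * (m * n) + (200 * (m * n) + (300 * (m * n) + (?T4 + (?T5 + 20)))) \<le> 2000 * (H * nat (G ^ r) * (m * n))"
  proof -
    define E where "E = nat (G ^ r)"
    have H: "1 \<le> H" by (simp add: H_def)
    have r: "1 \<le> r" using m n by (simp add: r_def)
    \<comment> \<open>Since \<open>n \<le> G \<le> G^r\<close>, the cost \<open>H * n^2\<close> of
      filling the table is dominated by that of the search.\<close>
    have "int n \<le> G" using n Q_pos one_le_power[of Q m] by (simp add: G_def)
    also have "G ^ 1 \<le> G ^ r" using G_pos r by (intro power_increasing) auto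
    finally have nE: "n \<le> E" by (simp add: E_def)
    then have E: "1 \<le> E" using n by simp
    have HE: "1 \<le> H * E" using mult_le_mono[OF H E] by simp
    then have 1: "m * n \<le> H * E * (m * n)" using mult_le_mono1[of 1 "H * E" "m * n"] by simp
    have "H * (n * n) \<le> H * (E * (m * n))" using nE mn_ge(3) by (intro mult_le_mono mult_le_mono2) auto
    then have 2: "H * (n * n) \<le> H * E * (m * n)" by (simp add: mult.assoc)
    show ?thesis unfolding E_def[symmetric] using 1 2 mn_ge(1) by linarith
  qed
  ultimately show ?thesis using runs_mono[where R = solved and Q = solved] by blast
qed

section \<open>The arithmetic of the running time\<close>

text \<open>For \<open>n = 1\<close> only \<open>4^m\<close> is available, and the program makes
  \<open>3^m\<close> trials on a single table cell. For \<open>n \<ge> 2\<close> all numerical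
  factors except the \<open>4^m\<close> from \<open>K^m\<close> are absorbed into powers of
  \<open>n\<close> and \<open>M\<close>.\<close>

lemma time_bound:
  assumes n1: "n = 1 \<Longrightarrow> \<Delta> = 1"
  shows "H * nat (G ^ r) * (m * n) \<le> 4 * (2 ^ (2 * m) * \<Delta> ^ (m ^ 3 + 3 * m ^ 2 + 2 * m) * n ^ (m ^ 3 + 5 * m ^ 2 + 6 * m + 1))"
proof (cases "n = 1")
  case True
  have M1: "M = 1" unfolding M_def unfolding n1[OF True] True by simp
  have H1: "H = 1" unfolding H_def D_def M1 by simp
  have r1: "r = 1" unfolding r_def unfolding True using m by simp
  have E1: "nat (G ^ r) = 3 ^ m" unfolding r1 G_def Q_def M1 unfolding True by (simp add: nat_power_eq)
  \<comment> \<open>The factor \<open>m\<close> from one trial is absorbed by the gap between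
    \<open>3^m\<close> and \<open>4^m\<close>; this accounts for the factor 4 in the
    statement.\<close>
  have "3 ^ m * m \<le> 4 * 4 ^ m" for m :: nat
  proof (induction m)
    case (Suc m)
    have "3 ^ Suc m * Suc m = 3 * (3 ^ m * m) + 3 * 3 ^ m" by (simp add: algebra_simps)
    also have "\<dots> \<le> 3 * (4 * 4 ^ m) + 3 * 4 ^ m" using Suc.IH by (intro add_mono mult_le_mono2 power_mono) auto
    finally show ?case by simp
  qed simp
  then show ?thesis unfolding H1 E1 unfolding n1[OF True] True by (simp add: power_mult)
next
  case False
  then have n2: "2 \<le> n" using n by simp
  have nM: "D + 1 \<le> n * M"
  proof -
    have "D + n = n * M" using M_ge_1 by (cases M) (simp_all add: D_def)
    then show ?thesis using n by simp
  qed
  define k where "k = 4 * (D + 1) * \<Delta>"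
  have K: "K = int k" by (simp add: K_def k_def)
  have "k \<le> 4 * (n * M) * \<Delta>" unfolding k_def using nM by (intro mult_le_mono) auto
  then have "k ^ m \<le> (4 * (n * \<Delta>) * M) ^ m" by (intro power_mono) (simp_all add: mult_ac)
  \<comment> \<open>Here \<open>(n * \<Delta>)^m\<close> is itself \<open>M\<close>, and
    \<open>4^m\<close> is the factor \<open>2^(2*m)\<close> of the final bound.\<close>
  also have "\<dots> = 4 ^ m * M ^ (m + 1)" by (simp add: power_mult_distrib M_def)
  finally have km: "k ^ m \<le> 4 ^ m * M ^ (m + 1)" .
  have "1 \<le> k ^ m" using \<Delta> by (simp add: k_def)
  then have "H \<le> 2 * (D + 1) * k ^ m" by (simp add: H_def K nat_power_eq algebra_simps)
  also have "\<dots> \<le> 2 * (n * M) * (4 ^ m * M ^ (m + 1))" using nM km by (intro mult_le_mono) auto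
  finally have H: "H \<le> 2 * 4 ^ m * n * M ^ (m + 2)" by (simp add: mult_ac)
  have "nat (G ^ r) = (n * (2 * M + 1) ^ m) ^ r"
  proof -
    have "G ^ r = int ((n * (2 * M + 1) ^ m) ^ r)" by (simp add: G_def Q_def add.commute)
    then show ?thesis by (simp only: nat_int)
  qed
  also have "\<dots> \<le> (n * (2 * M + 1) ^ m) ^ m" using n by (intro power_increasing) (simp_all add: r_def)
  also have "\<dots> \<le> (n * (3 * M) ^ m) ^ m" using M_ge_1 by (intro power_mono mult_le_mono2) auto
  also have "\<dots> = n ^ m * 3 ^ (m * m) * M ^ (m * m)" by (simp add: power_mult_distrib power_mult mult_ac)
  finally have E: "nat (G ^ r) \<le> n ^ m * 3 ^ (m * m) * M ^ (m * m)" .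
  \<comment> \<open>From \<open>3 \<le> 2^2 \<le> n^2\<close> one gets
    \<open>3^(m^2) \<le> (n^m)^(2*m)\<close>, and \<open>n^m \<le> M\<close>.\<close>
  have three: "3 ^ (m * m) \<le> M ^ (2 * m)"
  proof -
    have "(3::nat) ^ (m * m) \<le> (2 ^ 2) ^ (m * m)" by (intro power_mono) auto
    also have "\<dots> \<le> (n ^ 2) ^ (m * m)" using n2 by (intro power_mono) auto
    also have "\<dots> = (n ^ m) ^ (2 * m)" by (simp add: power_mult[symmetric] mult_ac)
    also have "\<dots> \<le> M ^ (2 * m)" unfolding M_def using \<Delta> by (intro power_mono) auto
    finally show ?thesis .
  qed
  have "m \<le> 2 ^ m" using less_exp[of m] by simp
  also have "(2::nat) ^ m \<le> n ^ m" using n2 by (intro power_mono) auto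
  finally have mn: "m \<le> n ^ m" .
  have "H * nat (G ^ r) * (m * n) \<le> (2 * 4 ^ m * n * M ^ (m + 2)) * (n ^ m * 3 ^ (m * m) * M ^ (m * m)) * (n ^ m * n)"
    using H E mn by (intro mult_le_mono) auto
  \<comment> \<open>The factor 2 of the bound on \<open>H\<close> is absorbed by one factor
    \<open>n\<close>.\<close>
  also have "\<dots> \<le> (n * 4 ^ m * n * M ^ (m + 2)) * (n ^ m * M ^ (2 * m) * M ^ (m * m)) * (n ^ m * n)"
    using n2 three by (intro mult_le_mono) auto
  also have "\<dots> = 4 ^ m * M ^ (m * m + 3 * m + 2) * n ^ (2 * m + 3)"
    by (simp add: power_add power_mult power_numeral_reduce mult_ac)
  \<comment> \<open>The new exponent of \<open>n\<close> is what the claimed exponent leaves after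
    \<open>M^(m^2+3*m+2)\<close> has taken \<open>m^3 + 3*m^2 + 2*m\<close>.\<close>
  also have "\<dots> \<le> 4 ^ m * M ^ (m * m + 3 * m + 2) * n ^ (2 * m * m + 4 * m + 1)"
  proof (intro mult_le_mono2 power_increasing)
    have "1 \<le> m * m" using m by simp
    then show "2 * m + 3 \<le> 2 * m * m + 4 * m + 1" using m by linarith
  qed (use n in simp)
  also have "\<dots> = 2 ^ (2 * m) * \<Delta> ^ (m ^ 3 + 3 * m ^ 2 + 2 * m) * n ^ (m ^ 3 + 5 * m ^ 2 + 6 * m + 1)"
  proof -
    have e1: "m * (m * m + 3 * m + 2) = m ^ 3 + 3 * m ^ 2 + 2 * m"
      by (simp add: algebra_simps power2_eq_square power3_eq_cube)
    have "M ^ (m * m + 3 * m + 2) = (n * \<Delta>) ^ (m ^ 3 + 3 * m ^ 2 + 2 * m)"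
      unfolding M_def power_mult[symmetric] e1 ..
    moreover have "m ^ 3 + 5 * m ^ 2 + 6 * m + 1 = (m ^ 3 + 3 * m ^ 2 + 2 * m) + (2 * m * m + 4 * m + 1)"
      by (simp add: power2_eq_square)
    moreover have "(4::nat) ^ m = 2 ^ (2 * m)" by (simp add: power_mult)
    ultimately show ?thesis by (simp only: power_mult_distrib power_add mult_ac)
  qed
  finally show ?thesis by linarith
qed

end

section \<open>Transfer to matrices and the input format\<close>

lemma Gcd_eq_1_nonzero:
  fixes X :: "int set"
  assumes "Gcd X = 1"
  shows "\<exists>x\<in>X. x \<noteq> 0"
  using assms by (metis Gcd_0_iff singletonI subsetI zero_neq_one)

theorem theorem2:
  "\<exists>(prog :: com) (C :: nat). \<forall>(m :: nat) (n :: nat) (A :: int mat) (b :: int vec) (c :: int vec).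
     1 \<le> m \<longrightarrow> 1 \<le> n \<longrightarrow>
     A \<in> carrier_mat m n \<longrightarrow> b \<in> carrier_vec m \<longrightarrow> c \<in> carrier_vec n \<longrightarrow>
     (\<forall>i < m. Gcd {A $$ (i, j) | j. j < n} = 1) \<longrightarrow>
     (\<exists>t s. exec prog (ip_input A b c) t s \<and>
            ip_correct A b c (ip_output n s) \<and>
            t \<le> C * (2 ^ (2 * m) * max_abs_entry A ^ (m ^ 3 + 3 * m ^ 2 + 2 * m)
                     * n ^ (m ^ 3 + 5 * m ^ 2 + 6 * m + 1)))"
proof (rule exI[of _ solve_ip], rule exI[of _ 8000], intro allI impI)
  fix m n :: nat and A :: "int mat" and b c :: "int vec"
  assume m: "1 \<le> m" and n: "1 \<le> n" and A: "A \<in> carrier_mat m n" and b: "b \<in> carrier_vec m" and c: "c \<in> carrier_vec n"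
    and gcd: "\<forall>i < m. Gcd {A $$ (i, j) | j. j < n} = 1"
  have dim: "dim_row A = m" "dim_col A = n" "dim_vec b = m" "dim_vec c = n" using A b c by auto
  let ?X = "{\<bar>A $$ (i, j)\<bar> | i j. i < dim_row A \<and> j < dim_col A}"
  have "?X = (\<lambda>(i, j). \<bar>A $$ (i, j)\<bar>) ` ({..<m} \<times> {..<n})" using dim by auto
  then have finX: "finite ?X" by simp
  have ne: "?X \<noteq> {}" using m n dim by fastforce
  define \<Delta> where "\<Delta> = max_abs_entry A"
  have "Max ?X \<in> ?X" using finX ne by (rule Max_in)
  then obtain i0 j0 where ij0: "i0 < m" "j0 < n" "Max ?X = \<bar>A $$ (i0, j0)\<bar>" using dim by auto
  then have max: "int \<Delta> = Max ?X" by (simp add: \<Delta>_def max_abs_entry_def)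
  have le: "\<bar>A $$ (i, j)\<bar> \<le> int \<Delta>" if "i < m" "j < n" for i j
    unfolding max using that dim finX by (intro Max_ge) auto
  \<comment> \<open>A row with greatest common divisor 1 is not the zero row; the first row is
    enough to show \<open>1 \<le> \<Delta>\<close>.\<close>
  have nonzero: "\<exists>i<m. \<exists>j<n. A $$ (i, j) \<noteq> 0"
    using Gcd_eq_1_nonzero[of "{A $$ (0, j) | j. j < n}"] gcd m by force
  have \<Delta>1: "1 \<le> \<Delta>"
  proof -
    obtain i j where "i < m" "j < n" "A $$ (i, j) \<noteq> 0" using nonzero by blast
    then show ?thesis using le[of i j] by linarith
  qed
  interpret integer_program m n "\<lambda>i j. A $$ (i, j)" "\<lambda>i. b $ i" "\<lambda>j. c $ j" \<Delta>
    by unfold_locales (use m n \<Delta>1 le nonzero in auto)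
  \<comment> \<open>In a single column each row consists of one entry, and greatest common divisor 1
    makes it 1 or -1.\<close>
  have n1: "\<Delta> = 1" if "n = 1"
  proof -
    have "{A $$ (i0, j) | j. j < n} = {A $$ (i0, 0)}" using that by auto
    then have "\<bar>A $$ (i0, 0)\<bar> = 1" using gcd ij0(1) by force
    then show ?thesis using max ij0 that by simp
  qed
  have feas: "x \<in> ip_feasible A b \<longleftrightarrow> x \<in> carrier_vec n \<and> feasible (\<lambda>j. x $ j)" for x
  proof -
    have "A *\<^sub>v x = b \<longleftrightarrow> (\<forall>i<m. lhs (\<lambda>j. x $ j) i = b $ i)" if "x \<in> carrier_vec n"
    proof -
      have "(A *\<^sub>v x) $ i = lhs (\<lambda>j. x $ j) i" if "i < m" for i
        using that dim \<open>x \<in> carrier_vec n\<close> by (simp add: lhs_def scalar_prod_def lessThan_atLeast0)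
      then show ?thesis using dim by (auto simp: vec_eq_iff)
    qed
    then show ?thesis using dim by (auto simp: ip_feasible_def feasible_def nonneg_def)
  qed
  have objective: "c \<bullet> x = obj (\<lambda>j. x $ j)" if "x \<in> carrier_vec n" for x
    using that by (simp add: scalar_prod_def obj_def lessThan_atLeast0)
  have vec: "vec n y \<in> ip_feasible A b" "c \<bullet> vec n y = obj y" if "feasible y" for y
  proof -
    show "vec n y \<in> ip_feasible A b"
      using that feasible_cong[of "\<lambda>j. vec n y $ j" y] by (simp add: feas)
    show "c \<bullet> vec n y = obj y"
      using obj_cong[of "\<lambda>j. vec n y $ j" y] by (simp add: objective)
  qed
  have entry: "ip_input A b c ''A'' (int k) = A $$ (k div n, k mod n)" if "k < m * n" for k
  proof -
    have "int k < int m * int n" using that by (simp flip: of_nat_mult)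
    then show ?thesis by (simp add: ip_input_def dim)
  qed
  have input: "stores_input (ip_input A b c)"
    unfolding stores_input_def
  proof (intro conjI allI impI)
    fix i j assume ij: "i < m" "j < n"
    have "int i * int n + int j = int (i * n + j)" by simp
    moreover have "i * n + j < m * n"
    proof -
      have "i * n + j < (i + 1) * n" using ij by simp
      also have "\<dots> \<le> m * n" using ij by (intro mult_right_mono) auto
      finally show ?thesis .
    qed
    moreover have "(i * n + j) div n = i" "(i * n + j) mod n = j" using ij by simp_all
    ultimately show "ip_input A b c ''A'' (int i * int n + int j) = A $$ (i, j)"
      using entry[of "i * n + j"] by (simp only:)
  qed (simp_all add: ip_input_def dim)
  have zero: "ip_input A b c a k = 0" if "a \<notin> {''m'', ''n'', ''A'', ''b'', ''c''}" for a k
    using that by (simp add: ip_input_def)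
  have "\<exists>i<m. \<exists>j<n. \<bar>A $$ (i, j)\<bar> = int \<Delta>" using ij0 max by auto
  from runs_solve_ip[OF input zero this] obtain t s where
    t: "exec solve_ip (ip_input A b c) t s" "t \<le> 2000 * (H * nat (G ^ r) * (m * n))" "solved s"
    unfolding runs_def by blast
  have "ip_correct A b c (ip_output n s)"
  proof -
    let ?x = "vector_at ''x'' s"
    consider "s ''status'' 0 = 0" | "s ''status'' 0 = 1" | "s ''status'' 0 \<noteq> 0" "s ''status'' 0 \<noteq> 1" by blast
    then show ?thesis
    proof cases
      case 1
      then have "\<nexists>x. feasible x" using t(3) by (simp add: solved_def)
      then show ?thesis using 1 by (auto simp: ip_output_def feas)
    next
      case 2
      then have x: "feasible ?x" "\<And>y. feasible y \<Longrightarrow> obj y \<le> obj ?x" using t(3) by (auto simp: solved_def)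
      have "c \<bullet> y \<le> c \<bullet> vec n ?x" if "y \<in> ip_feasible A b" for y
        using that x feas[of y] objective[of y] vec(2)[OF x(1)] by simp
      moreover have "ip_output n s = Optimal (vec n ?x)" using 2 by (simp add: ip_output_def vector_at_def[abs_def])
      ultimately show ?thesis using vec(1)[OF x(1)] by simp
    next
      case 3
      then have "\<exists>x. feasible x \<and> K < obj x" for K using t(3) by (simp add: solved_def)
      then have "\<exists>x\<in>ip_feasible A b. K < c \<bullet> x" for K using vec by metis
      then show ?thesis using 3 by (simp add: ip_output_def)
    qed
  qed
  \<comment> \<open>The constant is the product of 2000 from \<open>runs_solve_ip\<close> and 4 from
    \<open>time_bound\<close>.\<close>
  moreover have "t \<le> 8000 * (2 ^ (2 * m) * max_abs_entry A ^ (m ^ 3 + 3 * m ^ 2 + 2 * m) * n ^ (m ^ 3 + 5 * m ^ 2 + 6 * m + 1))"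
    using t(2) time_bound[OF n1] unfolding \<Delta>_def[symmetric] by linarith
  ultimately show "\<exists>t s. exec solve_ip (ip_input A b c) t s \<and> ip_correct A b c (ip_output n s) \<and>
      t \<le> 8000 * (2 ^ (2 * m) * max_abs_entry A ^ (m ^ 3 + 3 * m ^ 2 + 2 * m) * n ^ (m ^ 3 + 5 * m ^ 2 + 6 * m + 1))"
    using t(1) by blast
qed

end
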